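(* For every $\alpha>0$ there is a split torus $L\subset X_\alpha$ such that every Weinstein neighbourhood of $L$ contains a (and thus infinitely many) split torus $L'$ with $L\cong L'$ and $L\cap L'=\varnothing$.
   Context: Let $\omega_{S^2}$ be an area form on $S^2$ of total area $1$. For $\alpha>0$ let $X_\alpha=(S^2\times S^2,\omega_\alpha)$ with $\omega_\alpha=2(\alpha+1)\omega_{S^2}\oplus 2\alpha\,\omega_{S^2}$. In $S^2(a)=(S^2,a\omega_{S^2})$, for $h\in(-\frac a2,\frac a2)$, $S^1_h$ denotes the circle of constant height such that the annulus bounded by the equator and $S^1_h$ has signed symplectic area $h$. A split torus is $T(x,y)=S^1_x\times S^1_y\subset X_\alpha$ with $(x,y)\in(-1-\alpha,1+\alpha)\times(-\alpha,\alpha)$. $L\cong L'$ means that $\phi(L)=L'$ for some $\phi\in\mathrm{Ham}(X_\alpha)$. A Weinstein neighbourhood of $L$ is a neighbourhood of $L$ symplectomorphic to a neighbourhood of the zero section in $T^*L$, with $L$ corresponding to the zero section. *)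

theory Defs
  imports "HOL-Analysis.Analysis"
begin

section \<open>Smooth maps between subsets of Euclidean spaces\<close>

text \<open>All manifolds below are submanifolds of Euclidean spaces, possibly with boundary (the
  time interval), or open subsets of such.\<close>

text \<open>Only meaningful for open \<open>U\<close>, since the derivatives are taken in the ambient space.\<close>

primrec Ck_on :: "nat \<Rightarrow> 'a::euclidean_space set \<Rightarrow> ('a \<Rightarrow> 'b::real_normed_vector) \<Rightarrow> bool" where
  "Ck_on 0 U f \<longleftrightarrow> continuous_on U f"
| "Ck_on (Suc k) U f \<longleftrightarrow>
     (\<forall>x\<in>U. f differentiable (at x)) \<and> (\<forall>v. Ck_on k U (\<lambda>x. frechet_derivative f (at x) v))"

text \<open>Smoothness on an arbitrary subset: local existence of smooth extensions.\<close>

definition smooth_on :: "'a::euclidean_space set \<Rightarrow> ('a \<Rightarrow> 'b::real_normed_vector) \<Rightarrow> bool" where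
  "smooth_on M f \<longleftrightarrow>
     (\<forall>p\<in>M. \<exists>U g. open U \<and> p \<in> U \<and> (\<forall>k. Ck_on k U g) \<and> (\<forall>x\<in>M \<inter> U. g x = f x))"

definition smooth_curve_through ::
    "'a::euclidean_space set \<Rightarrow> 'a \<Rightarrow> 'a \<Rightarrow> (real \<Rightarrow> 'a) \<Rightarrow> bool" where
  "smooth_curve_through M p v \<gamma> \<longleftrightarrow>
     (\<exists>e>0. smooth_on {-e<..<e} \<gamma> \<and> \<gamma> ` {-e<..<e} \<subseteq> M) \<and>
     \<gamma> 0 = p \<and> (\<gamma> has_vector_derivative v) (at 0)"

definition tangent_space :: "'a::euclidean_space set \<Rightarrow> 'a \<Rightarrow> 'a set" where
  "tangent_space M p = {v. \<exists>\<gamma>. smooth_curve_through M p v \<gamma>}"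

text \<open>The differential at \<open>p\<close> of a map defined on \<open>M\<close>, applied to \<open>v \<in> tangent_space M p\<close>.\<close>

definition tangent_map ::
    "'a::euclidean_space set \<Rightarrow> ('a \<Rightarrow> 'b::real_normed_vector) \<Rightarrow> 'a \<Rightarrow> 'a \<Rightarrow> 'b" where
  "tangent_map M f p v =
     (THE w. \<forall>\<gamma>. smooth_curve_through M p v \<gamma> \<longrightarrow> ((f \<circ> \<gamma>) has_vector_derivative w) (at 0))"


section \<open>Symplectic notions\<close>

text \<open>A 2-form on \<open>M\<close> is a function taking a point and two vectors; only its values on points
  of \<open>M\<close> and vectors tangent to \<open>M\<close> matter.\<close>

type_synonym 'a two_form = "'a \<Rightarrow> 'a \<Rightarrow> 'a \<Rightarrow> real"

definition symplectomorphism ::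
    "'a::euclidean_space set \<Rightarrow> 'a two_form \<Rightarrow> 'b::euclidean_space set \<Rightarrow> 'b two_form \<Rightarrow>
     ('a \<Rightarrow> 'b) \<Rightarrow> bool" where
  "symplectomorphism M \<omega> N \<tau> f \<longleftrightarrow>
     bij_betw f M N \<and> smooth_on M f \<and> smooth_on N (inv_into M f) \<and>
     (\<forall>p\<in>M. \<forall>v\<in>tangent_space M p. \<forall>w\<in>tangent_space M p.
        \<tau> (f p) (tangent_map M f p v) (tangent_map M f p w) = \<omega> p v w)"

text \<open>Time-one maps of time-dependent Hamiltonian flows, with the convention
  \<open>\<omega>(X\<^sub>H, -) = dH\<close>. Replacing \<open>H\<close> by \<open>-H\<close> shows that the sign does not affect the
  resulting set. Maps are only constrained on \<open>M\<close>. On compact \<open>M\<close> no condition on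
  completeness or support is needed.\<close>

definition Ham :: "'a::euclidean_space set \<Rightarrow> 'a two_form \<Rightarrow> ('a \<Rightarrow> 'a) set" where
  "Ham M \<omega> = {\<phi>. \<exists>(H :: real \<Rightarrow> 'a \<Rightarrow> real) (\<psi> :: real \<Rightarrow> 'a \<Rightarrow> 'a).
     smooth_on ({0..1} \<times> M) (\<lambda>(t, x). H t x) \<and>
     (\<forall>p\<in>M. \<psi> 0 p = p \<and> \<psi> 1 p = \<phi> p) \<and>
     (\<forall>p\<in>M. \<forall>t\<in>{0..1}. \<psi> t p \<in> M \<and>
        (\<exists>V\<in>tangent_space M (\<psi> t p).
           (\<forall>w\<in>tangent_space M (\<psi> t p). \<omega> (\<psi> t p) V w = tangent_map M (H t) (\<psi> t p) w) \<and>
           ((\<lambda>s. \<psi> s p) has_vector_derivative V) (at t within {0..1})))}"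

definition ham_equiv :: "'a::euclidean_space set \<Rightarrow> 'a two_form \<Rightarrow> 'a set \<Rightarrow> 'a set \<Rightarrow> bool" where
  "ham_equiv M \<omega> L L' \<longleftrightarrow> (\<exists>\<phi>\<in>Ham M \<omega>. \<phi> ` L = L')"

text \<open>The cotangent bundle of a submanifold \<open>L\<close> of a Euclidean space \<open>E\<close>, embedded in
  \<open>E \<times> E\<close>: a covector at \<open>q\<close> is written uniquely as \<open>\<lambda>v. p \<bullet> v\<close> with \<open>p\<close> tangent to \<open>L\<close>
  at \<open>q\<close>. The tautological 1-form at \<open>(q, p)\<close> then sends \<open>(q', p')\<close> to \<open>p \<bullet> q'\<close>, i.e. it is the
  restriction of \<open>\<Sum> p\<^sub>i dq\<^sub>i\<close> on \<open>E \<times> E\<close>, and so its exterior derivative is the restriction of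
  \<open>\<Sum> dp\<^sub>i \<and> dq\<^sub>i\<close>. The opposite sign convention gives an isomorphic bundle, by \<open>p \<mapsto> -p\<close>.\<close>

definition cotangent_bundle :: "'a::euclidean_space set \<Rightarrow> ('a \<times> 'a) set" where
  "cotangent_bundle L = {(q, p). q \<in> L \<and> p \<in> tangent_space L q}"

definition canonical_form :: "('a::euclidean_space \<times> 'a) two_form" where
  "canonical_form z v w = snd v \<bullet> fst w - snd w \<bullet> fst v"

definition zero_section :: "'a::euclidean_space set \<Rightarrow> ('a \<times> 'a) set" where
  "zero_section L = {(q, 0) | q. q \<in> L}"

text \<open>Neighbourhoods are taken open, so that they are again submanifolds. The symplectomorphism
  maps \<open>L\<close> onto the zero section as a set.\<close>

definition weinstein_nbhd ::
    "'a::euclidean_space set \<Rightarrow> 'a two_form \<Rightarrow> 'a set \<Rightarrow> 'a set \<Rightarrow> bool" where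
  "weinstein_nbhd M \<omega> L W \<longleftrightarrow>
     openin (top_of_set M) W \<and> L \<subseteq> W \<and>
     (\<exists>N \<Psi>. openin (top_of_set (cotangent_bundle L)) N \<and> zero_section L \<subseteq> N \<and>
        symplectomorphism W \<omega> N canonical_form \<Psi> \<and> \<Psi> ` L = zero_section L)"


section \<open>Split tori in \<open>S\<^sup>2 \<times> S\<^sup>2\<close>\<close>

abbreviation S2 :: "(real^3) set" where
  "S2 \<equiv> sphere 0 1"

text \<open>The round area form of the unit sphere, oriented by the outward normal and divided by
  the total area \<open>4\<pi>\<close>.\<close>

definition area_form :: "(real^3) two_form" where
  "area_form p u v = (p \<bullet> cross3 u v) / (4 * pi)"

definition S2_param :: "real \<Rightarrow> real \<Rightarrow> real^3" where
  "S2_param \<theta> t = vector [cos \<theta> * cos t, sin \<theta> * cos t, sin t]"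

text \<open>The integral of \<open>a\<close> times the area form over the annulus between the equator and the
  circle of height \<open>c\<close>, in longitude and latitude. It is negative for \<open>c < 0\<close>, as
  the interval integral is oriented.\<close>

definition annulus_area :: "real \<Rightarrow> real \<Rightarrow> real" where
  "annulus_area a c = (LBINT t=ereal 0..ereal (arcsin c). (LBINT \<theta>=ereal 0..ereal (2 * pi).
     a * area_form (S2_param \<theta> t)
           (vector_derivative (\<lambda>s. S2_param s t) (at \<theta>))
           (vector_derivative (S2_param \<theta>) (at t))))"

definition height_circle :: "real \<Rightarrow> (real^3) set" where
  "height_circle c = {p \<in> S2. p $ 3 = c}"

definition level_circle :: "real \<Rightarrow> real \<Rightarrow> (real^3) set" where
  "level_circle a h = height_circle (THE c. c \<in> {-1<..<1} \<and> annulus_area a c = h)"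

lemma S2_param_eq:
  "S2_param \<theta> t = (cos \<theta> * cos t) *\<^sub>R axis 1 1 + (sin \<theta> * cos t) *\<^sub>R axis 2 1 + sin t *\<^sub>R axis 3 1"
  by (simp add: S2_param_def vec_eq_iff forall_3 axis_def)

lemma area_form_S2_param:
  "area_form (S2_param \<theta> t)
     (vector_derivative (\<lambda>s. S2_param s t) (at \<theta>))
     (vector_derivative (S2_param \<theta>) (at t)) = cos t / (4 * pi)"
proof -
  have 1: "vector_derivative (\<lambda>s. S2_param s t) (at \<theta>) =
      (- sin \<theta> * cos t) *\<^sub>R axis 1 1 + (cos \<theta> * cos t) *\<^sub>R axis 2 1"
    unfolding S2_param_eq
    by (rule vector_derivative_at) (auto intro!: derivative_eq_intros simp: mult.commute)
  have 2: "vector_derivative (S2_param \<theta>) (at t) =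
      (- cos \<theta> * sin t) *\<^sub>R axis 1 1 + (- sin \<theta> * sin t) *\<^sub>R axis 2 1 + cos t *\<^sub>R axis 3 1"
    unfolding S2_param_eq
    by (rule vector_derivative_at) (auto intro!: derivative_eq_intros simp: mult.commute)
  have "S2_param \<theta> t \<bullet> cross3 (vector_derivative (\<lambda>s. S2_param s t) (at \<theta>))
      (vector_derivative (S2_param \<theta>) (at t)) =
      cos t * (((cos \<theta>)\<^sup>2 + (sin \<theta>)\<^sup>2) * ((cos t)\<^sup>2 + (sin t)\<^sup>2))"
    unfolding 1 2
    by (simp add: S2_param_def cross3_def inner_vec_def sum_3 axis_def power2_eq_square algebra_simps
        del: sin_cos_squared_add sin_cos_squared_add2 sin_cos_squared_add3)
  then show ?thesis by (simp add: area_form_def)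
qed

lemma annulus_area_eq:
  assumes "c \<in> {-1..1}"
  shows "annulus_area a c = a * c / 2"
proof -
  have "annulus_area a c = (LBINT t=ereal 0..ereal (arcsin c). a / 2 * cos t)"
    unfolding annulus_area_def area_form_S2_param by simp
  also have "\<dots> = a / 2 * sin (arcsin c) - a / 2 * sin 0"
    by (rule interval_integral_FTC_finite)
      (auto intro!: continuous_intros derivative_eq_intros
        simp flip: has_real_derivative_iff_has_vector_derivative)
  finally show ?thesis using assms by simp
qed

lemma level_circle_eq:
  assumes "a > 0" "h \<in> {-a/2<..<a/2}"
  shows "level_circle a h = {p \<in> S2. p $ 3 = 2 * h / a}"
proof -
  have "(THE c. c \<in> {-1<..<1} \<and> annulus_area a c = h) = 2 * h / a"
    using assms by (intro the_equality) (auto simp: annulus_area_eq field_simps)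
  then show ?thesis by (simp add: level_circle_def height_circle_def)
qed

definition S2xS2 :: "((real^3) \<times> (real^3)) set" where
  "S2xS2 = S2 \<times> S2"

definition omega :: "real \<Rightarrow> ((real^3) \<times> (real^3)) two_form" where
  "omega \<alpha> p v w = 2 * (\<alpha> + 1) * area_form (fst p) (fst v) (fst w) +
                 2 * \<alpha> * area_form (snd p) (snd v) (snd w)"

definition split_torus :: "real \<Rightarrow> real \<Rightarrow> real \<Rightarrow> ((real^3) \<times> (real^3)) set" where
  "split_torus \<alpha> x y = level_circle (2 * (\<alpha> + 1)) x \<times> level_circle (2 * \<alpha>) y"

definition split_tori :: "real \<Rightarrow> ((real^3) \<times> (real^3)) set set" where
  "split_tori \<alpha> = {split_torus \<alpha> x y | x y. x \<in> {-1 - \<alpha><..<1 + \<alpha>} \<and> y \<in> {-\<alpha><..<\<alpha>}}"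

end

theory Submission
  imports Defs
begin

text \<open>The moment image of \<open>X\<^sub>\<alpha>\<close> is the rectangle \<open>(-1 - \<alpha>, 1 + \<alpha>) \<times> (-\<alpha>, \<alpha>)\<close>. Explicit Hamiltonian
  flows identify the tori over points that are symmetric on a symmetric probe: besides the two
  reflections of the rectangle, there is the shear \<open>(x, y) \<mapsto> (x - 2y, -y)\<close> for \<open>\<bar>x - y\<bar> < 1\<close> (probes
  of direction (1,1) from the bottom to the top edge) and the swap \<open>(x, y) \<mapsto> (1 + y, x - 1)\<close> for
  \<open>x + y > 1\<close> (probes of direction (1,-1) cutting off a corner). On the segment \<open>\<bar>x\<bar> < 1 + y\<close> at
  fixed height \<open>y > 0\<close> these moves combine to \<open>x \<mapsto> x + 2\<close> for \<open>x < y - 1\<close> and \<open>x \<mapsto> x - 2y\<close> for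
  \<open>x > y - 1\<close>, which is the rotation by 2 of a circle of length \<open>2 + 2y\<close>. For irrational \<open>y\<close> the orbit
  of \<open>x = 0\<close> accumulates at 0 by Dirichlet's approximation theorem, whereas any neighbourhood of \<open>T(0, y)\<close>
  contains \<open>T(x, y)\<close> for all small \<open>x\<close>.\<close>

section \<open>Calculus of smooth functions\<close>

text \<open>The two branches x + 2 and x - 2y differ by the length of the circle, and they meet at x
  = y - 1, a point on the boundary of the range of both the swap and the shear, where neither
  applies. Irrationality of y therefore works twice: it keeps the orbit of 0 off this break point,
  and it prevents a return to 0 itself. The obstacle is that \<open>Ham\<close> demands a
  Hamiltonian that is smooth on all of \<open>S2xS2\<close> and in time, whereas a symmetric probe
  only provides a rotation of the reduced spaces near one level, generated by a function that may be
  singular at poles. Multiplying that function by a cut-off of the level makes it global. Since the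
  level is conserved, the flow stays explicit: the cut-off only changes the speed and adds a drift
  along the circle orbits, and the drift vanishes on the level of the torus because the cut-off is
  critical there. The formulas can then be checked by differentiating them, without existence theory
  for differential equations.\<close>

lemma Ck_on_cong:
  assumes "open U" "\<And>x. x \<in> U \<Longrightarrow> f x = g x"
  shows "Ck_on k U f \<longleftrightarrow> Ck_on k U g"
  using assms(2)
proof (induction k arbitrary: f g)
  case 0
  then show ?case by (simp cong: continuous_on_cong)
next
  case (Suc k)
  have fr: "(f has_derivative D) (at x) \<longleftrightarrow> (g has_derivative D) (at x)" if "x \<in> U" for x D
    using Suc.prems assms(1) that
    by (metis has_derivative_transform_within_open)
  have "f differentiable (at x) \<longleftrightarrow> g differentiable (at x)"
    "frechet_derivative f (at x) = frechet_derivative g (at x)" if "x \<in> U" for x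
    using fr[OF that] by (simp_all add: differentiable_def frechet_derivative_def)
  moreover from this(2) have "Ck_on k U (\<lambda>x. frechet_derivative f (at x) v) \<longleftrightarrow>
      Ck_on k U (\<lambda>x. frechet_derivative g (at x) v)" for v
    by (intro Suc.IH) simp
  ultimately show ?case by simp
qed

lemma Ck_on_subset: "Ck_on k U f \<Longrightarrow> V \<subseteq> U \<Longrightarrow> Ck_on k V f"
  by (induction k arbitrary: f) (auto intro: continuous_on_subset)

lemma Ck_on_SucI:
  assumes "open U" "\<And>x. x \<in> U \<Longrightarrow> (f has_derivative f' x) (at x)"
    "\<And>v. Ck_on k U (\<lambda>x. f' x v)"
  shows "Ck_on (Suc k) U f"
proof -
  have "frechet_derivative f (at x) = f' x" if "x \<in> U" for x
    using assms(2)[OF that] by (rule frechet_derivative_at[symmetric])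
  then have "Ck_on k U (\<lambda>x. frechet_derivative f (at x) v)" for v
    using assms(3)[of v] by (subst Ck_on_cong[OF assms(1)]) auto
  with assms(2) show ?thesis by (auto simp: differentiable_def)
qed

lemma Ck_on_SucD:
  assumes "Ck_on (Suc k) U f" "x \<in> U"
  shows "(f has_derivative frechet_derivative f (at x)) (at x)"
  using assms by (simp add: frechet_derivative_works)

lemma Ck_on_Suc_imp: "Ck_on (Suc k) U f \<Longrightarrow> Ck_on k U f"
proof (induction k arbitrary: f)
  case 0
  then show ?case
    by (auto intro!: continuous_at_imp_continuous_on differentiable_imp_continuous_within)
next
  case (Suc k)
  then show ?case by (metis Ck_on.simps(2))
qed

lemma Ck_on_const: "open U \<Longrightarrow> Ck_on k U (\<lambda>x. c)"
proof (induction k arbitrary: c)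
  case (Suc k)
  show ?case by (rule Ck_on_SucI[where f' = "\<lambda>x v. 0"]) (use Suc in auto)
qed simp

lemma Ck_on_bounded_linear:
  assumes "bounded_linear L" "open U" "Ck_on k U f"
  shows "Ck_on k U (\<lambda>x. L (f x))"
  using assms(3)
proof (induction k arbitrary: f)
  case 0
  then show ?case using bounded_linear.continuous_on[OF assms(1)] by simp
next
  case (Suc k)
  show ?case
  proof (rule Ck_on_SucI[OF assms(2)])
    show "((\<lambda>x. L (f x)) has_derivative (\<lambda>v. L (frechet_derivative f (at x) v))) (at x)"
      if "x \<in> U" for x
      by (rule bounded_linear.has_derivative[OF assms(1) Ck_on_SucD[OF Suc.prems that]])
    show "Ck_on k U (\<lambda>x. L (frechet_derivative f (at x) v))" for v
      using Suc.prems by (intro Suc.IH) simp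
  qed
qed

lemma Ck_on_add:
  assumes "open U" "Ck_on k U f" "Ck_on k U g"
  shows "Ck_on k U (\<lambda>x. f x + g x)"
  using assms(2,3)
proof (induction k arbitrary: f g)
  case 0
  then show ?case by (auto intro: continuous_on_add)
next
  case (Suc k)
  show ?case
  proof (rule Ck_on_SucI[OF assms(1)])
    show "((\<lambda>x. f x + g x) has_derivative
        (\<lambda>v. frechet_derivative f (at x) v + frechet_derivative g (at x) v)) (at x)"
      if "x \<in> U" for x
      by (intro has_derivative_add Ck_on_SucD[OF Suc.prems(1) that] Ck_on_SucD[OF Suc.prems(2) that])
    show "Ck_on k U (\<lambda>x. frechet_derivative f (at x) v + frechet_derivative g (at x) v)" for v
      using Suc.prems by (intro Suc.IH) simp_all
  qed
qed

lemma Ck_on_sum: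
  assumes "open U" "\<And>i. i \<in> I \<Longrightarrow> Ck_on k U (f i)"
  shows "Ck_on k U (\<lambda>x. \<Sum>i\<in>I. f i x)"
  using assms(2)
  by (induction I rule: infinite_finite_induct) (auto intro!: Ck_on_const Ck_on_add assms(1))

lemma Ck_on_bounded_bilinear:
  assumes "bounded_bilinear B" "open U" "Ck_on k U f" "Ck_on k U g"
  shows "Ck_on k U (\<lambda>x. B (f x) (g x))"
  using assms(3,4)
proof (induction k arbitrary: f g)
  case 0
  then show ?case using bounded_bilinear.continuous_on[OF assms(1)] by simp
next
  case (Suc k)
  show ?case
  proof (rule Ck_on_SucI[OF assms(2)])
    show "((\<lambda>x. B (f x) (g x)) has_derivative (\<lambda>v. B (f x) (frechet_derivative g (at x) v) +
        B (frechet_derivative f (at x) v) (g x))) (at x)" if "x \<in> U" for x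
      by (intro bounded_bilinear.FDERIV[OF assms(1)] Ck_on_SucD[OF Suc.prems(1) that]
          Ck_on_SucD[OF Suc.prems(2) that])
    show "Ck_on k U (\<lambda>x. B (f x) (frechet_derivative g (at x) v) +
        B (frechet_derivative f (at x) v) (g x))" for v
      using Suc.prems Ck_on_Suc_imp[OF Suc.prems(1)] Ck_on_Suc_imp[OF Suc.prems(2)]
      by (intro Ck_on_add[OF assms(2)] Suc.IH) simp_all
  qed
qed

text \<open>In the chain rule the direction fed to the derivative of \<open>f\<close> moves with the
  point, so the induction hypothesis does not apply to it directly. Expanding that direction in
  \<open>Basis\<close> leaves products of scalar coefficients with derivatives of \<open>f\<close>
  in fixed directions.\<close>

lemma Ck_on_compose:
  fixes f :: "'b::euclidean_space \<Rightarrow> 'c::real_normed_vector"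
  assumes "open U" "open V" "Ck_on k U g" "Ck_on k V f" "g ` U \<subseteq> V"
  shows "Ck_on k U (\<lambda>x. f (g x))"
  using assms(3,4)
proof (induction k arbitrary: f)
  case 0
  then show ?case using assms(5) by (auto intro: continuous_on_compose2)
next
  case (Suc k)
  show ?case
  proof (rule Ck_on_SucI[OF assms(1)])
    fix x assume x: "x \<in> U"
    have f: "(f has_derivative frechet_derivative f (at (g x))) (at (g x))"
      using assms(5) x by (intro Ck_on_SucD[OF Suc.prems(2)]) auto
    have "((\<lambda>x. f (g x)) has_derivative
        (\<lambda>v. frechet_derivative f (at (g x)) (frechet_derivative g (at x) v))) (at x)"
      by (rule has_derivative_compose[OF Ck_on_SucD[OF Suc.prems(1) x] f])
    also have "(\<lambda>v. frechet_derivative f (at (g x)) (frechet_derivative g (at x) v)) =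
        (\<lambda>v. \<Sum>b\<in>Basis. (frechet_derivative g (at x) v \<bullet> b) *\<^sub>R frechet_derivative f (at (g x)) b)"
    proof
      fix v
      interpret linear "frechet_derivative f (at (g x))"
        using f by (rule has_derivative_linear)
      show "frechet_derivative f (at (g x)) (frechet_derivative g (at x) v) =
        (\<Sum>b\<in>Basis. (frechet_derivative g (at x) v \<bullet> b) *\<^sub>R frechet_derivative f (at (g x)) b)"
        by (subst euclidean_representation[symmetric, of "frechet_derivative g (at x) v"])
          (simp add: sum scale)
    qed
    finally show "((\<lambda>x. f (g x)) has_derivative (\<lambda>v. \<Sum>b\<in>Basis.
      (frechet_derivative g (at x) v \<bullet> b) *\<^sub>R frechet_derivative f (at (g x)) b)) (at x)" .
  next
    fix v
    show "Ck_on k U (\<lambda>x. \<Sum>b\<in>Basis.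
        (frechet_derivative g (at x) v \<bullet> b) *\<^sub>R frechet_derivative f (at (g x)) b)"
    proof (intro Ck_on_sum[OF assms(1)] Ck_on_bounded_bilinear[OF bounded_bilinear_scaleR assms(1)])
      fix b :: 'b
      show "Ck_on k U (\<lambda>x. frechet_derivative g (at x) v \<bullet> b)"
        using Suc.prems(1) by (intro Ck_on_bounded_linear[OF bounded_linear_inner_left assms(1)]) simp
      show "Ck_on k U (\<lambda>x. frechet_derivative f (at (g x)) b)"
        using Suc.prems Ck_on_Suc_imp[OF Suc.prems(1)] by (intro Suc.IH) simp_all
    qed
  qed
qed

text \<open>Bundling openness with the conditions of all orders lets sums, products and linear
  images chain without side conditions.\<close>

definition Cinf_on :: "'a::euclidean_space set \<Rightarrow> ('a \<Rightarrow> 'b::real_normed_vector) \<Rightarrow> bool" where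
  "Cinf_on U f \<longleftrightarrow> open U \<and> (\<forall>k. Ck_on k U f)"

lemma Cinf_on_linear: "open U \<Longrightarrow> bounded_linear L \<Longrightarrow> Cinf_on U L"
proof -
  assume *: "open U" "bounded_linear L"
  have "Ck_on k U (\<lambda>x. x)" for k
  proof (cases k)
    case (Suc j)
    show ?thesis unfolding Suc
      by (rule Ck_on_SucI[where f' = "\<lambda>x v. v"]) (auto intro: * Ck_on_const)
  qed simp
  from Ck_on_bounded_linear[OF *(2,1) this] show ?thesis
    using * by (simp add: Cinf_on_def)
qed

lemma Cinf_on_const: "open U \<Longrightarrow> Cinf_on U (\<lambda>x. c)"
  by (simp add: Cinf_on_def Ck_on_const)

lemma Cinf_on_add: "Cinf_on U f \<Longrightarrow> Cinf_on U g \<Longrightarrow> Cinf_on U (\<lambda>x. f x + g x)"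
  by (simp add: Cinf_on_def Ck_on_add)

lemma Cinf_on_bounded_linear: "bounded_linear L \<Longrightarrow> Cinf_on U f \<Longrightarrow> Cinf_on U (\<lambda>x. L (f x))"
  by (simp add: Cinf_on_def Ck_on_bounded_linear)

lemma Cinf_on_minus: "Cinf_on U f \<Longrightarrow> Cinf_on U (\<lambda>x. - f x)"
  by (rule Cinf_on_bounded_linear[OF bounded_linear_minus[OF bounded_linear_ident]])

lemma Cinf_on_diff: "Cinf_on U f \<Longrightarrow> Cinf_on U g \<Longrightarrow> Cinf_on U (\<lambda>x. f x - g x)"
  using Cinf_on_add[OF _ Cinf_on_minus, of U f g] by simp

lemma Cinf_on_scaleR: "Cinf_on U f \<Longrightarrow> Cinf_on U g \<Longrightarrow> Cinf_on U (\<lambda>x. f x *\<^sub>R g x)"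
  by (simp add: Cinf_on_def Ck_on_bounded_bilinear bounded_bilinear_scaleR)

lemma Cinf_on_mult:
  fixes f g :: "'a::euclidean_space \<Rightarrow> real"
  shows "Cinf_on U f \<Longrightarrow> Cinf_on U g \<Longrightarrow> Cinf_on U (\<lambda>x. f x * g x)"
  by (simp add: Cinf_on_def Ck_on_bounded_bilinear bounded_bilinear_mult)

lemma Cinf_on_Pair: "Cinf_on U f \<Longrightarrow> Cinf_on U g \<Longrightarrow> Cinf_on U (\<lambda>x. (f x, g x))"
  using Cinf_on_add[OF Cinf_on_bounded_linear[OF bounded_linear_Pair[OF bounded_linear_ident
        bounded_linear_zero], of U f] Cinf_on_bounded_linear[OF bounded_linear_Pair[OF
        bounded_linear_zero bounded_linear_ident], of U g]]
  by simp

lemma Cinf_on_compose: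
  fixes f :: "'b::euclidean_space \<Rightarrow> 'c::real_normed_vector"
  shows "Cinf_on V f \<Longrightarrow> Cinf_on U g \<Longrightarrow> g ` U \<subseteq> V \<Longrightarrow> Cinf_on U (\<lambda>x. f (g x))"
  unfolding Cinf_on_def using Ck_on_compose by blast

lemma Cinf_on_subset: "Cinf_on U f \<Longrightarrow> V \<subseteq> U \<Longrightarrow> open V \<Longrightarrow> Cinf_on V f"
  unfolding Cinf_on_def using Ck_on_subset by blast

lemma Cinf_on_has_derivative:
  assumes "Cinf_on U f" "x \<in> U"
  shows "(f has_derivative frechet_derivative f (at x)) (at x)"
  using assms Ck_on_SucD unfolding Cinf_on_def by blast

lemma Cinf_on_frechet_derivative:
  assumes "Cinf_on U f"
  shows "Cinf_on U (\<lambda>x. frechet_derivative f (at x) v)"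
  using assms unfolding Cinf_on_def by (metis Ck_on.simps(2))

text \<open>Induction on the order, for the whole family at once: the derivative of a member is
  again a member, so higher derivatives never have to be written down. The families in question are
  the multiples of real powers and the functions \<open>flat Q\<close>.\<close>

lemma Cinf_on_real_family:
  fixes F :: "(real \<Rightarrow> real) set"
  assumes "open U"
    and "\<And>f. f \<in> F \<Longrightarrow> \<exists>f'\<in>F. \<forall>x\<in>U. (f has_real_derivative f' x) (at x)"
    and "f \<in> F"
  shows "Cinf_on U f"
proof -
  have "Ck_on k U f" for k
    using assms(3)
  proof (induction k arbitrary: f)
    case 0
    from assms(2)[OF this] show ?case
      by (auto intro!: continuous_at_imp_continuous_on DERIV_isCont)
  next
    case (Suc k)
    from assms(2)[OF Suc.prems] obtain f' where f': "f' \<in> F"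
      "\<And>x. x \<in> U \<Longrightarrow> (f has_derivative (\<lambda>v. f' x * v)) (at x)"
      by (auto simp: has_field_derivative_def)
    show ?case
      by (rule Ck_on_SucI[OF assms(1) f'(2)])
        (simp_all add: Ck_on_bounded_linear[OF bounded_linear_mult_left assms(1)] Suc.IH f'(1))
  qed
  then show ?thesis using assms(1) by (simp add: Cinf_on_def)
qed

lemma Cinf_on_powr: "Cinf_on {0<..} (\<lambda>x::real. x powr a)"
proof (rule Cinf_on_real_family[where F = "{\<lambda>x. c * x powr a | c a. True}"])
  fix f :: "real \<Rightarrow> real" assume "f \<in> {\<lambda>x. c * x powr a | c a. True}"
  then obtain c a where f: "f = (\<lambda>x. c * x powr a)" by blast
  have "\<forall>x\<in>{0<..}. (f has_real_derivative c * a * x powr (a - 1)) (at x)"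
    unfolding f by (auto intro!: derivative_eq_intros simp: powr_diff)
  then show "\<exists>f'\<in>{\<lambda>x. c * x powr a | c a. True}. \<forall>x\<in>{0<..}. (f has_real_derivative f' x) (at x)"
    by (intro bexI[of _ "\<lambda>x. c * a * x powr (a - 1)"]) auto
next
  show "(\<lambda>x. x powr a) \<in> {\<lambda>x. c * x powr a | c a. True}"
    by (intro CollectI exI[of _ 1] exI[of _ a]) simp
qed simp

lemma smooth_onI:
  assumes "\<And>p. p \<in> M \<Longrightarrow> \<exists>U. p \<in> U \<and> Cinf_on U f"
  shows "smooth_on M f"
  using assms unfolding smooth_on_def Cinf_on_def by metis

section \<open>Flat functions\<close>

text \<open>The functions \<open>Q(1/x) exp(-1/x)\<close>, extended by zero, form a family closed under
  differentiation.\<close>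

definition flat :: "real poly \<Rightarrow> real \<Rightarrow> real" where
  "flat Q x = (if x > 0 then poly Q (inverse x) * exp (- inverse x) else 0)"

text \<open>The free exponent \<open>k\<close> absorbs the factor x that appears when the constant
  coefficient of \<open>Q\<close> is split off.\<close>

lemma tendsto_poly_div_exp_0: "((\<lambda>x::real. x ^ k * poly Q x / exp x) \<longlongrightarrow> 0) at_top"
proof (induction Q arbitrary: k)
  case (pCons a Q)
  have "((\<lambda>x. a * (x ^ k / exp x) + x ^ Suc k * poly Q x / exp x) \<longlongrightarrow> a * 0 + 0) at_top"
    by (intro tendsto_intros tendsto_power_div_exp_0 pCons.IH)
  then show ?case by (simp add: algebra_simps add_divide_distrib)
qed simp

text \<open>With t = 1/x one has dt/dx = -t^2, and the exponential contributes a factor t^2, which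
  gives the polynomial t^2 (Q - Q'). At 0 the right difference quotient is t Q(t) exp(-t) with t
  tending to infinity.\<close>

lemma flat_has_real_derivative:
  "(flat Q has_real_derivative flat ([:0, 0, 1:] * (Q - pderiv Q)) x) (at x)"
proof -
  consider "x > 0" | "x < 0" | "x = 0" by linarith
  then show ?thesis
  proof cases
    case 1
    have "((\<lambda>x. poly Q (inverse x) * exp (- inverse x)) has_real_derivative
        flat ([:0, 0, 1:] * (Q - pderiv Q)) x) (at x)"
      using 1 by (auto intro!: derivative_eq_intros simp: flat_def field_simps power2_eq_square)
    then show ?thesis
      by (rule has_field_derivative_transform_within[where d = x]) (use 1 in \<open>auto simp: flat_def dist_real_def\<close>)
  next
    case 2
    have "((\<lambda>x. 0) has_real_derivative 0) (at x)" by simp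
    then have "(flat Q has_real_derivative 0) (at x)"
      by (rule has_field_derivative_transform_within[where d = "- x"])
        (use 2 in \<open>auto simp: flat_def dist_real_def\<close>)
    then show ?thesis using 2 by (simp add: flat_def)
  next
    case 3
    have "((\<lambda>x. inverse x ^ 1 * poly Q (inverse x) / exp (inverse x)) \<longlongrightarrow> 0) (at_right (0::real))"
      by (rule filterlim_compose[OF tendsto_poly_div_exp_0 filterlim_inverse_at_top_right])
    then have "((\<lambda>h. flat Q h / h) \<longlongrightarrow> 0) (at_right 0)"
      by (rule Lim_transform_eventually)
        (auto simp: flat_def eventually_at_filter exp_minus field_simps)
    moreover have "((\<lambda>h. flat Q h / h) \<longlongrightarrow> 0) (at_left 0)"
      by (rule tendsto_eventually) (auto simp: flat_def eventually_at_filter)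
    ultimately have "((\<lambda>h. flat Q h / h) \<longlongrightarrow> 0) (at 0)"
      by (simp add: filterlim_split_at)
    then show ?thesis using 3 by (simp add: DERIV_def flat_def)
  qed
qed

lemma Cinf_on_flat: "Cinf_on UNIV (flat Q)"
  by (rule Cinf_on_real_family[where F = "range flat"]) (use flat_has_real_derivative in auto)

text \<open>This is the cut-off of the levels of a probe. It is even about \<open>c0\<close>, hence
  critical there; on the central level the flow is then a rigid rotation at unit speed without
  drift.\<close>

lemma bump_exists:
  fixes c0 \<epsilon> :: real
  assumes "\<epsilon> > 0"
  obtains \<rho> \<rho>' where "Cinf_on UNIV \<rho>" "\<And>c. (\<rho> has_real_derivative \<rho>' c) (at c)"
    "\<And>c. \<bar>c - c0\<bar> \<ge> \<epsilon> \<Longrightarrow> \<rho> c = 0" "\<And>c. \<bar>c - c0\<bar> \<ge> \<epsilon> \<Longrightarrow> \<rho>' c = 0" "\<rho> c0 = 1" "\<rho>' c0 = 0"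
proof
  define K where "K = flat 1 (\<epsilon>\<^sup>2)"
  have K: "K > 0" using assms by (simp add: K_def flat_def)
  define f where "f c = flat 1 (\<epsilon>\<^sup>2 - (c - c0)\<^sup>2)" for c
  define \<rho> where "\<rho> c = f c / K" for c
  define \<rho>' where "\<rho>' c = flat [:0, 0, 1:] (\<epsilon>\<^sup>2 - (c - c0)\<^sup>2) * (- 2 * (c - c0)) / K" for c
  have id: "Cinf_on UNIV (\<lambda>c::real. c)" by (intro Cinf_on_linear) auto
  have "Cinf_on UNIV (\<lambda>c. \<epsilon>\<^sup>2 - (c - c0)\<^sup>2)"
    unfolding power2_eq_square by (intro Cinf_on_diff Cinf_on_mult Cinf_on_const id) auto
  then have "Cinf_on UNIV f"
    unfolding f_def by (intro Cinf_on_compose[OF Cinf_on_flat]) auto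
  then show "Cinf_on UNIV \<rho>"
    unfolding \<rho>_def divide_inverse by (intro Cinf_on_mult Cinf_on_const) auto
  show "(\<rho> has_real_derivative \<rho>' c) (at c)" for c
    unfolding \<rho>_def f_def \<rho>'_def
    by (auto intro!: derivative_eq_intros DERIV_chain2[OF flat_has_real_derivative] simp: pderiv_1
        less_imp_neq[OF K, symmetric])
  show "\<rho> c = 0" "\<rho>' c = 0" if "\<bar>c - c0\<bar> \<ge> \<epsilon>" for c
  proof -
    have "\<epsilon>\<^sup>2 \<le> (c - c0)\<^sup>2" using that assms by (simp flip: abs_le_square_iff)
    then show "\<rho> c = 0" "\<rho>' c = 0" by (simp_all add: \<rho>_def \<rho>'_def f_def flat_def)
  qed
  have "f c0 = K" by (simp add: f_def K_def)
  then show "\<rho> c0 = 1" using K by (simp add: \<rho>_def)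
  show "\<rho>' c0 = 0" by (simp add: \<rho>'_def)
qed

text \<open>The usual quotient e(t) / (e(t) + e(1 - t)) with e = \<open>flat 1\<close>. It
  reparametrises the time of a flow, and smoothness is asked of \<beta>' because \<beta>' is what
  then multiplies the Hamiltonian.\<close>

lemma smooth_step_exists:
  obtains \<beta> \<beta>' :: "real \<Rightarrow> real" where "Cinf_on UNIV \<beta>'" "\<And>t. (\<beta> has_real_derivative \<beta>' t) (at t)"
    "\<And>t. t \<le> 0 \<Longrightarrow> \<beta> t = 0" "\<And>t. t \<ge> 1 \<Longrightarrow> \<beta> t = 1"
    "\<And>t. t \<notin> {0..1} \<Longrightarrow> \<beta>' t = 0"
proof -
  define N where "N t = flat 1 t + flat 1 (1 - t)" for t
  have N: "N t > 0" for t by (auto simp: N_def flat_def add_pos_nonneg add_nonneg_pos)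
  define \<beta> where "\<beta> t = flat 1 t * N t powr (- 1)" for t
  have id: "Cinf_on UNIV (\<lambda>c::real. c)" by (intro Cinf_on_linear) auto
  have "Cinf_on UNIV (\<lambda>t. flat 1 (1 - t))"
    by (intro Cinf_on_compose[OF Cinf_on_flat] Cinf_on_diff Cinf_on_const id) auto
  then have "Cinf_on UNIV N"
    unfolding N_def by (intro Cinf_on_add Cinf_on_flat)
  then have "Cinf_on UNIV \<beta>"
    unfolding \<beta>_def
    by (intro Cinf_on_mult Cinf_on_flat Cinf_on_compose[OF Cinf_on_powr]) (use N in auto)
  note * = Cinf_on_frechet_derivative[OF this, of 1] Cinf_on_has_derivative[OF this]
  have D: "(\<beta> has_real_derivative frechet_derivative \<beta> (at t) 1) (at t)" for t
  proof -
    have D: "(\<beta> has_derivative frechet_derivative \<beta> (at t)) (at t)" using *(2) by simp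
    have "frechet_derivative \<beta> (at t) v = frechet_derivative \<beta> (at t) 1 * v" for v
      using linear_scale[OF has_derivative_linear[OF D], of v 1]
      by (simp only: real_scaleR_def mult_1_right mult.commute[of _ v])
    then have "frechet_derivative \<beta> (at t) = (*) (frechet_derivative \<beta> (at t) 1)" by (rule ext)
    with D show ?thesis by (simp add: has_field_derivative_def)
  qed
  have 0: "\<beta> t = 0" if "t \<le> 0" for t using that by (simp add: \<beta>_def flat_def)
  have 1: "\<beta> t = 1" if "t \<ge> 1" for t
  proof -
    have "N t = flat 1 t" using that by (simp add: N_def flat_def)
    then show "\<beta> t = 1" using N[of t] by (simp add: \<beta>_def powr_minus field_simps)
  qed
  have "frechet_derivative \<beta> (at t) 1 = 0" if "t \<notin> {0..1}" for t :: real
  proof (cases "t < 0")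
    case True
    have "(\<beta> has_real_derivative 0) (at t)"
      by (rule has_field_derivative_transform_within_open[where S = "{..<0}" and f = "\<lambda>_. 0"])
        (use True 0 in auto)
    then show ?thesis by (rule DERIV_unique[OF D])
  next
    case False
    have "(\<beta> has_real_derivative 0) (at t)"
      by (rule has_field_derivative_transform_within_open[where S = "{1<..}" and f = "\<lambda>_. 1"])
        (use False that 1 in auto)
    then show ?thesis by (rule DERIV_unique[OF D])
  qed
  from that[OF *(1) D 0 1 this] show ?thesis .
qed

section \<open>Smoothness on arbitrary subsets, through local extensions\<close>

lemma smooth_on_compose:
  fixes f :: "'b::euclidean_space \<Rightarrow> 'c::real_normed_vector"
  assumes f: "smooth_on N f" and g: "Cinf_on UNIV g" and "g ` M \<subseteq> N"
  shows "smooth_on M (\<lambda>x. f (g x))"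
  unfolding smooth_on_def
proof
  fix p assume "p \<in> M"
  with assms(3) have "g p \<in> N" by auto
  with f obtain U h where U: "open U" "g p \<in> U" "\<forall>k. Ck_on k U h" "\<forall>x\<in>N \<inter> U. h x = f x"
    unfolding smooth_on_def by blast
  have "continuous_on UNIV g" using g by (auto simp: Cinf_on_def dest: spec[of _ 0])
  then have *: "open (g -` U)" using U(1) by (simp add: continuous_on_open_vimage)
  have "Cinf_on (g -` U) (\<lambda>x. h (g x))"
    by (rule Cinf_on_compose[where V = U]) (use U * Cinf_on_subset[OF g] in \<open>auto simp: Cinf_on_def\<close>)
  then show "\<exists>U h. open U \<and> p \<in> U \<and> (\<forall>k. Ck_on k U h) \<and> (\<forall>x\<in>M \<inter> U. h x = f (g x))"
    using U * assms(3)
    by (intro exI[of _ "g -` U"] exI[of _ "\<lambda>x. h (g x)"]) (auto simp: Cinf_on_def)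
qed

lemma smooth_on_bounded_bilinear:
  assumes "bounded_bilinear B" "smooth_on M f" "smooth_on M g"
  shows "smooth_on M (\<lambda>x. B (f x) (g x))"
  unfolding smooth_on_def
proof
  fix p assume p: "p \<in> M"
  from assms(2) p obtain U f' where U: "open U" "p \<in> U" "\<forall>k. Ck_on k U f'" "\<forall>x\<in>M \<inter> U. f' x = f x"
    unfolding smooth_on_def by blast
  from assms(3) p obtain V g' where V: "open V" "p \<in> V" "\<forall>k. Ck_on k V g'" "\<forall>x\<in>M \<inter> V. g' x = g x"
    unfolding smooth_on_def by blast
  have "Ck_on k (U \<inter> V) (\<lambda>x. B (f' x) (g' x))" for k
    by (rule Ck_on_bounded_bilinear[OF assms(1)])
      (use U V in \<open>auto intro: Ck_on_subset[of k U] Ck_on_subset[of k V]\<close>)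
  then show "\<exists>U h. open U \<and> p \<in> U \<and> (\<forall>k. Ck_on k U h) \<and> (\<forall>x\<in>M \<inter> U. h x = B (f x) (g x))"
    using U V by (intro exI[of _ "U \<inter> V"] exI[of _ "\<lambda>x. B (f' x) (g' x)"]) auto
qed

lemma smooth_on_add:
  assumes "smooth_on M f" "smooth_on M g"
  shows "smooth_on M (\<lambda>x. f x + g x)"
  unfolding smooth_on_def
proof
  fix p assume p: "p \<in> M"
  from assms(1) p obtain U f' where U: "open U" "p \<in> U" "\<forall>k. Ck_on k U f'" "\<forall>x\<in>M \<inter> U. f' x = f x"
    unfolding smooth_on_def by blast
  from assms(2) p obtain V g' where V: "open V" "p \<in> V" "\<forall>k. Ck_on k V g'" "\<forall>x\<in>M \<inter> V. g' x = g x"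
    unfolding smooth_on_def by blast
  have "Ck_on k (U \<inter> V) (\<lambda>x. f' x + g' x)" for k
    by (rule Ck_on_add) (use U V in \<open>auto intro: Ck_on_subset[of k U] Ck_on_subset[of k V]\<close>)
  then show "\<exists>U h. open U \<and> p \<in> U \<and> (\<forall>k. Ck_on k U h) \<and> (\<forall>x\<in>M \<inter> U. h x = f x + g x)"
    using U V by (intro exI[of _ "U \<inter> V"] exI[of _ "\<lambda>x. f' x + g' x"]) auto
qed

lemma smooth_on_Cinf: "Cinf_on U f \<Longrightarrow> M \<subseteq> U \<Longrightarrow> smooth_on M f"
  by (rule smooth_onI) blast

section \<open>Tangent vectors and differentials\<close>

lemma has_vector_derivative_compose:
  assumes "(h has_derivative D) (at (\<gamma> t))" "(\<gamma> has_vector_derivative v) (at t)"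
  shows "((h \<circ> \<gamma>) has_vector_derivative D v) (at t)"
  using has_derivative_compose[OF assms(2)[unfolded has_vector_derivative_def] assms(1)]
  by (simp add: has_vector_derivative_def comp_def linear_scale[OF has_derivative_linear[OF assms(1)]])

text \<open>A tangent vector has at least one curve, and the chain rule gives the same derivative
  along all of them, so the description is unique. Differentials on the submanifold thereby become
  restrictions of ambient derivatives.\<close>

lemma tangent_map_eq:
  assumes "v \<in> tangent_space M p" "(h has_derivative D) (at p)"
  shows "tangent_map M h p v = D v"
  unfolding tangent_map_def
proof (rule the_equality)
  have *: "((h \<circ> \<gamma>) has_vector_derivative D v) (at 0)" if "smooth_curve_through M p v \<gamma>" for \<gamma>
    using that assms(2) by (intro has_vector_derivative_compose) (auto simp: smooth_curve_through_def)
  then show "\<forall>\<gamma>. smooth_curve_through M p v \<gamma> \<longrightarrow> ((h \<circ> \<gamma>) has_vector_derivative D v) (at 0)"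
    by blast
  fix w assume w: "\<forall>\<gamma>. smooth_curve_through M p v \<gamma> \<longrightarrow> ((h \<circ> \<gamma>) has_vector_derivative w) (at 0)"
  from assms(1) obtain \<gamma> where "smooth_curve_through M p v \<gamma>" unfolding tangent_space_def by blast
  with w * show "w = D v" by (intro vector_derivative_unique_at[of "h \<circ> \<gamma>" w 0]) simp_all
qed

lemma has_vector_derivative_fst:
  "(f has_vector_derivative v) F \<Longrightarrow> ((\<lambda>x. fst (f x)) has_vector_derivative fst v) F"
  by (rule bounded_linear.has_vector_derivative[OF bounded_linear_fst])

lemma has_vector_derivative_snd:
  "(f has_vector_derivative v) F \<Longrightarrow> ((\<lambda>x. snd (f x)) has_vector_derivative snd v) F"
  by (rule bounded_linear.has_vector_derivative[OF bounded_linear_snd])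

lemma sphere_velocity_orthogonal:
  fixes \<gamma> :: "real \<Rightarrow> 'a::real_inner"
  assumes "(\<gamma> has_vector_derivative v) (at 0)" "e > 0" "\<And>s. s \<in> {-e<..<e} \<Longrightarrow> norm (\<gamma> s) = 1"
  shows "v \<bullet> \<gamma> 0 = 0"
proof -
  have "((\<lambda>s. \<gamma> s \<bullet> \<gamma> s) has_real_derivative 2 * (v \<bullet> \<gamma> 0)) (at 0)"
    unfolding has_field_derivative_def
    using has_derivative_inner[OF assms(1)[unfolded has_vector_derivative_def]
        assms(1)[unfolded has_vector_derivative_def]]
    by (rule has_derivative_eq_rhs) (auto simp: inner_commute algebra_simps)
  moreover have "((\<lambda>s. \<gamma> s \<bullet> \<gamma> s) has_real_derivative 0) (at 0)"
    by (rule has_field_derivative_transform_within_open[where S = "{-e<..<e}" and f = "\<lambda>_. 1"])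
      (use assms(2,3) in \<open>auto simp: norm_eq_1\<close>)
  ultimately have "2 * (v \<bullet> \<gamma> 0) = 0" by (rule DERIV_unique)
  then show ?thesis by simp
qed

text \<open>The line p + s v projected radially to the sphere. As v is orthogonal to p, the norm on
  the line is sqrt(1 + s^2 |v|^2), which has no first-order term, so the projection keeps the
  velocity v at 0.\<close>

lemma sphere_curve:
  fixes p v :: "'a::euclidean_space"
  assumes "norm p = 1" "v \<bullet> p = 0"
  defines "\<gamma> \<equiv> \<lambda>s. (1 + s * s * (v \<bullet> v)) powr (- 1 / 2) *\<^sub>R (p + s *\<^sub>R v)"
  shows "Cinf_on UNIV \<gamma>" "\<gamma> s \<in> sphere 0 1" "\<gamma> 0 = p" "(\<gamma> has_vector_derivative v) (at 0)"
proof -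
  have pos: "1 + s * s * (v \<bullet> v) > 0" for s :: real by (intro add_pos_nonneg) auto
  have id: "Cinf_on UNIV (\<lambda>s::real. s)" by (intro Cinf_on_linear) auto
  show "Cinf_on UNIV \<gamma>"
    unfolding \<gamma>_def
    by (intro Cinf_on_scaleR Cinf_on_compose[OF Cinf_on_powr] Cinf_on_add Cinf_on_mult Cinf_on_const id)
      (use pos in auto)
  have "(norm (p + s *\<^sub>R v))\<^sup>2 = 1 + s * s * (v \<bullet> v)"
    using assms(1,2) by (simp add: norm_eq_1 power2_norm_eq_inner inner_add inner_commute)
  then have "norm (p + s *\<^sub>R v) = (1 + s * s * (v \<bullet> v)) powr (1 / 2)"
    using pos[of s] real_sqrt_unique[OF _ norm_ge_zero] powr_half_sqrt by (metis less_imp_le)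
  then show "\<gamma> s \<in> sphere 0 1"
    using pos[of s] by (simp add: \<gamma>_def powr_minus)
  show "\<gamma> 0 = p" by (simp add: \<gamma>_def)
  show "(\<gamma> has_vector_derivative v) (at 0)"
    unfolding \<gamma>_def by (auto intro!: derivative_eq_intros)
qed

lemma tangent_space_S2xS2:
  assumes "x \<in> S2xS2"
  shows "tangent_space S2xS2 x = {v. fst v \<bullet> fst x = 0 \<and> snd v \<bullet> snd x = 0}"
proof (intro set_eqI iffI CollectI; (elim CollectE)?)
  fix v assume "v \<in> tangent_space S2xS2 x"
  then obtain \<gamma> e where \<gamma>: "e > 0" "\<gamma> ` {-e<..<e} \<subseteq> S2xS2" "\<gamma> 0 = x" "(\<gamma> has_vector_derivative v) (at 0)"
    unfolding tangent_space_def smooth_curve_through_def by blast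
  have "norm (fst (\<gamma> s)) = 1" "norm (snd (\<gamma> s)) = 1" if "s \<in> {-e<..<e}" for s
    using subsetD[OF \<gamma>(2) imageI[OF that]] by (auto simp: S2xS2_def mem_Times_iff)
  from sphere_velocity_orthogonal[OF has_vector_derivative_fst[OF \<gamma>(4)] \<gamma>(1) this(1)]
    sphere_velocity_orthogonal[OF has_vector_derivative_snd[OF \<gamma>(4)] \<gamma>(1) this(2)]
  show "fst v \<bullet> fst x = 0 \<and> snd v \<bullet> snd x = 0" by (simp add: \<gamma>(3))
next
  fix v assume "fst v \<bullet> fst x = 0 \<and> snd v \<bullet> snd x = 0"
  then have v: "fst v \<bullet> fst x = 0" "snd v \<bullet> snd x = 0" by auto
  have x: "norm (fst x) = 1" "norm (snd x) = 1" using assms by (auto simp: S2xS2_def)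
  define \<gamma> where "\<gamma> p v s = (1 + s * s * (v \<bullet> v)) powr (- 1 / 2) *\<^sub>R (p + s *\<^sub>R v)" for p v :: "real^3" and s
  note 1 = sphere_curve[OF x(1) v(1), folded \<gamma>_def] and 2 = sphere_curve[OF x(2) v(2), folded \<gamma>_def]
  let ?c = "\<lambda>s. (\<gamma> (fst x) (fst v) s, \<gamma> (snd x) (snd v) s)"
  have "(?c has_vector_derivative v) (at 0)"
    using has_vector_derivative_Pair[OF 1(4) 2(4)] by simp
  moreover have "smooth_on {-1<..<1} ?c"
    by (rule smooth_on_Cinf[OF Cinf_on_Pair[OF 1(1) 2(1)]]) simp
  moreover have "?c ` {-1<..<1} \<subseteq> S2xS2" unfolding S2xS2_def using 1(2) 2(2) by blast
  moreover have "?c 0 = x" using 1(3) 2(3) by simp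
  ultimately have "smooth_curve_through S2xS2 x v ?c"
    unfolding smooth_curve_through_def by (intro conjI exI[of _ 1]) simp_all
  then show "v \<in> tangent_space S2xS2 x" unfolding tangent_space_def by blast
qed

section \<open>Hamiltonian isotopies that are constant near both ends\<close>

text \<open>Hamilton's equation at one point, phrased with an ambient derivative \<open>D\<close> of
  the Hamiltonian instead of \<open>tangent_map\<close>, so that sums, multiples and the product
  rule are available.\<close>

definition ham_vec :: "real \<Rightarrow> ((real^3) \<times> (real^3) \<Rightarrow> real) \<Rightarrow> (real^3) \<times> (real^3) \<Rightarrow> (real^3) \<times> (real^3) \<Rightarrow> bool"
  where "ham_vec \<alpha> h x V \<longleftrightarrow> V \<in> tangent_space S2xS2 x \<and>
    (\<exists>D. (h has_derivative D) (at x) \<and> (\<forall>w\<in>tangent_space S2xS2 x. omega \<alpha> x V w = D w))"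

lemma omega_scale: "omega \<alpha> x (c *\<^sub>R V) w = c * omega \<alpha> x V w"
  by (simp add: omega_def area_form_def cross_mult_left algebra_simps add_divide_distrib)

lemma ham_vec_scale:
  assumes "x \<in> S2xS2" "ham_vec \<alpha> h x V"
  shows "ham_vec \<alpha> (\<lambda>y. c * h y) x (c *\<^sub>R V)"
proof -
  from assms(2) obtain D where D: "(h has_derivative D) (at x)"
    "\<forall>w\<in>tangent_space S2xS2 x. omega \<alpha> x V w = D w" and V: "V \<in> tangent_space S2xS2 x"
    unfolding ham_vec_def by blast
  then show ?thesis
    unfolding ham_vec_def
    by (intro conjI exI[of _ "\<lambda>w. c * D w"] has_derivative_mult_right)
      (auto simp: omega_scale tangent_space_S2xS2[OF assms(1)])
qed

text \<open>Vanishing of the Hamiltonian at both ends keeps concatenations smooth in time.\<close>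

definition flat_isotopy :: "real \<Rightarrow> real \<Rightarrow> (real \<Rightarrow> (real^3) \<times> (real^3) \<Rightarrow> real) \<Rightarrow>
    (real \<Rightarrow> (real^3) \<times> (real^3) \<Rightarrow> (real^3) \<times> (real^3)) \<Rightarrow> bool" where
  "flat_isotopy \<alpha> T H \<psi> \<longleftrightarrow> T > 0 \<and> smooth_on (UNIV \<times> S2xS2) (\<lambda>(t, x). H t x) \<and>
     (\<forall>t x. t \<notin> {0..T} \<longrightarrow> H t x = 0) \<and>
     (\<forall>x\<in>S2xS2. (\<forall>t\<le>0. \<psi> t x = x) \<and> (\<forall>t\<ge>T. \<psi> t x = \<psi> T x) \<and>
       (\<forall>t. \<psi> t x \<in> S2xS2 \<and>
         (\<exists>V. ham_vec \<alpha> (H t) (\<psi> t x) V \<and> ((\<lambda>s. \<psi> s x) has_vector_derivative V) (at t))))"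

lemma flat_isotopyD:
  assumes "flat_isotopy \<alpha> T H \<psi>"
  shows "T > 0" "smooth_on (UNIV \<times> S2xS2) (\<lambda>(t, x). H t x)" "t \<notin> {0..T} \<Longrightarrow> H t y = 0"
    "x \<in> S2xS2 \<Longrightarrow> t \<le> 0 \<Longrightarrow> \<psi> t x = x" "x \<in> S2xS2 \<Longrightarrow> t \<ge> T \<Longrightarrow> \<psi> t x = \<psi> T x"
    "x \<in> S2xS2 \<Longrightarrow> \<psi> t x \<in> S2xS2"
    "x \<in> S2xS2 \<Longrightarrow> \<exists>V. ham_vec \<alpha> (H t) (\<psi> t x) V \<and> ((\<lambda>s. \<psi> s x) has_vector_derivative V) (at t)"
  using assms unfolding flat_isotopy_def by blast+

lemma flat_isotopy_imp_Ham:
  assumes "flat_isotopy \<alpha> T H \<psi>"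
  shows "\<psi> T \<in> Ham S2xS2 (omega \<alpha>)"
proof -
  note * = flat_isotopyD[OF assms]
  have "smooth_on ({0..1} \<times> S2xS2) (\<lambda>y. T * (\<lambda>(t, x). H t x) (T * fst y, snd y))"
    using *(1,2) by (intro smooth_on_bounded_bilinear[OF bounded_bilinear_mult]
        smooth_on_Cinf[OF Cinf_on_const[OF open_UNIV]]
        smooth_on_compose[where N = "UNIV \<times> S2xS2" and g = "\<lambda>y. (T * fst y, snd y)"] Cinf_on_Pair
        Cinf_on_linear bounded_linear_snd bounded_linear_const_mult[OF bounded_linear_fst]) auto
  then have "smooth_on ({0..1} \<times> S2xS2) (\<lambda>(t, x). T * H (T * t) x)"
    by (simp add: case_prod_beta')
  moreover have "\<exists>V\<in>tangent_space S2xS2 (\<psi> (T * t) x).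
      (\<forall>w\<in>tangent_space S2xS2 (\<psi> (T * t) x).
        omega \<alpha> (\<psi> (T * t) x) V w = tangent_map S2xS2 (\<lambda>x. T * H (T * t) x) (\<psi> (T * t) x) w) \<and>
      ((\<lambda>s. \<psi> (T * s) x) has_vector_derivative V) (at t within {0..1})"
    if x: "x \<in> S2xS2" for x t
  proof -
    from *(6,7)[OF x, of "T * t"] obtain V where V: "ham_vec \<alpha> (H (T * t)) (\<psi> (T * t) x) V"
      "\<psi> (T * t) x \<in> S2xS2" "((\<lambda>s. \<psi> s x) has_vector_derivative V) (at (T * t))" by blast
    have "((\<lambda>s. T * s) has_real_derivative T) (at t)" by (auto intro!: derivative_eq_intros)
    then have "((\<lambda>s. \<psi> (T * s) x) has_vector_derivative T *\<^sub>R V) (at t)"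
      using vector_diff_chain_at[of "\<lambda>s. T * s" T t "\<lambda>s. \<psi> s x" V] V(3)
      by (simp add: comp_def has_real_derivative_iff_has_vector_derivative)
    with ham_vec_scale[OF V(2,1), of T] show ?thesis
      unfolding ham_vec_def
      by (intro bexI[of _ "T *\<^sub>R V"])
        (auto simp: tangent_map_eq intro: has_vector_derivative_at_within)
  qed
  ultimately show ?thesis
    unfolding Ham_def using *(4,6)
    by (intro CollectI exI[of _ "\<lambda>t x. T * H (T * t) x"] exI[of _ "\<lambda>t. \<psi> (T * t)"]) simp
qed

text \<open>A pause of length 1 separates the two isotopies. Before time T + 1 the second is still
  at rest, after time T the first has stopped; these two open conditions cover the line, so no
  moment requires matching one-sided derivatives.\<close>

lemma flat_isotopy_concat:
  assumes "flat_isotopy \<alpha> T H \<psi>" "flat_isotopy \<alpha> T' H' \<psi>'"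
  shows "flat_isotopy \<alpha> (T + 1 + T') (\<lambda>t x. H t x + H' (t - (T + 1)) x)
     (\<lambda>t x. \<psi>' (t - (T + 1)) (\<psi> t x))"
proof -
  note 1 = flat_isotopyD[OF assms(1)] and 2 = flat_isotopyD[OF assms(2)]
  have "smooth_on (UNIV \<times> S2xS2)
      (\<lambda>y. (\<lambda>(t, x). H t x) y + (\<lambda>(t, x). H' t x) (fst y - (T + 1), snd y))"
    using 1(2) 2(2) by (intro smooth_on_add
        smooth_on_compose[where N = "UNIV \<times> S2xS2" and g = "\<lambda>y. (fst y - (T + 1), snd y)"] Cinf_on_Pair
        Cinf_on_diff Cinf_on_const Cinf_on_linear bounded_linear_snd bounded_linear_fst) auto
  then have "smooth_on (UNIV \<times> S2xS2) (\<lambda>(t, x). H t x + H' (t - (T + 1)) x)"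
    by (simp add: case_prod_beta')
  moreover have "\<exists>V. ham_vec \<alpha> (\<lambda>x. H t x + H' (t - (T + 1)) x) (\<psi>' (t - (T + 1)) (\<psi> t x)) V \<and>
      ((\<lambda>s. \<psi>' (s - (T + 1)) (\<psi> s x)) has_vector_derivative V) (at t)"
    if x: "x \<in> S2xS2" for x t
  proof (cases "t < T + 1")
    case True
    have *: "\<psi>' (s - (T + 1)) (\<psi> s x) = \<psi> s x" if "s < T + 1" for s
      using 1(6) 2(4) x that by simp
    have **: "H' (t - (T + 1)) y = 0" for y using 2(3) True by simp
    obtain V where V: "ham_vec \<alpha> (H t) (\<psi> t x) V" "((\<lambda>s. \<psi> s x) has_vector_derivative V) (at t)"
      using 1(7) x by blast
    have "((\<lambda>s. \<psi>' (s - (T + 1)) (\<psi> s x)) has_vector_derivative V) (at t)"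
      by (rule has_vector_derivative_transform_within_open[OF V(2), of "{..<T + 1}"])
        (use True * in auto)
    with V(1) show ?thesis unfolding ** *[OF True] add_0_right by blast
  next
    case False
    then have t: "t > T" by simp
    have *: "\<psi> s x = \<psi> T x" if "s > T" for s
      using that by (intro 1(5) x) simp
    have **: "H t y = 0" for y using 1(3) t by simp
    have "\<psi> T x \<in> S2xS2" using 1(6) x by blast
    then obtain V where V: "ham_vec \<alpha> (H' (t - (T + 1))) (\<psi>' (t - (T + 1)) (\<psi> T x)) V"
      "((\<lambda>s. \<psi>' s (\<psi> T x)) has_vector_derivative V) (at (t - (T + 1)))"
      using 2(7) by blast
    have "((\<lambda>s. s - (T + 1)) has_real_derivative 1) (at t)" by (auto intro!: derivative_eq_intros)
    then have "((\<lambda>s. \<psi>' (s - (T + 1)) (\<psi> T x)) has_vector_derivative V) (at t)"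
      using vector_diff_chain_at[of "\<lambda>s. s - (T + 1)" 1 t "\<lambda>s. \<psi>' s (\<psi> T x)" V] V(2)
      by (simp add: comp_def has_real_derivative_iff_has_vector_derivative)
    then have "((\<lambda>s. \<psi>' (s - (T + 1)) (\<psi> s x)) has_vector_derivative V) (at t)"
      by (rule has_vector_derivative_transform_within_open[of _ _ _ "{T<..}"]) (use t * in auto)
    with V(1) show ?thesis unfolding ** *[OF t] add_0 by blast
  qed
  ultimately show ?thesis
    unfolding flat_isotopy_def
  proof (intro conjI ballI allI impI)
    show "0 < T + 1 + T'" using 1(1) 2(1) by simp
    show "H t x + H' (t - (T + 1)) x = 0" if "t \<notin> {0..T + 1 + T'}" for t x
      using that 1(1) 2(1) by (subst 1(3), force, subst 2(3)) auto
  next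
    fix x and t :: real assume x: "x \<in> S2xS2"
    show "\<psi>' (t - (T + 1)) (\<psi> t x) \<in> S2xS2" using x 1(6) 2(6) by blast
    show "\<psi>' (t - (T + 1)) (\<psi> t x) = x" if "t \<le> 0"
      using that x 1(1) 1(4)[OF x that] 2(4)[OF x, of "t - (T + 1)"] by simp
    show "\<psi>' (t - (T + 1)) (\<psi> t x) = \<psi>' (T + 1 + T' - (T + 1)) (\<psi> (T + 1 + T') x)"
      if "t \<ge> T + 1 + T'"
    proof -
      have "\<psi> t x = \<psi> T x" "\<psi> (T + 1 + T') x = \<psi> T x"
        using that 2(1) by (auto intro!: 1(5) x)
      moreover have "\<psi>' (t - (T + 1)) (\<psi> T x) = \<psi>' T' (\<psi> T x)"
        using that by (intro 2(5) 1(6) x) simp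
      ultimately show ?thesis by simp
    qed
  qed
qed

section \<open>Autonomous flows and a composable form of Hamiltonian equivalence\<close>

definition ham_flow :: "real \<Rightarrow> ((real^3) \<times> (real^3) \<Rightarrow> real) \<Rightarrow>
    (real \<Rightarrow> (real^3) \<times> (real^3) \<Rightarrow> (real^3) \<times> (real^3)) \<Rightarrow> bool" where
  "ham_flow \<alpha> h \<Phi> \<longleftrightarrow> smooth_on S2xS2 h \<and>
     (\<forall>x\<in>S2xS2. \<Phi> 0 x = x \<and> (\<forall>s. \<Phi> s x \<in> S2xS2 \<and>
       (\<exists>V. ham_vec \<alpha> h (\<Phi> s x) V \<and> ((\<lambda>s. \<Phi> s x) has_vector_derivative V) (at s))))"

text \<open>The duration is left free so that concatenation needs no reparametrisation; the
  rescaling to unit time is done once, in \<open>flat_isotopy_imp_Ham\<close>.\<close>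

definition flat_equiv :: "real \<Rightarrow> ((real^3) \<times> (real^3)) set \<Rightarrow> ((real^3) \<times> (real^3)) set \<Rightarrow> bool" where
  "flat_equiv \<alpha> L L' \<longleftrightarrow> (\<exists>T H \<psi>. flat_isotopy \<alpha> T H \<psi> \<and> \<psi> T ` L = L')"

lemma flat_equiv_imp_ham_equiv: "flat_equiv \<alpha> L L' \<Longrightarrow> ham_equiv S2xS2 (omega \<alpha>) L L'"
  unfolding flat_equiv_def ham_equiv_def using flat_isotopy_imp_Ham by blast

lemma flat_equiv_trans:
  assumes "flat_equiv \<alpha> L L'" "flat_equiv \<alpha> L' L''" "L \<subseteq> S2xS2"
  shows "flat_equiv \<alpha> L L''"
proof -
  from assms obtain T H \<psi> T' H' \<psi>' where *: "flat_isotopy \<alpha> T H \<psi>" "flat_isotopy \<alpha> T' H' \<psi>'"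
    and im: "\<psi> T ` L = L'" "\<psi>' T' ` L' = L''"
    unfolding flat_equiv_def by blast
  have "\<psi> (T + 1 + T') x = \<psi> T x" if "x \<in> L" for x
  proof -
    have "T' > 0" using *(2) by (rule flat_isotopyD)
    with that assms(3) show ?thesis by (intro flat_isotopyD(5)[OF *(1)]) auto
  qed
  then have "(\<lambda>x. \<psi>' (T + 1 + T' - (T + 1)) (\<psi> (T + 1 + T') x)) ` L = (\<lambda>x. \<psi>' T' (\<psi> T x)) ` L"
    by (intro image_cong) simp_all
  also have "\<dots> = L''" using im by (simp flip: image_image)
  finally have "(\<lambda>x. \<psi>' (T + 1 + T' - (T + 1)) (\<psi> (T + 1 + T') x)) ` L = L''" .
  with flat_isotopy_concat[OF *] show ?thesis unfolding flat_equiv_def by blast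
qed

text \<open>Following the flow at time \<tau> \<beta>(t) for the smooth step \<beta> multiplies the
  Hamiltonian by \<tau> \<beta>'(t), which vanishes outside the unit interval, and it ends at the
  time-\<tau> map.\<close>

lemma ham_flow_imp_flat_equiv:
  assumes "ham_flow \<alpha> h \<Phi>" "L \<subseteq> S2xS2"
  shows "flat_equiv \<alpha> L (\<Phi> \<tau> ` L)"
proof -
  note 1 = assms(1)[unfolded ham_flow_def]
  obtain \<beta> \<beta>' :: "real \<Rightarrow> real" where \<beta>: "Cinf_on UNIV \<beta>'" "\<And>t. (\<beta> has_real_derivative \<beta>' t) (at t)"
    "\<And>t. t \<le> 0 \<Longrightarrow> \<beta> t = 0" "\<And>t. t \<ge> 1 \<Longrightarrow> \<beta> t = 1" "\<And>t. t \<notin> {0..1} \<Longrightarrow> \<beta>' t = 0"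
    using smooth_step_exists by metis
  have "smooth_on (UNIV \<times> S2xS2) (\<lambda>y. (\<tau> * \<beta>' (fst y)) * h (snd y))"
  proof (rule smooth_on_bounded_bilinear[OF bounded_bilinear_mult])
    have "Cinf_on UNIV (\<lambda>y::real \<times> (real^3) \<times> (real^3). \<beta>' (fst y))"
      by (rule Cinf_on_compose[OF \<beta>(1) Cinf_on_linear[OF open_UNIV bounded_linear_fst]]) simp
    then show "smooth_on (UNIV \<times> S2xS2) (\<lambda>y. \<tau> * \<beta>' (fst y))"
      using smooth_on_Cinf[OF Cinf_on_mult[OF Cinf_on_const[OF open_UNIV]]] by blast
    show "smooth_on (UNIV \<times> S2xS2) (\<lambda>y. h (snd y))"
      by (rule smooth_on_compose[OF conjunct1[OF 1] Cinf_on_linear[OF open_UNIV bounded_linear_snd]])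
        auto
  qed
  then have "smooth_on (UNIV \<times> S2xS2) (\<lambda>(t, x). \<tau> * \<beta>' t * h x)"
    by (simp add: case_prod_beta')
  moreover have "\<exists>V. ham_vec \<alpha> (\<lambda>y. \<tau> * \<beta>' t * h y) (\<Phi> (\<tau> * \<beta> t) x) V \<and>
      ((\<lambda>s. \<Phi> (\<tau> * \<beta> s) x) has_vector_derivative V) (at t)" if x: "x \<in> S2xS2" for x t
  proof -
    obtain V where V: "\<Phi> (\<tau> * \<beta> t) x \<in> S2xS2" "ham_vec \<alpha> h (\<Phi> (\<tau> * \<beta> t) x) V"
      "((\<lambda>s. \<Phi> s x) has_vector_derivative V) (at (\<tau> * \<beta> t))" using 1 x by blast
    have "((\<lambda>s. \<tau> * \<beta> s) has_real_derivative \<tau> * \<beta>' t) (at t)" by (intro DERIV_cmult \<beta>(2))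
    then have "((\<lambda>s. \<Phi> (\<tau> * \<beta> s) x) has_vector_derivative (\<tau> * \<beta>' t) *\<^sub>R V) (at t)"
      using vector_diff_chain_at[of "\<lambda>s. \<tau> * \<beta> s" "\<tau> * \<beta>' t" t "\<lambda>s. \<Phi> s x" V] V(3)
      by (simp add: comp_def has_real_derivative_iff_has_vector_derivative)
    with ham_vec_scale[OF V(1,2)] show ?thesis by blast
  qed
  ultimately have "flat_isotopy \<alpha> 1 (\<lambda>t x. \<tau> * \<beta>' t * h x) (\<lambda>t. \<Phi> (\<tau> * \<beta> t))"
    unfolding flat_isotopy_def using 1 \<beta>(3-5) by (simp del: split_paired_All split_paired_Ex)
  moreover have "\<Phi> (\<tau> * \<beta> 1) ` L = \<Phi> \<tau> ` L" using \<beta>(4) by simp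
  ultimately show ?thesis unfolding flat_equiv_def by (intro exI conjI)
qed

text \<open>For a unit vector p and w orthogonal to p, the triple product of p, G x p and w is G .
  w, so taking the cross product with p turns an ambient gradient into the Hamiltonian vector of the
  form p . (u x v). The factors of \<open>omega\<close> are (\<alpha> + 1)/(2 pi) and \<alpha>/(2
  pi) times this form, whence the constants.\<close>

lemma ham_vecI:
  assumes "\<alpha> > 0" "x \<in> S2xS2"
    "(h has_derivative (\<lambda>w. G1 \<bullet> fst w + G2 \<bullet> snd w)) (at x)"
  shows "ham_vec \<alpha> h x ((2 * pi / (\<alpha> + 1)) *\<^sub>R cross3 G1 (fst x), (2 * pi / \<alpha>) *\<^sub>R cross3 G2 (snd x))"
proof -
  have *: "p \<bullet> cross3 (cross3 G p) w = G \<bullet> w" if "p \<bullet> p = 1" "w \<bullet> p = 0" for G p w :: "real^3"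
  proof -
    have "p \<bullet> cross3 (cross3 G p) w = cross3 G p \<bullet> cross3 w p"
      by (metis cross_triple inner_commute)
    also have "\<dots> = G \<bullet> w" using that by (simp add: dot_cross inner_commute)
    finally show ?thesis .
  qed
  have x: "fst x \<bullet> fst x = 1" "snd x \<bullet> snd x = 1"
    using assms(2) by (auto simp: S2xS2_def norm_eq_1)
  have scale: "2 * k * (2 * pi / k * a / (4 * pi)) = a" if "k \<noteq> 0" for a k :: real
    using that by simp
  have a: "\<alpha> + 1 \<noteq> 0" "\<alpha> \<noteq> 0" using assms(1) by auto
  have "omega \<alpha> x ((2 * pi / (\<alpha> + 1)) *\<^sub>R cross3 G1 (fst x), (2 * pi / \<alpha>) *\<^sub>R cross3 G2 (snd x)) w =
      G1 \<bullet> fst w + G2 \<bullet> snd w" if "fst w \<bullet> fst x = 0" "snd w \<bullet> snd x = 0" for w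
    unfolding omega_def area_form_def fst_conv snd_conv cross_mult_left inner_scaleR_right
      *[OF x(1) that(1)] *[OF x(2) that(2)] scale[OF a(1)] scale[OF a(2)] ..
  moreover have "((2 * pi / (\<alpha> + 1)) *\<^sub>R cross3 G1 (fst x)) \<bullet> fst x = 0"
    "((2 * pi / \<alpha>) *\<^sub>R cross3 G2 (snd x)) \<bullet> snd x = 0"
    by (simp_all only: inner_scaleR_left dot_cross_self mult_zero_right)
  ultimately show ?thesis
    unfolding ham_vec_def tangent_space_S2xS2[OF assms(2)] mem_Collect_eq fst_conv snd_conv
    using assms(3) by blast
qed

section \<open>Hamiltonians commuting with a diagonal rotation\<close>

lemma vector_3_eq: "vector [a, b, c] = a *\<^sub>R axis 1 1 + b *\<^sub>R axis 2 1 + c *\<^sub>R (axis 3 1 :: real^3)"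
  by (simp add: vec_eq_iff forall_3 axis_def)

lemma has_vector_derivative_vector_3:
  assumes "(f has_real_derivative f') (at s)" "(g has_real_derivative g') (at s)"
    "(h has_real_derivative h') (at s)"
  shows "((\<lambda>s. vector [f s, g s, h s] :: real^3) has_vector_derivative vector [f', g', h']) (at s)"
  unfolding vector_3_eq
  by (auto intro!: derivative_eq_intros assms simp: has_real_derivative_iff_has_vector_derivative[symmetric])

lemma vector_3_collapse: "vector [p $ 1, p $ 2, p $ 3] = (p :: real^3)"
  by (simp add: vec_eq_iff forall_3)

lemma inner_vector_3: "vector [a, b, c] \<bullet> (w :: real^3) = a * w $ 1 + b * w $ 2 + c * w $ 3"
  by (simp add: inner_vec_def sum_3)

lemma S2_iff: "p \<in> S2 \<longleftrightarrow> (p $ 1)\<^sup>2 + (p $ 2)\<^sup>2 + (p $ 3)\<^sup>2 = 1"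
  by (simp add: norm_eq_1 inner_vec_def sum_3 power2_eq_square)

lemma vector_in_S2_iff: "vector [a, b, c] \<in> S2 \<longleftrightarrow> a\<^sup>2 + b\<^sup>2 + c\<^sup>2 = 1"
  by (subst S2_iff) simp

lemma bounded_linear_fst_nth: "bounded_linear (\<lambda>x :: (real^3) \<times> (real^3). fst x $ i)"
  by (rule bounded_linear_compose[OF bounded_linear_vec_nth bounded_linear_fst])

lemma bounded_linear_snd_nth: "bounded_linear (\<lambda>x :: (real^3) \<times> (real^3). snd x $ i)"
  by (rule bounded_linear_compose[OF bounded_linear_vec_nth bounded_linear_snd])

text \<open>The Hamiltonians below commute with the diagonal rotation (for \<open>\<delta> = 1\<close>) or the antidiagonal
  rotation (for \<open>\<delta> = -1\<close>), whose moment map is the affine function \<open>level\<close> of the heights. The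
  profiles \<open>g1\<close> and \<open>g2\<close> turn the flow on the reduced spaces into a rigid rotation, and may be
  singular at a pole, so \<open>\<rho>\<close> cuts off the levels in \<open>Z\<close>.\<close>

locale probe =
  fixes \<alpha> \<kappa> \<delta> k0 k1 k2 :: real and \<rho> \<rho>' g1 g1' g2 g2' :: "real \<Rightarrow> real" and I1 I2 Z :: "real set"
  assumes \<alpha>: "\<alpha> > 0"
    and \<rho>: "Cinf_on UNIV \<rho>" "\<And>c. (\<rho> has_real_derivative \<rho>' c) (at c)"
    and g1: "Cinf_on I1 g1" "\<And>z. z \<in> I1 \<Longrightarrow> (g1 has_real_derivative g1' z) (at z)"
    and g2: "Cinf_on I2 g2" "\<And>z. z \<in> I2 \<Longrightarrow> (g2 has_real_derivative g2' z) (at z)"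
    and Z: "open Z" "\<And>c. c \<in> Z \<Longrightarrow> \<rho> c = 0"
    and dom: "\<And>p q. p \<in> S2 \<Longrightarrow> q \<in> S2 \<Longrightarrow> k0 + k1 * p $ 3 + k2 * q $ 3 \<notin> Z \<Longrightarrow> p $ 3 \<in> I1 \<and> q $ 3 \<in> I2"
begin

definition level :: "(real^3) \<times> (real^3) \<Rightarrow> real" where
  "level x = k0 + k1 * fst x $ 3 + k2 * snd x $ 3"

definition ham :: "(real^3) \<times> (real^3) \<Rightarrow> real" where
  "ham x = \<kappa> * \<rho> (level x) * (g1 (fst x $ 3) * g2 (snd x $ 3)) *
     (fst x $ 1 * snd x $ 1 + \<delta> * (fst x $ 2 * snd x $ 2))"

definition grad1 :: "(real^3) \<times> (real^3) \<Rightarrow> real^3" where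
  "grad1 x = (let (p, q) = x; r = \<rho> (level x); B = p $ 1 * q $ 1 + \<delta> * (p $ 2 * q $ 2);
      g = g1 (p $ 3) * g2 (q $ 3) in
    \<kappa> *\<^sub>R vector [r * g * q $ 1, \<delta> * r * g * q $ 2,
      k1 * \<rho>' (level x) * g * B + r * g1' (p $ 3) * g2 (q $ 3) * B])"

definition grad2 :: "(real^3) \<times> (real^3) \<Rightarrow> real^3" where
  "grad2 x = (let (p, q) = x; r = \<rho> (level x); B = p $ 1 * q $ 1 + \<delta> * (p $ 2 * q $ 2);
      g = g1 (p $ 3) * g2 (q $ 3) in
    \<kappa> *\<^sub>R vector [r * g * p $ 1, \<delta> * r * g * p $ 2,
      k2 * \<rho>' (level x) * g * B + r * g1 (p $ 3) * g2' (q $ 3) * B])"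

definition velocity :: "(real^3) \<times> (real^3) \<Rightarrow> (real^3) \<times> (real^3)" where
  "velocity x = ((2 * pi / (\<alpha> + 1)) *\<^sub>R cross3 (grad1 x) (fst x), (2 * pi / \<alpha>) *\<^sub>R cross3 (grad2 x) (snd x))"

lemma Cinf_on_level: "Cinf_on UNIV level"
  unfolding level_def
  by (intro Cinf_on_add Cinf_on_mult Cinf_on_const Cinf_on_linear open_UNIV
      bounded_linear_fst_nth bounded_linear_snd_nth)

lemma open_level_vimage: "open (level -` Z)"
proof -
  have "continuous_on UNIV level"
    using Cinf_on_level by (auto simp: Cinf_on_def dest: spec[of _ 0])
  with Z(1) show ?thesis by (simp add: continuous_on_open_vimage)
qed

text \<open>Every point is in one of two open sets: where the level lies in \<open>Z\<close> the
  function is identically zero, and elsewhere \<open>dom\<close> puts both heights where the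
  profiles are smooth.\<close>

lemma smooth_ham: "smooth_on S2xS2 ham"
proof (rule smooth_onI)
  fix x assume x: "x \<in> S2xS2"
  let ?U = "{x :: (real^3) \<times> (real^3). fst x $ 3 \<in> I1} \<inter> {x. snd x $ 3 \<in> I2}"
  show "\<exists>U. x \<in> U \<and> Cinf_on U ham"
  proof (cases "level x \<in> Z")
    case True
    have "Cinf_on (level -` Z) (\<lambda>_. 0 :: real)" by (rule Cinf_on_const[OF open_level_vimage])
    then have "Cinf_on (level -` Z) ham"
      unfolding Cinf_on_def
      using Ck_on_cong[OF open_level_vimage, of ham "\<lambda>_. 0"] Z(2) by (simp add: ham_def)
    with True show ?thesis by blast
  next
    case False
    have "open I1" "open I2" using g1 g2 by (auto simp: Cinf_on_def)
    then have "open ((\<lambda>x::(real^3) \<times> (real^3). fst x $ 3) -` I1)" "open ((\<lambda>x::(real^3) \<times> (real^3). snd x $ 3) -` I2)"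
      by (intro open_vimage continuous_intros; simp)+
    then have U: "open ?U" unfolding vimage_def by (rule open_Int)
    note f = Cinf_on_linear[OF U bounded_linear_fst_nth] and s = Cinf_on_linear[OF U bounded_linear_snd_nth]
    have "Cinf_on ?U (\<lambda>x. \<rho> (level x))"
      by (rule Cinf_on_compose[OF \<rho>(1) Cinf_on_subset[OF Cinf_on_level _ U]]) simp_all
    moreover have "Cinf_on ?U (\<lambda>x. g1 (fst x $ 3))"
      by (rule Cinf_on_compose[OF g1(1) f]) blast
    moreover have "Cinf_on ?U (\<lambda>x. g2 (snd x $ 3))"
      by (rule Cinf_on_compose[OF g2(1) s]) blast
    ultimately have "Cinf_on ?U ham"
      unfolding ham_def[abs_def]
      by (intro Cinf_on_add Cinf_on_mult Cinf_on_const[OF U] f s)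
    moreover have "fst x $ 3 \<in> I1 \<and> snd x $ 3 \<in> I2"
      using x False unfolding level_def S2xS2_def by (intro dom) auto
    then have "x \<in> ?U" by simp
    ultimately show ?thesis by (intro exI[of _ ?U] conjI)
  qed
qed

lemma ham_has_derivative:
  assumes "fst x $ 3 \<in> I1" "snd x $ 3 \<in> I2"
  shows "(ham has_derivative (\<lambda>w. grad1 x \<bullet> fst w + grad2 x \<bullet> snd w)) (at x)"
proof -
  note d1 = bounded_linear_imp_has_derivative[OF bounded_linear_fst_nth]
    and d2 = bounded_linear_imp_has_derivative[OF bounded_linear_snd_nth]
  have "(level has_derivative (\<lambda>w. k1 * fst w $ 3 + k2 * snd w $ 3)) (at x)"
    unfolding level_def by (auto intro!: derivative_eq_intros d1 d2)
  note l = DERIV_compose_FDERIV[OF \<rho>(2) this]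
    and m1 = DERIV_compose_FDERIV[OF g1(2)[OF assms(1)] d1]
    and m2 = DERIV_compose_FDERIV[OF g2(2)[OF assms(2)] d2]
  have "((\<lambda>x. \<kappa> * \<rho> (level x) * (g1 (fst x $ 3) * g2 (snd x $ 3)) *
     (fst x $ 1 * snd x $ 1 + \<delta> * (fst x $ 2 * snd x $ 2))) has_derivative
     (\<lambda>w. grad1 x \<bullet> fst w + grad2 x \<bullet> snd w)) (at x)"
    by (rule has_derivative_eq_rhs[OF has_derivative_mult[OF
            has_derivative_mult[OF has_derivative_mult[OF has_derivative_const[of \<kappa>] l]
              has_derivative_mult[OF m1 m2]]
            has_derivative_add[OF has_derivative_mult[OF d1[of 1] d2[of 1]]
              has_derivative_mult[OF has_derivative_const[of \<delta>]
                has_derivative_mult[OF d1[of 2] d2[of 2]]]]]])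
      (simp add: grad1_def grad2_def Let_def inner_vector_3 case_prod_beta algebra_simps fun_eq_iff)
  then show ?thesis unfolding ham_def[abs_def] .
qed

lemma ham_vec_velocity:
  assumes "x \<in> S2xS2" "level x \<notin> Z"
  shows "ham_vec \<alpha> ham x (velocity x)"
  unfolding velocity_def
  by (rule ham_vecI[OF \<alpha> assms(1) ham_has_derivative])
    (use dom[of "fst x" "snd x"] assms in \<open>auto simp: level_def S2xS2_def\<close>)

lemma ham_vec_zero:
  assumes "x \<in> S2xS2" "level x \<in> Z"
  shows "ham_vec \<alpha> ham x 0"
proof -
  have "(ham has_derivative (\<lambda>w. 0 \<bullet> fst w + 0 \<bullet> snd w)) (at x)"
    by (rule has_derivative_transform_within_open[where f = "\<lambda>_. 0", OF _ open_level_vimage])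
      (use assms Z in \<open>auto simp: ham_def\<close>)
  from ham_vecI[OF \<alpha> assms(1) this] show ?thesis by (simp add: cross_zero_left zero_prod_def)
qed

text \<open>It is enough to solve the equation off \<open>Z\<close>. Points with level in
  \<open>Z\<close> rest, because the Hamiltonian vanishes on a neighbourhood of them, and
  conservation of the level keeps every other trajectory in the region where the equation was
  solved.\<close>

lemma ham_flow_ham:
  assumes "\<And>x. x \<in> S2xS2 \<Longrightarrow> level x \<notin> Z \<Longrightarrow> \<Phi> 0 x = x"
    and "\<And>x s. x \<in> S2xS2 \<Longrightarrow> level x \<notin> Z \<Longrightarrow> \<Phi> s x \<in> S2xS2 \<and> level (\<Phi> s x) = level x \<and>
      ((\<lambda>s. \<Phi> s x) has_vector_derivative velocity (\<Phi> s x)) (at s)"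
  shows "ham_flow \<alpha> ham (\<lambda>s x. if level x \<in> Z then x else \<Phi> s x)"
  unfolding ham_flow_def
proof (intro conjI ballI allI smooth_ham)
  fix x s assume x: "x \<in> S2xS2"
  show "(if level x \<in> Z then x else \<Phi> 0 x) = x" using assms(1) x by simp
  show "(if level x \<in> Z then x else \<Phi> s x) \<in> S2xS2" using assms(2) x by simp
  show "\<exists>V. ham_vec \<alpha> ham (if level x \<in> Z then x else \<Phi> s x) V \<and>
      ((\<lambda>s. if level x \<in> Z then x else \<Phi> s x) has_vector_derivative V) (at s)"
  proof (cases "level x \<in> Z")
    case True
    then show ?thesis
      by (auto intro!: exI[of _ 0] ham_vec_zero x simp del: split_paired_Ex)
  next
    case False
    with assms(2)[OF x False, of s] ham_vec_velocity[of "\<Phi> s x"] show ?thesis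
      by (intro exI[of _ "velocity (\<Phi> s x)"]) simp
  qed
qed

end

section \<open>Square-root profiles, and split tori as fibres of the two heights\<close>

lemma Cinf_on_inverse_sqrt:
  assumes "Cinf_on U f" "\<And>x. x \<in> U \<Longrightarrow> f x > 0"
  shows "Cinf_on U (\<lambda>x. 1 / sqrt (f x))"
proof -
  have U: "open U" using assms(1) by (simp add: Cinf_on_def)
  have "Cinf_on U (\<lambda>x. f x powr (- 1 / 2))"
    by (rule Cinf_on_compose[OF Cinf_on_powr assms(1)]) (use assms(2) in auto)
  moreover have "f x powr (- 1 / 2) = 1 / sqrt (f x)" if "x \<in> U" for x
    using assms(2)[OF that] by (simp add: powr_half_sqrt powr_minus field_simps)
  ultimately show ?thesis
    using Ck_on_cong[OF U, of "\<lambda>x. f x powr (- 1 / 2)" "\<lambda>x. 1 / sqrt (f x)"] by (simp add: Cinf_on_def)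
qed

lemma scaleR_vector_3: "c *\<^sub>R (vector [x, y, z] :: real^3) = vector [c * x, c * y, c * z]"
  by (simp add: vec_eq_iff forall_3)

text \<open>Area on the sphere is proportional to height (Archimedes), so the moment coordinates are
  the heights multiplied by half the total areas, \<alpha> + 1 and \<alpha>.\<close>

lemma split_torus_eq:
  assumes "\<alpha> > 0" "x \<in> {-1 - \<alpha><..<1 + \<alpha>}" "y \<in> {-\<alpha><..<\<alpha>}"
  shows "split_torus \<alpha> x y = {z \<in> S2xS2. fst z $ 3 = x / (\<alpha> + 1) \<and> snd z $ 3 = y / \<alpha>}"
proof -
  have "2 * x / (2 * (\<alpha> + 1)) = x / (\<alpha> + 1)" by (rule mult_divide_mult_cancel_left) simp
  moreover have "level_circle (2 * (\<alpha> + 1)) x = {p \<in> S2. p $ 3 = 2 * x / (2 * (\<alpha> + 1))}"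
    using assms by (intro level_circle_eq) auto
  moreover have "level_circle (2 * \<alpha>) y = {p \<in> S2. p $ 3 = 2 * y / (2 * \<alpha>)}"
    using assms by (intro level_circle_eq) auto
  ultimately show ?thesis by (auto simp: split_torus_def S2xS2_def)
qed

section \<open>The shear\<close>

text \<open>Coordinates on the level set \<open>(\<alpha> + 1) p\<^sub>3 - \<alpha> q\<^sub>3 = c\<close> with \<open>\<bar>c\<bar> < 1\<close>: \<open>u\<close> is the direction
  of \<open>(p\<^sub>1, p\<^sub>2)\<close>, and \<open>(X, Y, Z)\<close> is \<open>q\<close> turned around the vertical axis by the angle of \<open>u\<close>. The
  reduced space is the sphere of the \<open>(X, Y, Z)\<close>, and the probe flow rotates it around the \<open>X\<close>-axis.\<close>

definition shear_point :: "real \<Rightarrow> real \<Rightarrow> real \<Rightarrow> real \<Rightarrow> real \<Rightarrow> real \<Rightarrow> real \<Rightarrow> (real^3) \<times> (real^3)" where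
  "shear_point \<alpha> c u1 u2 X Y Z = (let z = (c + \<alpha> * Z) / (\<alpha> + 1); r = sqrt (1 - z\<^sup>2) in
     (vector [r * u1, r * u2, z], vector [u1 * X + u2 * Y, u1 * Y - u2 * X, Z]))"

definition shear_coords :: "(real^3) \<times> (real^3) \<Rightarrow> real \<times> real \<times> real \<times> real \<times> real" where
  "shear_coords x = (let (p, q) = x; r = sqrt (1 - (p $ 3)\<^sup>2); u1 = p $ 1 / r; u2 = p $ 2 / r in
     (u1, u2, u1 * q $ 1 - u2 * q $ 2, u1 * q $ 2 + u2 * q $ 1, q $ 3))"

text \<open>The levels with \<bar>c\<bar> < 1 avoid the poles of the first sphere altogether, while
  the second height still runs through all of [-1, 1]. This is why the reduced space is a full
  sphere.\<close>

lemma abs_less_1_if_level: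
  fixes \<alpha> c z Z :: real
  assumes "\<alpha> > 0" "\<bar>c\<bar> < 1" "\<bar>Z\<bar> \<le> 1" "(\<alpha> + 1) * z - \<alpha> * Z = c"
  shows "\<bar>z\<bar> < 1"
proof -
  have "\<bar>\<alpha> * Z\<bar> \<le> \<alpha>" using assms(1,3) by (simp add: abs_mult)
  moreover have "(\<alpha> + 1) * z = c + \<alpha> * Z" using assms(4) by simp
  ultimately have "\<bar>(\<alpha> + 1) * z\<bar> < (\<alpha> + 1) * 1"
    using assms(2) abs_triangle_ineq[of c "\<alpha> * Z"] by simp
  then show ?thesis using assms(1) by (simp add: abs_mult)
qed

lemma S2_nth_le: "p \<in> S2 \<Longrightarrow> \<bar>p $ 3\<bar> \<le> 1"
  using component_le_norm_cart[of p 3] by simp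

lemma shear_point_props:
  assumes "\<alpha> > 0" "\<bar>c\<bar> < 1" "u1\<^sup>2 + u2\<^sup>2 = 1" "X\<^sup>2 + Y\<^sup>2 + Z\<^sup>2 = 1"
  shows "\<bar>(c + \<alpha> * Z) / (\<alpha> + 1)\<bar> < 1" "shear_point \<alpha> c u1 u2 X Y Z \<in> S2xS2"
    "shear_coords (shear_point \<alpha> c u1 u2 X Y Z) = (u1, u2, X, Y, Z)"
proof -
  define z where "z = (c + \<alpha> * Z) / (\<alpha> + 1)"
  define r where "r = sqrt (1 - z\<^sup>2)"
  have "Z\<^sup>2 \<le> 1" using assms(4) zero_le_power2[of X] zero_le_power2[of Y] by linarith
  then have "\<bar>Z\<bar> \<le> 1" by (simp add: abs_square_le_1)
  moreover have "(\<alpha> + 1) * z - \<alpha> * Z = c" using assms(1) by (simp add: z_def)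
  ultimately have z: "\<bar>z\<bar> < 1" using assms(1,2) abs_less_1_if_level by blast
  then show "\<bar>(c + \<alpha> * Z) / (\<alpha> + 1)\<bar> < 1" by (simp add: z_def)
  have "1 - z\<^sup>2 > 0" using z by (simp add: abs_square_less_1)
  then have r: "r > 0" "r\<^sup>2 = 1 - z\<^sup>2" by (simp_all add: r_def)
  have *: "shear_point \<alpha> c u1 u2 X Y Z = (vector [r * u1, r * u2, z], vector [u1 * X + u2 * Y, u1 * Y - u2 * X, Z])"
    by (simp add: shear_point_def z_def r_def Let_def)
  have "(r * u1)\<^sup>2 + (r * u2)\<^sup>2 + z\<^sup>2 = 1" using r(2) assms(3) by algebra
  moreover have "(u1 * X + u2 * Y)\<^sup>2 + (u1 * Y - u2 * X)\<^sup>2 + Z\<^sup>2 = 1" using assms(3,4) by algebra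
  ultimately show "shear_point \<alpha> c u1 u2 X Y Z \<in> S2xS2"
    unfolding * S2xS2_def by (simp only: mem_Times_iff fst_conv snd_conv vector_in_S2_iff)
  have "u1 * (u1 * X + u2 * Y) - u2 * (u1 * Y - u2 * X) = X"
    "u1 * (u1 * Y - u2 * X) + u2 * (u1 * X + u2 * Y) = Y" using assms(3) by algebra+
  then show "shear_coords (shear_point \<alpha> c u1 u2 X Y Z) = (u1, u2, X, Y, Z)"
    unfolding * using r(1) by (simp add: shear_coords_def flip: r_def)
qed

lemma shear_coords_props:
  assumes "\<alpha> > 0" "\<bar>c\<bar> < 1" "x \<in> S2xS2" "(\<alpha> + 1) * fst x $ 3 - \<alpha> * snd x $ 3 = c"
    "shear_coords x = (u1, u2, X, Y, Z)"
  shows "u1\<^sup>2 + u2\<^sup>2 = 1" "X\<^sup>2 + Y\<^sup>2 + Z\<^sup>2 = 1" "shear_point \<alpha> c u1 u2 X Y Z = x"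
proof -
  obtain p q where x: "x = (p, q)" by (cases x)
  have S: "p \<in> S2" "q \<in> S2" using assms(3) by (auto simp: S2xS2_def x)
  have p: "(p $ 1)\<^sup>2 + (p $ 2)\<^sup>2 + (p $ 3)\<^sup>2 = 1" and q: "(q $ 1)\<^sup>2 + (q $ 2)\<^sup>2 + (q $ 3)\<^sup>2 = 1"
    using S by (simp_all only: S2_iff)
  define r where "r = sqrt (1 - (p $ 3)\<^sup>2)"
  have "\<bar>p $ 3\<bar> < 1"
    using abs_less_1_if_level[OF assms(1,2) S2_nth_le[OF S(2)]] assms(4) by (simp add: x)
  then have "1 - (p $ 3)\<^sup>2 > 0" by (simp add: abs_square_less_1)
  then have r: "r > 0" "r\<^sup>2 = 1 - (p $ 3)\<^sup>2" by (simp_all add: r_def)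
  have u: "u1 = p $ 1 / r" "u2 = p $ 2 / r" "X = u1 * q $ 1 - u2 * q $ 2"
    "Y = u1 * q $ 2 + u2 * q $ 1" "Z = q $ 3"
    using assms(5) by (auto simp: shear_coords_def x Let_def r_def)
  then have ru: "r * u1 = p $ 1" "r * u2 = p $ 2" using r(1) by simp_all
  have "r\<^sup>2 * (u1\<^sup>2 + u2\<^sup>2) = (r * u1)\<^sup>2 + (r * u2)\<^sup>2" by algebra
  also have "\<dots> = r\<^sup>2 * 1" unfolding ru using p r(2) by simp
  finally show 1: "u1\<^sup>2 + u2\<^sup>2 = 1" using r(1) by simp
  show "X\<^sup>2 + Y\<^sup>2 + Z\<^sup>2 = 1" using 1 q u(3-5) by algebra
  have z: "(c + \<alpha> * Z) / (\<alpha> + 1) = p $ 3" using assms(1,4) u(5) by (simp add: x field_simps)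
  have "u1 * X + u2 * Y = q $ 1" "u1 * Y - u2 * X = q $ 2" using 1 u(3,4) by algebra+
  then show "shear_point \<alpha> c u1 u2 X Y Z = x"
    unfolding shear_point_def Let_def z r_def[symmetric] ru x using u(5) by (simp add: vector_3_collapse)
qed

text \<open>The profile \<open>g\<close> cancels the radius of the circle through p, so the
  Hamiltonian becomes \<alpha>/(2 pi) \<rho>(c) X in the coordinates above. Half a turn around the
  X-axis negates the second height, that is y, and since x - y is conserved, x goes to x -
  2y.\<close>

lemma shear_move:
  assumes \<alpha>: "\<alpha> > 0" and x: "x \<in> {-1 - \<alpha><..<1 + \<alpha>}" and y: "y \<in> {-\<alpha><..<\<alpha>}" and xy: "\<bar>x - y\<bar> < 1"
  shows "flat_equiv \<alpha> (split_torus \<alpha> x y) (split_torus \<alpha> (x - 2 * y) (- y))"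
proof -
  define c0 where "c0 = x - y"
  \<comment> \<open>Half of the gap between \<bar>c0\<bar> and 1: the closed band of radius
    \<epsilon> around \<open>c0\<close>, the complement of \<open>Z\<close> below, still lies in
    \<bar>c\<bar> < 1.\<close>
  define \<epsilon> where "\<epsilon> = (1 - \<bar>c0\<bar>) / 2"
  have \<epsilon>: "\<epsilon> > 0" using xy by (simp add: \<epsilon>_def c0_def)
  obtain \<rho> \<rho>' where bump: "Cinf_on UNIV \<rho>" "\<And>c. (\<rho> has_real_derivative \<rho>' c) (at c)"
    "\<And>c. \<bar>c - c0\<bar> \<ge> \<epsilon> \<Longrightarrow> \<rho> c = 0" "\<rho> c0 = 1" "\<rho>' c0 = 0"
    using bump_exists[OF \<epsilon>, of c0] by metis
  define Z where "Z = {c. \<epsilon> < \<bar>c - c0\<bar>}"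
  have absZ: "\<bar>c\<bar> < 1" if "c \<notin> Z" for c
    using that \<epsilon> abs_triangle_ineq[of "c - c0" c0] unfolding Z_def \<epsilon>_def by simp
  define g where "g t = 1 / sqrt (1 - t\<^sup>2)" for t :: real
  define g' where "g' t = t / (sqrt (1 - t\<^sup>2)) ^ 3" for t :: real
  have pos: "1 - t\<^sup>2 > 0" if "t \<in> {-1<..<1}" for t :: real
    using that by (simp add: abs_square_less_1 abs_less_iff)
  have id: "Cinf_on {-1<..<1} (\<lambda>c::real. c)" by (intro Cinf_on_linear) auto
  interpret probe \<alpha> "\<alpha> / (2 * pi)" "- 1" 0 "\<alpha> + 1" "- \<alpha>" \<rho> \<rho>' g g' "\<lambda>_. 1" "\<lambda>_. 0" "{-1<..<1}" UNIV Z
  proof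
    show "Cinf_on {- 1<..<1} g"
      unfolding g_def power2_eq_square
      by (intro Cinf_on_inverse_sqrt Cinf_on_diff Cinf_on_mult Cinf_on_const id)
        (use pos in \<open>auto simp: power2_eq_square\<close>)
    show "(g has_real_derivative g' t) (at t)" if "t \<in> {- 1<..<1}" for t
      using pos[OF that] unfolding g_def g'_def
      by (auto intro!: derivative_eq_intros simp: field_simps power3_eq_cube)
    show "open Z" unfolding Z_def by (intro open_Collect_less continuous_intros)
    show "\<rho> c = 0" if "c \<in> Z" for c using that bump(3) by (simp add: Z_def)
    fix p q :: "real^3"
    assume "p \<in> S2" and q: "q \<in> S2" and c: "0 + (\<alpha> + 1) * p $ 3 + - \<alpha> * q $ 3 \<notin> Z"
    have "(\<alpha> + 1) * p $ 3 - \<alpha> * q $ 3 = 0 + (\<alpha> + 1) * p $ 3 + - \<alpha> * q $ 3" by (simp only: add_0 minus_mult_left diff_conv_add_uminus)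
    from abs_less_1_if_level[OF \<alpha> absZ[OF c] S2_nth_le[OF q] this]
    show "p $ 3 \<in> {- 1<..<1} \<and> q $ 3 \<in> UNIV" by (simp add: abs_less_iff)
  next
    show "0 < \<alpha>" "Cinf_on UNIV \<rho>" by fact+
    show "(\<rho> has_real_derivative \<rho>' c) (at c)" for c by fact
    show "Cinf_on UNIV (\<lambda>_::real. 1::real)" by (rule Cinf_on_const[OF open_UNIV])
    show "((\<lambda>_. 1) has_real_derivative 0) (at z)" for z :: real by (rule DERIV_const)
  qed
  \<comment> \<open>Both c and X are conserved, so both angular speeds are constant along a
    trajectory. The angle \<sigma> of the drift of u comes from differentiating the cut-off; \<tau>
    is the rotation of the reduced sphere.\<close>
  define \<Phi> where "\<Phi> s x = (let c = level x; (u1, u2, X, Y, Z) = shear_coords x;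
      \<sigma> = \<alpha> * \<rho>' c * X * s; \<tau> = \<rho> c * s in
      shear_point \<alpha> c (u1 * cos \<sigma> - u2 * sin \<sigma>) (u2 * cos \<sigma> + u1 * sin \<sigma>)
        X (Y * cos \<tau> - Z * sin \<tau>) (Z * cos \<tau> + Y * sin \<tau>))" for s x
  have lev: "level x = (\<alpha> + 1) * fst x $ 3 - \<alpha> * snd x $ 3" for x by (simp add: level_def)
  have velocity: "velocity (shear_point \<alpha> c u1 u2 X Y Z) = (let z = (c + \<alpha> * Z) / (\<alpha> + 1); r = sqrt (1 - z\<^sup>2);
       z' = \<alpha> / (\<alpha> + 1) * (\<rho> c * Y); r' = - z * z' / r; u1' = - (\<alpha> * \<rho>' c * X * u2); u2' = \<alpha> * \<rho>' c * X * u1 in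
      (vector [r' * u1 + r * u1', r' * u2 + r * u2', z'],
       vector [u1' * X + (u2' * Y + u2 * (- (\<rho> c * Z))), u1' * Y + u1 * (- (\<rho> c * Z)) - u2' * X, \<rho> c * Y]))"
    "level (shear_point \<alpha> c u1 u2 X Y Z) = c"
    if "\<bar>c\<bar> < 1" "u1\<^sup>2 + u2\<^sup>2 = 1" "X\<^sup>2 + Y\<^sup>2 + Z\<^sup>2 = 1" for c u1 u2 X Y Z
  proof -
    define z where "z = (c + \<alpha> * Z) / (\<alpha> + 1)"
    define r where "r = sqrt (1 - z\<^sup>2)"
    define m where "m = 1 / r"
    define \<mu> where "\<mu> = \<alpha> / (\<alpha> + 1)"
    define q1 where "q1 = u1 * X + u2 * Y"
    define q2 where "q2 = u1 * Y - u2 * X"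
    have z: "\<bar>z\<bar> < 1" using shear_point_props(1)[OF \<alpha> that] by (simp add: z_def)
    have "1 - z\<^sup>2 > 0" using z by (intro pos) (simp add: abs_less_iff)
    then have r: "r > 0" "r * m = 1" by (simp_all add: r_def m_def)
    have g: "g z = m" "g' z = z * m ^ 3" by (simp_all add: g_def g'_def m_def power_divide flip: r_def)
    have \<mu>: "\<mu> * (\<alpha> + 1) = \<alpha>" using \<alpha> by (simp add: \<mu>_def)
    have sp: "shear_point \<alpha> c u1 u2 X Y Z = (vector [r * u1, r * u2, z], vector [q1, q2, Z])"
      by (simp add: shear_point_def z_def r_def Let_def q1_def q2_def)
    show l: "level (shear_point \<alpha> c u1 u2 X Y Z) = c"
      unfolding sp lev using \<alpha> by (simp add: z_def)
    have dr: "t / r = t * m" for t by (simp add: m_def)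
    have B: "r * u1 * q1 + - 1 * (r * u2 * q2) = r * X"
      unfolding q1_def q2_def using that(2) by algebra
    have G1: "grad1 (shear_point \<alpha> c u1 u2 X Y Z) = (\<alpha> / (2 * pi)) *\<^sub>R
        vector [\<rho> c * m * q1, - (\<rho> c * m * q2), (\<alpha> + 1) * \<rho>' c * X + \<rho> c * z * m\<^sup>2 * X]"
    proof -
      have "(\<alpha> + 1) * \<rho>' c * (m * 1) * (r * X) + \<rho> c * (z * m ^ 3) * 1 * (r * X) =
          (\<alpha> + 1) * \<rho>' c * X + \<rho> c * z * m\<^sup>2 * X" using r(2) by algebra
      then show ?thesis
        unfolding grad1_def l unfolding sp Let_def prod.case vector_3 B g by simp
    qed
    have G2: "grad2 (shear_point \<alpha> c u1 u2 X Y Z) = (\<alpha> / (2 * pi)) *\<^sub>R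
        vector [\<rho> c * u1, - (\<rho> c * u2), - (\<alpha> * \<rho>' c * X)]"
    proof -
      have e: "\<rho> c * (m * 1) * (r * u1) = \<rho> c * u1" "- 1 * \<rho> c * (m * 1) * (r * u2) = - (\<rho> c * u2)"
        "- \<alpha> * \<rho>' c * (m * 1) * (r * X) + \<rho> c * m * 0 * (r * X) = - (\<alpha> * \<rho>' c * X)"
        using r(2) by algebra+
      show ?thesis
        unfolding grad2_def l unfolding sp Let_def prod.case vector_3 B g e ..
    qed
    have k: "2 * pi / (\<alpha> + 1) * (\<alpha> / (2 * pi)) = \<mu>" "2 * pi / \<alpha> * (\<alpha> / (2 * pi)) = 1"
      using \<alpha> by (simp_all add: \<mu>_def)
    have v: "velocity (shear_point \<alpha> c u1 u2 X Y Z) =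
       (\<mu> *\<^sub>R cross3 (vector [\<rho> c * m * q1, - (\<rho> c * m * q2), (\<alpha> + 1) * \<rho>' c * X + \<rho> c * z * m\<^sup>2 * X])
           (vector [r * u1, r * u2, z]),
        cross3 (vector [\<rho> c * u1, - (\<rho> c * u2), - (\<alpha> * \<rho>' c * X)]) (vector [q1, q2, Z]))"
      unfolding velocity_def G1 G2 cross_mult_left scaleR_scaleR k unfolding sp by simp
    \<comment> \<open>With \<open>m\<close> and \<mu> in place of the quotients, the six components
      are polynomial identities modulo r m = 1, \<mu> (\<alpha> + 1) = \<alpha>, u1^2 + u2^2 = 1 and
      the formulas for q1, q2.\<close>
    have e: "\<mu> * (- (\<rho> c * m * q2) * z - ((\<alpha> + 1) * \<rho>' c * X + \<rho> c * z * m\<^sup>2 * X) * (r * u2)) =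
        (- z * (\<mu> * (\<rho> c * Y)) * m) * u1 + r * (- (\<alpha> * \<rho>' c * X * u2))"
      "\<mu> * (((\<alpha> + 1) * \<rho>' c * X + \<rho> c * z * m\<^sup>2 * X) * (r * u1) - \<rho> c * m * q1 * z) =
        (- z * (\<mu> * (\<rho> c * Y)) * m) * u2 + r * (\<alpha> * \<rho>' c * X * u1)"
      "\<mu> * (\<rho> c * m * q1 * (r * u2) - - (\<rho> c * m * q2) * (r * u1)) = \<mu> * (\<rho> c * Y)"
      "- (\<rho> c * u2) * Z - - (\<alpha> * \<rho>' c * X) * q2 =
        - (\<alpha> * \<rho>' c * X * u2) * X + (\<alpha> * \<rho>' c * X * u1 * Y + u2 * (- (\<rho> c * Z)))"
      "- (\<alpha> * \<rho>' c * X) * q1 - \<rho> c * u1 * Z =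
        - (\<alpha> * \<rho>' c * X * u2) * Y + u1 * (- (\<rho> c * Z)) - \<alpha> * \<rho>' c * X * u1 * X"
      "\<rho> c * u1 * q2 - - (\<rho> c * u2) * q1 = \<rho> c * Y"
      using r(2) \<mu> that(2) q1_def q2_def by algebra+
    show "velocity (shear_point \<alpha> c u1 u2 X Y Z) = (let z = (c + \<alpha> * Z) / (\<alpha> + 1); r = sqrt (1 - z\<^sup>2);
       z' = \<alpha> / (\<alpha> + 1) * (\<rho> c * Y); r' = - z * z' / r; u1' = - (\<alpha> * \<rho>' c * X * u2); u2' = \<alpha> * \<rho>' c * X * u1 in
      (vector [r' * u1 + r * u1', r' * u2 + r * u2', z'],
       vector [u1' * X + (u2' * Y + u2 * (- (\<rho> c * Z))), u1' * Y + u1 * (- (\<rho> c * Z)) - u2' * X, \<rho> c * Y]))"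
      unfolding v Let_def z_def[symmetric] r_def[symmetric] \<mu>_def[symmetric] dr cross3_def vector_3
        scaleR_vector_3 e ..
  qed
  have flow: "\<Phi> 0 w = w" "\<Phi> s w \<in> S2xS2" "level (\<Phi> s w) = level w"
    "((\<lambda>s. \<Phi> s w) has_vector_derivative velocity (\<Phi> s w)) (at s)"
    if w: "w \<in> S2xS2" "level w \<notin> Z" for w s
  proof -
    define c where "c = level w"
    obtain u1 u2 X Y Z where co: "shear_coords w = (u1, u2, X, Y, Z)" by (cases "shear_coords w")
    have c: "\<bar>c\<bar> < 1" using absZ[OF w(2)] by (simp add: c_def)
    note pr = shear_coords_props[OF \<alpha> c w(1) _ co, folded lev, OF c_def[symmetric]]
    define k where "k = \<alpha> * \<rho>' c * X"
    define U1 where "U1 s = u1 * cos (k * s) - u2 * sin (k * s)" for s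
    define U2 where "U2 s = u2 * cos (k * s) + u1 * sin (k * s)" for s
    define Y' where "Y' s = Y * cos (\<rho> c * s) - Z * sin (\<rho> c * s)" for s
    define Z' where "Z' s = Z * cos (\<rho> c * s) + Y * sin (\<rho> c * s)" for s
    define z where "z s = (c + \<alpha> * Z' s) / (\<alpha> + 1)" for s
    define r where "r s = sqrt (1 - (z s)\<^sup>2)" for s
    have \<Phi>: "\<Phi> s w = shear_point \<alpha> c (U1 s) (U2 s) X (Y' s) (Z' s)" for s
      by (simp add: \<Phi>_def Let_def co U1_def U2_def Y'_def Z'_def k_def c_def)
    then show "\<Phi> 0 w = w" using pr(3) by (simp add: U1_def U2_def Y'_def Z'_def)
    have "(U1 s)\<^sup>2 + (U2 s)\<^sup>2 = 1"
      using pr(1) sin_cos_squared_add[of "k * s"] unfolding U1_def U2_def by algebra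
    moreover have "X\<^sup>2 + (Y' s)\<^sup>2 + (Z' s)\<^sup>2 = 1"
      using pr(2) sin_cos_squared_add[of "\<rho> c * s"] unfolding Y'_def Z'_def by algebra
    ultimately have n: "\<bar>c\<bar> < 1" "(U1 s)\<^sup>2 + (U2 s)\<^sup>2 = 1" "X\<^sup>2 + (Y' s)\<^sup>2 + (Z' s)\<^sup>2 = 1"
      using c by auto
    show "\<Phi> s w \<in> S2xS2" unfolding \<Phi> by (rule shear_point_props[OF \<alpha> n])
    show "level (\<Phi> s w) = level w" unfolding \<Phi> velocity(2)[OF n] by (rule c_def)
    have "1 - (z s)\<^sup>2 > 0"
      using shear_point_props(1)[OF \<alpha> n, folded z_def] by (intro pos) (simp add: abs_less_iff)
    have dU1: "(U1 has_real_derivative - (k * U2 s)) (at s)"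
      unfolding U1_def[abs_def] U2_def by (auto intro!: derivative_eq_intros simp: algebra_simps)
    have dU2: "(U2 has_real_derivative k * U1 s) (at s)"
      unfolding U2_def[abs_def] U1_def by (auto intro!: derivative_eq_intros simp: algebra_simps)
    have dY: "(Y' has_real_derivative - (\<rho> c * Z' s)) (at s)"
      unfolding Y'_def[abs_def] Z'_def by (auto intro!: derivative_eq_intros simp: algebra_simps)
    have dZ: "(Z' has_real_derivative \<rho> c * Y' s) (at s)"
      unfolding Z'_def[abs_def] Y'_def by (auto intro!: derivative_eq_intros simp: algebra_simps)
    define dz where "dz = \<alpha> / (\<alpha> + 1) * (\<rho> c * Y' s)"
    have z: "(z has_real_derivative dz) (at s)"
      unfolding z_def[abs_def] dz_def
      by (rule DERIV_cong[OF DERIV_cdivide[OF DERIV_add[OF DERIV_const DERIV_cmult[OF dZ]]]]) simp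
    have d: "((\<lambda>s. 1 - (z s)\<^sup>2) has_real_derivative - (2 * z s * dz)) (at s)"
      by (rule DERIV_cong[OF DERIV_diff[OF DERIV_const DERIV_power[OF z]]]) simp
    have aux: "inverse q / 2 * - (2 * a * b) = - a * b / q" for q a b :: real
      by (cases "q = 0") (simp_all add: field_simps)
    have r: "(r has_real_derivative - z s * dz / r s) (at s)"
      unfolding r_def[abs_def]
      by (rule DERIV_cong[OF DERIV_chain2[where f = sqrt and g = "\<lambda>s. 1 - (z s)\<^sup>2",
              OF DERIV_real_sqrt[OF \<open>1 - (z s)\<^sup>2 > 0\<close>] d]])
        (rule aux)
    have "((\<lambda>s. r s * U s) has_real_derivative - z s * dz / r s * U s + r s * U') (at s)"
      if "(U has_real_derivative U') (at s)" for U U'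
      by (rule DERIV_cong[OF DERIV_mult'[OF r that]]) simp
    note rU = this[OF dU1] this[OF dU2]
    have q1: "((\<lambda>s. U1 s * X + U2 s * Y' s) has_real_derivative
        - (k * U2 s) * X + (k * U1 s * Y' s + U2 s * (- (\<rho> c * Z' s)))) (at s)"
      by (rule DERIV_cong[OF DERIV_add[OF DERIV_cmult_right[OF dU1] DERIV_mult'[OF dU2 dY]]]) simp
    have q2: "((\<lambda>s. U1 s * Y' s - U2 s * X) has_real_derivative
        - (k * U2 s) * Y' s + U1 s * (- (\<rho> c * Z' s)) - k * U1 s * X) (at s)"
      by (rule DERIV_cong[OF DERIV_diff[OF DERIV_mult'[OF dU1 dY] DERIV_cmult_right[OF dU2]]]) simp
    note D = has_vector_derivative_Pair[OF has_vector_derivative_vector_3[OF rU z]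
        has_vector_derivative_vector_3[OF q1 q2 dZ]]
    have "\<Phi> s w = (vector [r s * U1 s, r s * U2 s, z s], vector [U1 s * X + U2 s * Y' s, U1 s * Y' s - U2 s * X, Z' s])"
      for s unfolding \<Phi> shear_point_def Let_def z_def r_def ..
    moreover have "velocity (\<Phi> s w) =
       (vector [- z s * dz / r s * U1 s + r s * - (k * U2 s), - z s * dz / r s * U2 s + r s * (k * U1 s), dz],
        vector [- (k * U2 s) * X + (k * U1 s * Y' s + U2 s * - (\<rho> c * Z' s)),
          - (k * U2 s) * Y' s + U1 s * - (\<rho> c * Z' s) - k * U1 s * X, \<rho> c * Y' s])"
      unfolding \<Phi> velocity(1)[OF n] Let_def z_def[symmetric] r_def[symmetric] dz_def[symmetric] k_def[symmetric] ..
    ultimately show "((\<lambda>s. \<Phi> s w) has_vector_derivative velocity (\<Phi> s w)) (at s)"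
      using D by (simp only:)
  qed
  define T where "T v = {w \<in> S2xS2. level w = c0 \<and> snd w $ 3 = v}" for v
  have T: "split_torus \<alpha> a b = T (b / \<alpha>)"
    if "a \<in> {-1 - \<alpha><..<1 + \<alpha>}" "b \<in> {-\<alpha><..<\<alpha>}" "a - b = c0" for a b
  proof -
    have "fst w $ 3 = a / (\<alpha> + 1) \<longleftrightarrow> level w = c0" if "snd w $ 3 = b / \<alpha>" for w
      using that \<alpha> unfolding lev \<open>a - b = c0\<close>[symmetric] by (simp add: field_simps)
    then show ?thesis unfolding split_torus_eq[OF \<alpha> that(1,2)] T_def by blast
  qed
  have c0: "c0 \<notin> Z" using \<epsilon> by (simp add: Z_def)
  \<comment> \<open>On the central level \<rho> = 1 and \<rho>' = 0, so time pi is an exact half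
    turn with u fixed. Being an involution there, it maps the torus onto, and not merely into, its
    counterpart.\<close>
  have inv: "\<Phi> pi (\<Phi> pi w) = w" "snd (\<Phi> pi w) $ 3 = - snd w $ 3" if w: "w \<in> S2xS2" "level w = c0" for w
  proof -
    obtain u1 u2 X Y Z where co: "shear_coords w = (u1, u2, X, Y, Z)" by (cases "shear_coords w")
    note c = absZ[OF c0]
    note pr = shear_coords_props[OF \<alpha> c w(1) _ co, folded lev, OF w(2)]
    have n: "X\<^sup>2 + (- Y)\<^sup>2 + (- Z)\<^sup>2 = 1" using pr(2) by simp
    have \<Phi>: "\<Phi> pi w = shear_point \<alpha> c0 u1 u2 X (- Y) (- Z)"
      using bump(4,5) by (simp add: \<Phi>_def Let_def co w(2))
    have "level (\<Phi> pi w) = c0" "shear_coords (\<Phi> pi w) = (u1, u2, X, - Y, - Z)"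
      unfolding \<Phi> by (rule velocity(2)[OF c pr(1) n] shear_point_props(3)[OF \<alpha> c pr(1) n])+
    then show "\<Phi> pi (\<Phi> pi w) = w"
      using bump(4,5) pr(3) by (subst \<Phi>_def) (simp add: Let_def)
    have "snd w $ 3 = Z" unfolding pr(3)[symmetric] by (simp add: shear_point_def Let_def)
    then show "snd (\<Phi> pi w) $ 3 = - snd w $ 3" unfolding \<Phi> by (simp add: shear_point_def Let_def)
  qed
  have sub: "\<Phi> pi ` T v \<subseteq> T (- v)" for v
    using flow(2,3) inv(2) c0 unfolding T_def by auto
  have "\<Phi> pi ` T (y / \<alpha>) = T (- (y / \<alpha>))"
  proof (rule antisym[OF sub], rule subsetI)
    fix w assume w: "w \<in> T (- (y / \<alpha>))"
    then have "\<Phi> pi w \<in> T (y / \<alpha>)" using sub[of "- (y / \<alpha>)"] by auto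
    moreover have "\<Phi> pi (\<Phi> pi w) = w" using w inv(1) by (simp add: T_def)
    ultimately show "w \<in> \<Phi> pi ` T (y / \<alpha>)" by (metis imageI)
  qed
  moreover have "(\<lambda>w. if level w \<in> Z then w else \<Phi> pi w) ` T (y / \<alpha>) = \<Phi> pi ` T (y / \<alpha>)"
    by (rule image_cong) (use c0 in \<open>auto simp: T_def\<close>)
  moreover have "T (y / \<alpha>) \<subseteq> S2xS2" by (auto simp: T_def)
  ultimately have "flat_equiv \<alpha> (T (y / \<alpha>)) (T (- (y / \<alpha>)))"
    using ham_flow_imp_flat_equiv[OF ham_flow_ham[of \<Phi>], of "T (y / \<alpha>)" pi] flow by simp
  moreover have "split_torus \<alpha> x y = T (y / \<alpha>)" using x y by (intro T) (auto simp: c0_def)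
  moreover have "split_torus \<alpha> (x - 2 * y) (- y) = T (- y / \<alpha>)"
    using xy y by (intro T) (auto simp: c0_def abs_less_iff)
  ultimately show ?thesis by simp
qed

section \<open>The swap\<close>

text \<open>Near the pole of height 1, the sphere with area form scaled to \<open>A\<close> is a disc with Darboux
  coordinates \<open>(x, y)\<close>, the height being \<open>1 - (x\<^sup>2 + y\<^sup>2) / A\<close>. On the product of two such discs
  the swap is the unitary map that multiplies by \<open>\<i>\<close> and exchanges the two complex coordinates.\<close>

definition disc_point :: "real \<Rightarrow> real \<Rightarrow> real \<Rightarrow> real^3" where
  "disc_point A x y = (let z = 1 - (x\<^sup>2 + y\<^sup>2) / A; n = sqrt ((1 + z) / A) in vector [n * x, n * y, z])"

definition disc_coords :: "real \<Rightarrow> real^3 \<Rightarrow> real \<times> real" where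
  "disc_coords A p = (p $ 1 / sqrt ((1 + p $ 3) / A), p $ 2 / sqrt ((1 + p $ 3) / A))"

text \<open>The radius factor is forced: the circle of height z has squared radius (1 - z)(1 + z),
  while x^2 + y^2 = A (1 - z). At x^2 + y^2 = 2A the circles close up at the opposite pole.\<close>

lemma disc_point_props:
  assumes "A > 0" "x\<^sup>2 + y\<^sup>2 < 2 * A"
  shows "1 - (x\<^sup>2 + y\<^sup>2) / A > - 1" "disc_point A x y \<in> S2" "disc_coords A (disc_point A x y) = (x, y)"
    "disc_point A x y $ 3 = 1 - (x\<^sup>2 + y\<^sup>2) / A"
proof -
  define z where "z = 1 - (x\<^sup>2 + y\<^sup>2) / A"
  define n where "n = sqrt ((1 + z) / A)"
  have "(x\<^sup>2 + y\<^sup>2) / A < 2" using assms by (simp add: pos_divide_less_eq)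
  then have z: "z > - 1" by (simp add: z_def)
  then show "1 - (x\<^sup>2 + y\<^sup>2) / A > - 1" by (simp add: z_def)
  have n: "n > 0" "n\<^sup>2 = (1 + z) / A" using z assms(1) by (simp_all add: n_def)
  have *: "disc_point A x y = vector [n * x, n * y, z]"
    by (simp add: disc_point_def z_def n_def Let_def)
  then show "disc_point A x y $ 3 = 1 - (x\<^sup>2 + y\<^sup>2) / A" by (simp add: z_def)
  have "x\<^sup>2 + y\<^sup>2 = A * (1 - z)" "A * n\<^sup>2 = 1 + z" using assms(1) n(2) by (simp_all add: z_def)
  then have "(n * x)\<^sup>2 + (n * y)\<^sup>2 + z\<^sup>2 = 1" by algebra
  then show "disc_point A x y \<in> S2" unfolding * vector_in_S2_iff .
  show "disc_coords A (disc_point A x y) = (x, y)"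
    unfolding * disc_coords_def vector_3 n_def[symmetric] using n(1) by simp
qed

lemma disc_coords_props:
  assumes "A > 0" "p \<in> S2" "p $ 3 > - 1" "disc_coords A p = (x, y)"
  shows "x\<^sup>2 + y\<^sup>2 = A * (1 - p $ 3)" "disc_point A x y = p"
proof -
  define n where "n = sqrt ((1 + p $ 3) / A)"
  have n: "n > 0" "n\<^sup>2 = (1 + p $ 3) / A" using assms(1,3) by (simp_all add: n_def)
  then have xy: "n * x = p $ 1" "n * y = p $ 2"
    using assms(4) by (auto simp: disc_coords_def n_def)
  have p: "(p $ 1)\<^sup>2 + (p $ 2)\<^sup>2 + (p $ 3)\<^sup>2 = 1" using assms(2) by (simp only: S2_iff)
  have "n\<^sup>2 * (x\<^sup>2 + y\<^sup>2) = (n * x)\<^sup>2 + (n * y)\<^sup>2" by algebra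
  also have "\<dots> = 1 - (p $ 3)\<^sup>2" unfolding xy using p by simp
  also have "\<dots> = n\<^sup>2 * (A * (1 - p $ 3))"
  proof -
    have "A * n\<^sup>2 = 1 + p $ 3" using n(2) assms(1) by simp
    then have "n\<^sup>2 * (A * (1 - p $ 3)) = (1 + p $ 3) * (1 - p $ 3)" by (simp add: mult.commute)
    then show ?thesis by (simp add: power2_eq_square algebra_simps)
  qed
  finally show 1: "x\<^sup>2 + y\<^sup>2 = A * (1 - p $ 3)" using n(1) by simp
  have z: "1 - (x\<^sup>2 + y\<^sup>2) / A = p $ 3" unfolding 1 using assms(1) by simp
  show "disc_point A x y = p"
    unfolding disc_point_def Let_def z n_def[symmetric] xy by (rule vector_3_collapse)
qed

lemma has_vector_derivative_disc_point:
  assumes "A > 0" "(x s)\<^sup>2 + (y s)\<^sup>2 < 2 * A"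
    and x: "(x has_real_derivative x') (at s)" and y: "(y has_real_derivative y') (at s)"
  defines "n \<equiv> sqrt ((1 + disc_point A (x s) (y s) $ 3) / A)" and "z' \<equiv> - 2 * (x s * x' + y s * y') / A"
  defines "n' \<equiv> z' / (2 * A * n)"
  shows "((\<lambda>s. disc_point A (x s) (y s)) has_vector_derivative
    vector [n' * x s + n * x', n' * y s + n * y', z']) (at s)"
proof -
  define z where "z s = 1 - ((x s)\<^sup>2 + (y s)\<^sup>2) / A" for s
  define N where "N s = sqrt ((1 + z s) / A)" for s
  note pr = disc_point_props[OF assms(1,2), folded z_def]
  have n: "n = N s" by (simp only: n_def N_def pr)
  have dz: "(z has_real_derivative z') (at s)"
    unfolding z_def[abs_def] z'_def
    by (rule DERIV_cong[OF DERIV_diff[OF DERIV_const DERIV_cdivide[OF DERIV_add[OF DERIV_power[OF x] DERIV_power[OF y]]]]])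
      (use assms(1) in \<open>simp add: field_simps\<close>)
  have pos: "(1 + z s) / A > 0" using pr(1) assms(1) by simp
  have d: "((\<lambda>s. (1 + z s) / A) has_real_derivative z' / A) (at s)"
    by (rule DERIV_cong[OF DERIV_cdivide[OF DERIV_add[OF DERIV_const dz]]]) simp
  have aux: "inverse q / 2 * (a / A) = a / (2 * A * q)" for q a :: real
    using assms(1) by (cases "q = 0") (simp_all add: field_simps)
  have dN: "(N has_real_derivative n') (at s)"
    unfolding N_def[abs_def]
    by (rule DERIV_cong[OF DERIV_chain2[where f = sqrt and g = "\<lambda>s. (1 + z s) / A",
            OF DERIV_real_sqrt[OF pos] d]])
      (simp only: n'_def n N_def aux)
  have dU: "((\<lambda>s. N s * U s) has_real_derivative n' * U s + n * U') (at s)"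
    if "(U has_real_derivative U') (at s)" for U U'
    by (rule DERIV_cong[OF DERIV_mult'[OF dN that]]) (simp add: n)
  have "(\<lambda>s. disc_point A (x s) (y s)) = (\<lambda>s. vector [N s * x s, N s * y s, z s])"
    unfolding disc_point_def Let_def z_def N_def ..
  then show ?thesis using has_vector_derivative_vector_3[OF dU[OF x] dU[OF y] dz] by simp
qed

text \<open>One factor of the swap field. On the left is the Hamiltonian vector on the sphere; on
  the right the image under \<open>disc_point\<close> of the planar field i (\<rho> W + k w), where
  w = x + i y, W = X + i Y is the coordinate of the other factor, and \<open>k\<close> carries the
  derivative of the cut-off. Both factors are instances, with the roles of w and W
  exchanged.\<close>

lemma disc_velocity:
  fixes A x y X Y \<rho> \<rho>' m n z K k x' y' z' n' :: real
  assumes "A > 0" "n > 0" "A * n\<^sup>2 = 1 + z" "x\<^sup>2 + y\<^sup>2 = A * (1 - z)"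
  defines "m \<equiv> 1 / n" and "K \<equiv> x * X + y * Y"
  defines "k \<equiv> 2 * \<rho>' * K" and "x' \<equiv> - (\<rho> * Y) - 2 * \<rho>' * K * y" and "y' \<equiv> \<rho> * X + 2 * \<rho>' * K * x"
  defines "z' \<equiv> - 2 * (x * x' + y * y') / A"
  defines "n' \<equiv> z' / (2 * A * n)"
  shows "(- 2 / A) *\<^sub>R cross3 (vector [\<rho> * m * X, \<rho> * m * Y, - (A * \<rho>' * K) - \<rho> * m\<^sup>2 * K / (2 * A)])
      (vector [n * x, n * y, z]) = vector [n' * x + n * x', n' * y + n * y', z']"
proof -
  define v where "v = 1 / A"
  have v: "v * A = 1" using assms(1) by (simp add: v_def)
  have n0: "n \<noteq> 0" using assms(2) by simp
  have nm: "n * m = 1" using assms(2) by (simp add: m_def)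
  have d: "t / (2 * A) = t * v / 2" "t / A = t * v" "t / (2 * A * n) = t * v * m / 2" for t
    by (simp_all add: v_def m_def)
  have z': "z' = 2 * \<rho> * (x * Y - y * X) * v"
    unfolding z'_def x'_def y'_def d by algebra
  have z: "z = 1 - (x\<^sup>2 + y\<^sup>2) * v" and n: "n\<^sup>2 = (1 + z) * v" using assms(3,4) v by algebra+
  have e1: "- 2 * v * (\<rho> * m * Y * z - (- (A * \<rho>' * K) - \<rho> * m\<^sup>2 * K * v / 2) * (n * y)) =
      z' * v * m / 2 * x + n * x'"
  \<comment> \<open>Multiplying by the square root \<open>n\<close> leaves only even powers of it,
    and n^2 = (1 + z) v is polynomial.\<close>
  proof -
    have "n * (- 2 * v * (\<rho> * m * Y * z - (- (A * \<rho>' * K) - \<rho> * m\<^sup>2 * K * v / 2) * (n * y))) =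
      - 2 * v * \<rho> * Y * z - 2 * \<rho>' * K * y * n\<^sup>2 - \<rho> * K * v\<^sup>2 * y"
      using nm v by algebra
    also have "\<dots> = n * (z' * v * m / 2 * x + n * x')"
      using nm v z n z' unfolding x'_def K_def by algebra
    finally show ?thesis unfolding mult_left_cancel[OF n0] .
  qed
  have e2: "- 2 * v * ((- (A * \<rho>' * K) - \<rho> * m\<^sup>2 * K * v / 2) * (n * x) - \<rho> * m * X * z) =
      z' * v * m / 2 * y + n * y'"
  proof -
    have "n * (- 2 * v * ((- (A * \<rho>' * K) - \<rho> * m\<^sup>2 * K * v / 2) * (n * x) - \<rho> * m * X * z)) =
      2 * v * \<rho> * X * z + 2 * \<rho>' * K * x * n\<^sup>2 + \<rho> * K * v\<^sup>2 * x"
      using nm v by algebra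
    also have "\<dots> = n * (z' * v * m / 2 * y + n * y')"
      using nm v z n z' unfolding y'_def K_def by algebra
    finally show ?thesis unfolding mult_left_cancel[OF n0] .
  qed
  have e3: "- 2 * v * (\<rho> * m * X * (n * y) - \<rho> * m * Y * (n * x)) = z'"
    using nm z' by algebra
  show ?thesis
    unfolding cross3_def vector_3 scaleR_vector_3 n'_def d e1 e2 e3 ..
qed

text \<open>In the disc coordinates w1, w2 the Hamiltonian is -(1/pi) \<rho>(e) Re(w1 conj(w2)) with
  e = |w1|^2 + |w2|^2. On the torus |w1|^2 = \<alpha> + 1 - x and |w2|^2 = \<alpha> - y; exchanging
  these two numbers sends (x, y) to (1 + y, x - 1).\<close>

lemma swap_move:
  assumes \<alpha>: "\<alpha> > 0" and x: "x \<in> {-1 - \<alpha><..<1 + \<alpha>}" and y: "y \<in> {-\<alpha><..<\<alpha>}" and xy: "x + y > 1"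
  shows "flat_equiv \<alpha> (split_torus \<alpha> x y) (split_torus \<alpha> (1 + y) (x - 1))"
proof -
  \<comment> \<open>This is the squared radius of the sphere in C^2 that contains the torus. The
    condition x + y > 1 says that it is below 2\<alpha>, so that the ball fits into the smaller of
    the two discs; \<epsilon> is half of what is left.\<close>
  define e0 where "e0 = 2 * \<alpha> + 1 - x - y"
  define \<epsilon> where "\<epsilon> = (2 * \<alpha> - e0) / 2"
  have \<epsilon>: "\<epsilon> > 0" using xy by (simp add: \<epsilon>_def e0_def)
  obtain \<rho> \<rho>' where bump: "Cinf_on UNIV \<rho>" "\<And>c. (\<rho> has_real_derivative \<rho>' c) (at c)"
    "\<And>c. \<bar>c - e0\<bar> \<ge> \<epsilon> \<Longrightarrow> \<rho> c = 0" "\<rho> e0 = 1" "\<rho>' e0 = 0"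
    using bump_exists[OF \<epsilon>, of e0] by metis
  define Z where "Z = {c. \<epsilon> < \<bar>c - e0\<bar>}"
  have lessZ: "c < 2 * \<alpha>" if "c \<notin> Z" for c
    using that \<epsilon> abs_ge_self[of "c - e0"] unfolding Z_def \<epsilon>_def by simp
  \<comment> \<open>The reciprocal of the radius factor of \<open>disc_point\<close>, singular only
    at height -1. With it the product of the profiles and the bilinear term becomes the real part of
    w1 conj(w2).\<close>
  define g where "g A t = 1 / sqrt ((1 + t) / A)" for A t :: real
  define g' where "g' A t = - 1 / (2 * A * (sqrt ((1 + t) / A)) ^ 3)" for A t :: real
  have id: "Cinf_on {-1<..} (\<lambda>c::real. c)" by (intro Cinf_on_linear) auto
  have g: "Cinf_on {-1<..} (g A)" if "A > 0" for A
    unfolding g_def[abs_def] divide_inverse[of "1 + _"]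
    by (intro Cinf_on_inverse_sqrt[where f = "\<lambda>t. (1 + t) * inverse A"] Cinf_on_mult Cinf_on_add Cinf_on_const id)
      (use that in auto)
  have dg: "(g A has_real_derivative g' A t) (at t)" if "A > 0" "t \<in> {-1<..}" for A t
  proof -
    define q where "q = sqrt ((1 + t) / A)"
    have pos: "(1 + t) / A > 0" using that by simp
    then have q: "q > 0" by (simp add: q_def)
    have d: "((\<lambda>t. (1 + t) / A) has_real_derivative 1 / A) (at t)"
      by (rule DERIV_cong[OF DERIV_cdivide[OF DERIV_add[OF DERIV_const DERIV_ident]]]) simp
    have "((\<lambda>t. sqrt ((1 + t) / A)) has_real_derivative inverse q / 2 * (1 / A)) (at t)"
      unfolding q_def
      by (rule DERIV_chain2[where f = sqrt and g = "\<lambda>t. (1 + t) / A", OF DERIV_real_sqrt[OF pos] d])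
    from DERIV_inverse'[OF this, folded q_def]
    have "((\<lambda>t. inverse (sqrt ((1 + t) / A))) has_real_derivative
        - (inverse q * (inverse q / 2 * (1 / A)) * inverse q)) (at t)" using q by simp
    moreover have "- (inverse q * (inverse q / 2 * (1 / A)) * inverse q) = - 1 / (2 * A * q ^ 3)"
      using q that(1) by (simp add: field_simps power3_eq_cube)
    ultimately show ?thesis
      unfolding g_def[abs_def] g'_def q_def inverse_eq_divide by (simp only:)
  qed
  have above: "p $ 3 \<in> {-1<..}" "q $ 3 \<in> {-1<..}"
    if "p \<in> S2" "q \<in> S2" "(\<alpha> + 1) * (1 - p $ 3) + \<alpha> * (1 - q $ 3) < 2 * \<alpha>" for p q :: "real^3"
  proof -
    have "p $ 3 \<le> 1" "q $ 3 \<le> 1" using S2_nth_le[OF that(1)] S2_nth_le[OF that(2)] by auto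
    then have "(\<alpha> + 1) * (1 - p $ 3) \<ge> 0" "\<alpha> * (1 - q $ 3) \<ge> 0" using \<alpha> by auto
    then have "(\<alpha> + 1) * (1 - p $ 3) \<le> (\<alpha> + 1) * (1 - p $ 3) + \<alpha> * (1 - q $ 3)"
      "\<alpha> * (1 - q $ 3) \<le> (\<alpha> + 1) * (1 - p $ 3) + \<alpha> * (1 - q $ 3)" by simp_all
    from this[THEN le_less_trans, OF that(3)] \<alpha>
    have "(\<alpha> + 1) * (1 - p $ 3) < (\<alpha> + 1) * 2" "\<alpha> * (1 - q $ 3) < \<alpha> * 2" by simp_all
    then have "1 - p $ 3 < 2" "1 - q $ 3 < 2" using \<alpha> by (simp_all only: mult_less_cancel_left_pos)
    then show "p $ 3 \<in> {-1<..}" "q $ 3 \<in> {-1<..}" by simp_all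
  qed
  interpret probe \<alpha> "- 1 / pi" 1 "2 * \<alpha> + 1" "- (\<alpha> + 1)" "- \<alpha>" \<rho> \<rho>' "g (\<alpha> + 1)" "g' (\<alpha> + 1)" "g \<alpha>" "g' \<alpha>"
    "{-1<..}" "{-1<..}" Z
  proof
    show "0 < \<alpha>" "Cinf_on UNIV \<rho>" by fact+
    show "(\<rho> has_real_derivative \<rho>' c) (at c)" for c by fact
    show "Cinf_on {-1<..} (g (\<alpha> + 1))" "Cinf_on {-1<..} (g \<alpha>)" using \<alpha> by (auto intro: g)
    show "(g (\<alpha> + 1) has_real_derivative g' (\<alpha> + 1) t) (at t)" "(g \<alpha> has_real_derivative g' \<alpha> t) (at t)"
      if "t \<in> {-1<..}" for t using \<alpha> that by (auto intro: dg)
    show "open Z" unfolding Z_def by (intro open_Collect_less continuous_intros)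
    show "\<rho> c = 0" if "c \<in> Z" for c using that bump(3) by (simp add: Z_def)
    fix p q :: "real^3"
    assume pq: "p \<in> S2" "q \<in> S2" and c: "2 * \<alpha> + 1 + - (\<alpha> + 1) * p $ 3 + - \<alpha> * q $ 3 \<notin> Z"
    have "(\<alpha> + 1) * (1 - p $ 3) + \<alpha> * (1 - q $ 3) < 2 * \<alpha>"
      using lessZ[OF c] by (simp add: algebra_simps)
    from above[OF pq this] show "p $ 3 \<in> {-1<..} \<and> q $ 3 \<in> {-1<..}" by blast
  qed
  have lev: "level w = (\<alpha> + 1) * (1 - fst w $ 3) + \<alpha> * (1 - snd w $ 3)" for w
    unfolding level_def by (simp add: algebra_simps)
  define P where "P x1 y1 x2 y2 = (disc_point (\<alpha> + 1) x1 y1, disc_point \<alpha> x2 y2)" for x1 y1 x2 y2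
  have small: "x1\<^sup>2 + y1\<^sup>2 < 2 * (\<alpha> + 1)" "x2\<^sup>2 + y2\<^sup>2 < 2 * \<alpha>"
    if "x1\<^sup>2 + y1\<^sup>2 + x2\<^sup>2 + y2\<^sup>2 < 2 * \<alpha>" for x1 y1 x2 y2 :: real
  proof -
    have "0 \<le> x1\<^sup>2 + y1\<^sup>2" "0 \<le> x2\<^sup>2 + y2\<^sup>2" by simp_all
    then have "x1\<^sup>2 + y1\<^sup>2 < 2 * \<alpha>" and 2: "x2\<^sup>2 + y2\<^sup>2 < 2 * \<alpha>" using that by linarith+
    then show "x1\<^sup>2 + y1\<^sup>2 < 2 * (\<alpha> + 1)" by simp
    show "x2\<^sup>2 + y2\<^sup>2 < 2 * \<alpha>" by (rule 2)
  qed
  have \<alpha>1: "\<alpha> + 1 > 0" using \<alpha> by simp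
  have PM: "P x1 y1 x2 y2 \<in> S2xS2"
    and levP: "level (P x1 y1 x2 y2) = x1\<^sup>2 + y1\<^sup>2 + x2\<^sup>2 + y2\<^sup>2"
    if "x1\<^sup>2 + y1\<^sup>2 + x2\<^sup>2 + y2\<^sup>2 < 2 * \<alpha>" for x1 y1 x2 y2
  proof -
    note 1 = disc_point_props[OF \<alpha>1 small(1)[OF that]] and 2 = disc_point_props[OF \<alpha> small(2)[OF that]]
    show "P x1 y1 x2 y2 \<in> S2xS2" using 1(2) 2(2) by (simp add: P_def S2xS2_def)
    show "level (P x1 y1 x2 y2) = x1\<^sup>2 + y1\<^sup>2 + x2\<^sup>2 + y2\<^sup>2"
      unfolding lev P_def fst_conv snd_conv 1(4) 2(4) using \<alpha> \<alpha>1 by simp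
  qed
  \<comment> \<open>The derivative of \<open>P\<close> along w1' = i (r w2 + k w1), w2' = i (r w1 +
    k w2), again in the shape that the derivative rules produce.\<close>
  have velocity: "velocity (P x1 y1 x2 y2) = (let K = x1 * x2 + y1 * y2; k = 2 * \<rho>' e * K; r = \<rho> e;
      n1 = sqrt ((1 + disc_point (\<alpha> + 1) x1 y1 $ 3) / (\<alpha> + 1)); n2 = sqrt ((1 + disc_point \<alpha> x2 y2 $ 3) / \<alpha>);
      x1' = - (r * y2) - k * y1; y1' = r * x2 + k * x1; x2' = - (r * y1) - k * y2; y2' = r * x1 + k * x2;
      z1' = - 2 * (x1 * x1' + y1 * y1') / (\<alpha> + 1); z2' = - 2 * (x2 * x2' + y2 * y2') / \<alpha>;
      n1' = z1' / (2 * (\<alpha> + 1) * n1); n2' = z2' / (2 * \<alpha> * n2) in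
      (vector [n1' * x1 + n1 * x1', n1' * y1 + n1 * y1', z1'], vector [n2' * x2 + n2 * x2', n2' * y2 + n2 * y2', z2']))"
    if e: "x1\<^sup>2 + y1\<^sup>2 + x2\<^sup>2 + y2\<^sup>2 = e" "e < 2 * \<alpha>" for x1 y1 x2 y2 e
  proof -
    note e' = e(2)[folded e(1)]
    note 1 = disc_point_props[OF \<alpha>1 small(1)[OF e']] and 2 = disc_point_props[OF \<alpha> small(2)[OF e']]
    define z1 where "z1 = disc_point (\<alpha> + 1) x1 y1 $ 3"
    define z2 where "z2 = disc_point \<alpha> x2 y2 $ 3"
    define n1 where "n1 = sqrt ((1 + z1) / (\<alpha> + 1))"
    define n2 where "n2 = sqrt ((1 + z2) / \<alpha>)"
    define m1 where "m1 = 1 / n1"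
    define m2 where "m2 = 1 / n2"
    define K where "K = x1 * x2 + y1 * y2"
    have z: "z1 > - 1" "z2 > - 1" using 1(1,4) 2(1,4) by (simp_all add: z1_def z2_def)
    have n: "n1 > 0" "n2 > 0" "(\<alpha> + 1) * n1\<^sup>2 = 1 + z1" "\<alpha> * n2\<^sup>2 = 1 + z2"
      using z \<alpha> by (simp_all add: n1_def n2_def)
    then have m: "n1 * m1 = 1" "n2 * m2 = 1" by (simp_all add: m1_def m2_def)
    have q: "x1\<^sup>2 + y1\<^sup>2 = (\<alpha> + 1) * (1 - z1)" "x2\<^sup>2 + y2\<^sup>2 = \<alpha> * (1 - z2)"
      using \<alpha> \<alpha>1 unfolding z1_def z2_def 1(4) 2(4) by simp_all
    have d: "disc_point (\<alpha> + 1) x1 y1 = vector [n1 * x1, n1 * y1, z1]"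
      "disc_point \<alpha> x2 y2 = vector [n2 * x2, n2 * y2, z2]"
      unfolding n1_def n2_def z1_def z2_def 1(4) 2(4) by (simp_all only: disc_point_def Let_def)
    have gs: "g (\<alpha> + 1) z1 = m1" "g \<alpha> z2 = m2"
      unfolding g_def m1_def m2_def n1_def n2_def by simp_all
    have gs': "g' (\<alpha> + 1) z1 = - (m1 ^ 3) / (2 * (\<alpha> + 1))" "g' \<alpha> z2 = - (m2 ^ 3) / (2 * \<alpha>)"
      unfolding g'_def m1_def m2_def n1_def[symmetric] n2_def[symmetric] by (simp_all add: power_divide)
    have l: "level (P x1 y1 x2 y2) = e" using levP[OF e'] e(1) by simp
    have B: "n1 * x1 * (n2 * x2) + 1 * (n1 * y1 * (n2 * y2)) = n1 * n2 * K"
      unfolding K_def by algebra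
    have G1: "grad1 (P x1 y1 x2 y2) = (- 1 / pi) *\<^sub>R vector [\<rho> e * m1 * x2, \<rho> e * m1 * y2,
        - ((\<alpha> + 1) * \<rho>' e * K) - \<rho> e * m1\<^sup>2 * K / (2 * (\<alpha> + 1))]"
    proof -
      have 3: "\<rho> e * (m1 * m2) * (n2 * x2) = \<rho> e * m1 * x2" "1 * \<rho> e * (m1 * m2) * (n2 * y2) = \<rho> e * m1 * y2"
        "- (\<alpha> + 1) * \<rho>' e * (m1 * m2) * (n1 * n2 * K) = - ((\<alpha> + 1) * \<rho>' e * K)"
        "\<rho> e * (- (m1 ^ 3)) * m2 * (n1 * n2 * K) = - (\<rho> e * m1\<^sup>2 * K)"
        using m by algebra+
      have "\<rho> e * (- (m1 ^ 3) / (2 * (\<alpha> + 1))) * m2 * (n1 * n2 * K) =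
        \<rho> e * (- (m1 ^ 3)) * m2 * (n1 * n2 * K) / (2 * (\<alpha> + 1))" by simp
      also have "\<dots> = - (\<rho> e * m1\<^sup>2 * K / (2 * (\<alpha> + 1)))" unfolding 3 by simp
      finally have 4: "\<rho> e * (- (m1 ^ 3) / (2 * (\<alpha> + 1))) * m2 * (n1 * n2 * K) =
        - (\<rho> e * m1\<^sup>2 * K / (2 * (\<alpha> + 1)))" .
      show ?thesis
        unfolding grad1_def l unfolding P_def d Let_def prod.case vector_3 B gs gs' 3(1-3) 4
        by (simp only: diff_conv_add_uminus)
    qed
    have G2: "grad2 (P x1 y1 x2 y2) = (- 1 / pi) *\<^sub>R vector [\<rho> e * m2 * x1, \<rho> e * m2 * y1,
        - (\<alpha> * \<rho>' e * K) - \<rho> e * m2\<^sup>2 * K / (2 * \<alpha>)]"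
    proof -
      have 3: "\<rho> e * (m1 * m2) * (n1 * x1) = \<rho> e * m2 * x1" "1 * \<rho> e * (m1 * m2) * (n1 * y1) = \<rho> e * m2 * y1"
        "- \<alpha> * \<rho>' e * (m1 * m2) * (n1 * n2 * K) = - (\<alpha> * \<rho>' e * K)"
        "\<rho> e * m1 * (- (m2 ^ 3)) * (n1 * n2 * K) = - (\<rho> e * m2\<^sup>2 * K)"
        using m by algebra+
      have "\<rho> e * m1 * (- (m2 ^ 3) / (2 * \<alpha>)) * (n1 * n2 * K) =
        \<rho> e * m1 * (- (m2 ^ 3)) * (n1 * n2 * K) / (2 * \<alpha>)" by simp
      also have "\<dots> = - (\<rho> e * m2\<^sup>2 * K / (2 * \<alpha>))" unfolding 3 by simp
      finally have 4: "\<rho> e * m1 * (- (m2 ^ 3) / (2 * \<alpha>)) * (n1 * n2 * K) = - (\<rho> e * m2\<^sup>2 * K / (2 * \<alpha>))" .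
      show ?thesis
        unfolding grad2_def l unfolding P_def d Let_def prod.case vector_3 B gs gs' 3(1-3) 4
        by (simp only: diff_conv_add_uminus)
    qed
    have k: "2 * pi / A * (- 1 / pi) = - 2 / A" for A by simp
    have K: "x2 * x1 + y2 * y1 = K" by (simp add: K_def mult.commute)
    note v1 = disc_velocity[OF \<alpha>1 n(1,3) q(1), of "\<rho> e" x2 y2 "\<rho>' e", folded m1_def K_def]
      and v2 = disc_velocity[OF \<alpha> n(2,4) q(2), of "\<rho> e" x1 y1 "\<rho>' e", folded m2_def, unfolded K]
    show ?thesis
      unfolding velocity_def G1 G2 cross_mult_left scaleR_scaleR k
      unfolding P_def fst_conv snd_conv Let_def z1_def[symmetric] z2_def[symmetric]
      unfolding n1_def[symmetric] n2_def[symmetric] K_def[symmetric] d v1 v2 ..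
  qed
  \<comment> \<open>The exchange term and the common phase commute and e, K are conserved, so the
    flow is the mixing by cos \<tau> and i sin \<tau> (a1, b1, a2, b2) followed by the rotation of
    both discs by \<sigma>.\<close>
  define \<Phi> where "\<Phi> s w = (let e = level w; (x1, y1) = disc_coords (\<alpha> + 1) (fst w); (x2, y2) = disc_coords \<alpha> (snd w);
      \<sigma> = 2 * \<rho>' e * (x1 * x2 + y1 * y2) * s; \<tau> = \<rho> e * s;
      a1 = x1 * cos \<tau> - y2 * sin \<tau>; b1 = y1 * cos \<tau> + x2 * sin \<tau>;
      a2 = x2 * cos \<tau> - y1 * sin \<tau>; b2 = y2 * cos \<tau> + x1 * sin \<tau> in
      P (a1 * cos \<sigma> - b1 * sin \<sigma>) (b1 * cos \<sigma> + a1 * sin \<sigma>)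
        (a2 * cos \<sigma> - b2 * sin \<sigma>) (b2 * cos \<sigma> + a2 * sin \<sigma>))" for s w
  have coords: "x1\<^sup>2 + y1\<^sup>2 + x2\<^sup>2 + y2\<^sup>2 = level w" "P x1 y1 x2 y2 = w"
    "x1\<^sup>2 + y1\<^sup>2 = (\<alpha> + 1) * (1 - fst w $ 3)" "x2\<^sup>2 + y2\<^sup>2 = \<alpha> * (1 - snd w $ 3)"
    if w: "w \<in> S2xS2" "level w \<notin> Z" "disc_coords (\<alpha> + 1) (fst w) = (x1, y1)" "disc_coords \<alpha> (snd w) = (x2, y2)"
    for w x1 y1 x2 y2
  proof -
    have S: "fst w \<in> S2" "snd w \<in> S2" using w(1) by (auto simp: S2xS2_def)
    from above[OF this lessZ[OF w(2), unfolded lev]] have 3: "fst w $ 3 > - 1" "snd w $ 3 > - 1" by simp_all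
    note 1 = disc_coords_props[OF \<alpha>1 S(1) 3(1) w(3)] and 2 = disc_coords_props[OF \<alpha> S(2) 3(2) w(4)]
    show "x1\<^sup>2 + y1\<^sup>2 + x2\<^sup>2 + y2\<^sup>2 = level w" using 1(1) 2(1) unfolding lev by linarith
    show "P x1 y1 x2 y2 = w" unfolding P_def 1(2) 2(2) by simp
    show "x1\<^sup>2 + y1\<^sup>2 = (\<alpha> + 1) * (1 - fst w $ 3)" "x2\<^sup>2 + y2\<^sup>2 = \<alpha> * (1 - snd w $ 3)" by fact+
  qed
  have flow: "\<Phi> 0 w = w" "\<Phi> s w \<in> S2xS2" "level (\<Phi> s w) = level w"
    "((\<lambda>s. \<Phi> s w) has_vector_derivative velocity (\<Phi> s w)) (at s)"
    if w: "w \<in> S2xS2" "level w \<notin> Z" for w s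
  proof -
    define e where "e = level w"
    obtain x1 y1 x2 y2 where co: "disc_coords (\<alpha> + 1) (fst w) = (x1, y1)" "disc_coords \<alpha> (snd w) = (x2, y2)"
      by (cases "disc_coords (\<alpha> + 1) (fst w)", cases "disc_coords \<alpha> (snd w)") blast
    note pr = coords[OF w co, folded e_def]
    define K where "K = x1 * x2 + y1 * y2"
    define k where "k = 2 * \<rho>' e * K"
    define a1 where "a1 s = x1 * cos (\<rho> e * s) - y2 * sin (\<rho> e * s)" for s
    define b1 where "b1 s = y1 * cos (\<rho> e * s) + x2 * sin (\<rho> e * s)" for s
    define a2 where "a2 s = x2 * cos (\<rho> e * s) - y1 * sin (\<rho> e * s)" for s
    define b2 where "b2 s = y2 * cos (\<rho> e * s) + x1 * sin (\<rho> e * s)" for s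
    define X1 where "X1 s = a1 s * cos (k * s) - b1 s * sin (k * s)" for s
    define Y1 where "Y1 s = b1 s * cos (k * s) + a1 s * sin (k * s)" for s
    define X2 where "X2 s = a2 s * cos (k * s) - b2 s * sin (k * s)" for s
    define Y2 where "Y2 s = b2 s * cos (k * s) + a2 s * sin (k * s)" for s
    have \<Phi>: "\<Phi> s w = P (X1 s) (Y1 s) (X2 s) (Y2 s)" for s
      unfolding \<Phi>_def Let_def co prod.case e_def[symmetric] K_def[symmetric] k_def[symmetric]
        X1_def Y1_def X2_def Y2_def a1_def b1_def a2_def b2_def ..
    show "\<Phi> 0 w = w" unfolding \<Phi> X1_def Y1_def X2_def Y2_def a1_def b1_def a2_def b2_def using pr(2) by simp
    have t: "(sin (\<rho> e * s))\<^sup>2 + (cos (\<rho> e * s))\<^sup>2 = 1" "(sin (k * s))\<^sup>2 + (cos (k * s))\<^sup>2 = 1"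
      by (rule sin_cos_squared_add)+
    have "(a1 s)\<^sup>2 + (b1 s)\<^sup>2 + (a2 s)\<^sup>2 + (b2 s)\<^sup>2 =
        ((sin (\<rho> e * s))\<^sup>2 + (cos (\<rho> e * s))\<^sup>2) * (x1\<^sup>2 + y1\<^sup>2 + x2\<^sup>2 + y2\<^sup>2)"
      unfolding a1_def b1_def a2_def b2_def by algebra
    then have a: "(a1 s)\<^sup>2 + (b1 s)\<^sup>2 + (a2 s)\<^sup>2 + (b2 s)\<^sup>2 = e" unfolding t pr(1) by simp
    have "a1 s * a2 s + b1 s * b2 s = ((sin (\<rho> e * s))\<^sup>2 + (cos (\<rho> e * s))\<^sup>2) * K"
      unfolding a1_def b1_def a2_def b2_def K_def by algebra
    then have b: "a1 s * a2 s + b1 s * b2 s = K" unfolding t by simp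
    have "(X1 s)\<^sup>2 + (Y1 s)\<^sup>2 + (X2 s)\<^sup>2 + (Y2 s)\<^sup>2 =
        ((sin (k * s))\<^sup>2 + (cos (k * s))\<^sup>2) * ((a1 s)\<^sup>2 + (b1 s)\<^sup>2 + (a2 s)\<^sup>2 + (b2 s)\<^sup>2)"
      unfolding X1_def Y1_def X2_def Y2_def by algebra
    then have n: "(X1 s)\<^sup>2 + (Y1 s)\<^sup>2 + (X2 s)\<^sup>2 + (Y2 s)\<^sup>2 = e" unfolding t a by simp
    have "X1 s * X2 s + Y1 s * Y2 s = ((sin (k * s))\<^sup>2 + (cos (k * s))\<^sup>2) * (a1 s * a2 s + b1 s * b2 s)"
      unfolding X1_def Y1_def X2_def Y2_def by algebra
    then have K: "X1 s * X2 s + Y1 s * Y2 s = K" unfolding t b by simp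
    have e: "e < 2 * \<alpha>" using lessZ[OF w(2)] by (simp add: e_def)
    note n' = e[folded n]
    show "\<Phi> s w \<in> S2xS2" unfolding \<Phi> by (rule PM[OF n'])
    show "level (\<Phi> s w) = level w" unfolding \<Phi> levP[OF n'] n by (rule e_def)
    have da: "(a1 has_real_derivative - (\<rho> e * b2 s)) (at s)" "(b1 has_real_derivative \<rho> e * a2 s) (at s)"
      "(a2 has_real_derivative - (\<rho> e * b1 s)) (at s)" "(b2 has_real_derivative \<rho> e * a1 s) (at s)"
      unfolding a1_def[abs_def] b1_def[abs_def] a2_def[abs_def] b2_def[abs_def]
      by (auto intro!: derivative_eq_intros simp: algebra_simps)
    have dX: "(X1 has_real_derivative - (\<rho> e * Y2 s) - k * Y1 s) (at s)"
      "(Y1 has_real_derivative \<rho> e * X2 s + k * X1 s) (at s)"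
      "(X2 has_real_derivative - (\<rho> e * Y1 s) - k * Y2 s) (at s)"
      "(Y2 has_real_derivative \<rho> e * X1 s + k * X2 s) (at s)"
      unfolding X1_def[abs_def] Y1_def[abs_def] X2_def[abs_def] Y2_def[abs_def]
      by (auto intro!: derivative_eq_intros da simp: algebra_simps)
    note D = has_vector_derivative_Pair[OF
        has_vector_derivative_disc_point[OF \<alpha>1 small(1)[OF n'] dX(1,2)]
        has_vector_derivative_disc_point[OF \<alpha> small(2)[OF n'] dX(3,4)]]
    show "((\<lambda>s. \<Phi> s w) has_vector_derivative velocity (\<Phi> s w)) (at s)"
      unfolding \<Phi> velocity[OF n e] unfolding P_def Let_def K k_def[symmetric] by (rule D)
  qed
  define T where "T a b = {w \<in> S2xS2. fst w $ 3 = a / (\<alpha> + 1) \<and> snd w $ 3 = b / \<alpha>}" for a b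
  have levT: "level w = 2 * \<alpha> + 1 - a - b" if "w \<in> T a b" for w a b
    using that \<alpha> \<alpha>1 unfolding T_def lev by (simp add: field_simps)
  have e0: "e0 \<notin> Z" using \<epsilon> by (simp add: Z_def)
  \<comment> \<open>The time pi/2 map squares to -1 and not to the identity, so its inverse is taken
    at time -pi/2. Stating both times together, for every torus on the level, gives both inclusions
    below, since the map (a, b) to (1 + b, a - 1) is an involution of the parameters.\<close>
  have inv: "\<Phi> (- s) (\<Phi> s w) = w" "\<Phi> s w \<in> T (1 + b) (a - 1)"
    if w: "w \<in> T a b" "a + b = x + y" "s = pi / 2 \<or> s = - (pi / 2)" for w s a b
  proof -
    have S: "w \<in> S2xS2" and l: "level w = e0" using w levT[OF w(1)] by (auto simp: T_def e0_def)
    obtain x1 y1 x2 y2 where co: "disc_coords (\<alpha> + 1) (fst w) = (x1, y1)" "disc_coords \<alpha> (snd w) = (x2, y2)"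
      by (cases "disc_coords (\<alpha> + 1) (fst w)", cases "disc_coords \<alpha> (snd w)") blast
    note pr = coords[OF S _ co, unfolded l, OF e0]
    define t where "t = sin s"
    have c: "cos s = 0" using w(3) by (elim disjE) (simp_all only: cos_minus cos_pi_half)
    then have t: "cos s = 0" "t\<^sup>2 = 1" "sin (- s) = - t"
      using sin_cos_squared_add[of s] by (simp_all add: t_def)
    have \<Phi>: "\<Phi> s w = P (- y2 * t) (x2 * t) (- y1 * t) (x1 * t)"
      unfolding \<Phi>_def co Let_def l prod.case bump(4,5) using t by (simp add: t_def)
    have q: "(- y2 * t)\<^sup>2 + (x2 * t)\<^sup>2 = x2\<^sup>2 + y2\<^sup>2" "(- y1 * t)\<^sup>2 + (x1 * t)\<^sup>2 = x1\<^sup>2 + y1\<^sup>2"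
      using t(2) by algebra+
    have "(- y2 * t)\<^sup>2 + (x2 * t)\<^sup>2 + (- y1 * t)\<^sup>2 + (x1 * t)\<^sup>2 = e0"
      using pr(1) q by simp
    note sm = small[OF lessZ[OF e0, folded this]] and lv = levP[OF lessZ[OF e0, folded this], unfolded this]
      and SS = PM[OF lessZ[OF e0, folded this]]
    note 1 = disc_point_props[OF \<alpha>1 sm(1)] and 2 = disc_point_props[OF \<alpha> sm(2)]
    have tt: "x * t * t = x" for x using t(2) by (simp add: power2_eq_square mult.assoc)
    have "\<Phi> (- s) (P (- y2 * t) (x2 * t) (- y1 * t) (x1 * t)) = P x1 y1 x2 y2"
      unfolding \<Phi>_def lv unfolding P_def fst_conv snd_conv 1(3) 2(3) Let_def prod.case bump(4,5)
      using t(1,3) by (simp add: tt)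
    then show "\<Phi> (- s) (\<Phi> s w) = w" unfolding \<Phi> pr(2) .
    have ab: "fst w $ 3 = a / (\<alpha> + 1)" "snd w $ 3 = b / \<alpha>" using w(1) by (simp_all add: T_def)
    have "1 - \<alpha> * (1 - b / \<alpha>) / (\<alpha> + 1) = (1 + b) / (\<alpha> + 1)" "1 - (\<alpha> + 1) * (1 - a / (\<alpha> + 1)) / \<alpha> = (a - 1) / \<alpha>"
    proof -
      have e1: "\<alpha> * (1 - b / \<alpha>) = \<alpha> - b" using \<alpha> by (simp add: right_diff_distrib)
      have e2: "(\<alpha> + 1) * (1 - a / (\<alpha> + 1)) = \<alpha> + 1 - a"
        unfolding right_diff_distrib using \<alpha>1 by simp
      show "1 - \<alpha> * (1 - b / \<alpha>) / (\<alpha> + 1) = (1 + b) / (\<alpha> + 1)"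
        "1 - (\<alpha> + 1) * (1 - a / (\<alpha> + 1)) / \<alpha> = (a - 1) / \<alpha>"
        unfolding e1 e2 using \<alpha> \<alpha>1 by (simp_all add: field_simps)
    qed
    then show "\<Phi> s w \<in> T (1 + b) (a - 1)"
      using SS unfolding \<Phi> T_def mem_Collect_eq unfolding P_def fst_conv snd_conv 1(4) 2(4) q pr(3,4) ab by simp
  qed
  have "\<Phi> (pi / 2) ` T x y = T (1 + y) (x - 1)"
  proof (rule antisym; rule subsetI)
    fix w assume "w \<in> \<Phi> (pi / 2) ` T x y"
    then show "w \<in> T (1 + y) (x - 1)" using inv(2)[of _ x y "pi / 2"] by auto
  next
    fix w assume w: "w \<in> T (1 + y) (x - 1)"
    then have "\<Phi> (- (pi / 2)) w \<in> T x y" "\<Phi> (pi / 2) (\<Phi> (- (pi / 2)) w) = w"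
      using inv[OF w, of "- (pi / 2)"] by simp_all
    then show "w \<in> \<Phi> (pi / 2) ` T x y" by (metis imageI)
  qed
  moreover have "(\<lambda>w. if level w \<in> Z then w else \<Phi> (pi / 2) w) ` T x y = \<Phi> (pi / 2) ` T x y"
    by (rule image_cong) (use e0 levT[of _ x y] in \<open>auto simp: e0_def\<close>)
  moreover have "T x y \<subseteq> S2xS2" by (auto simp: T_def)
  ultimately have "flat_equiv \<alpha> (T x y) (T (1 + y) (x - 1))"
    using ham_flow_imp_flat_equiv[OF ham_flow_ham[of \<Phi>], of "T x y" "pi / 2"] flow by simp
  moreover have "split_torus \<alpha> x y = T x y" unfolding T_def by (rule split_torus_eq[OF \<alpha> x y])
  moreover have "split_torus \<alpha> (1 + y) (x - 1) = T (1 + y) (x - 1)"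
    unfolding T_def by (rule split_torus_eq[OF \<alpha>]) (use x y xy \<alpha> in auto)
  ultimately show ?thesis by simp
qed

section \<open>Reflections\<close>

definition rotate_x :: "real \<Rightarrow> real^3 \<Rightarrow> real^3" where
  "rotate_x s p = vector [p $ 1, p $ 2 * cos s - p $ 3 * sin s, p $ 3 * cos s + p $ 2 * sin s]"

lemma rotate_x_S2: "p \<in> S2 \<Longrightarrow> rotate_x s p \<in> S2"
proof -
  assume p: "p \<in> S2"
  have "(p $ 1)\<^sup>2 + (p $ 2 * cos s - p $ 3 * sin s)\<^sup>2 + (p $ 3 * cos s + p $ 2 * sin s)\<^sup>2 =
      (p $ 1)\<^sup>2 + ((sin s)\<^sup>2 + (cos s)\<^sup>2) * ((p $ 2)\<^sup>2 + (p $ 3)\<^sup>2)"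
    unfolding power2_eq_square by (simp only: algebra_simps)
  then show ?thesis
    using p[unfolded S2_iff] unfolding rotate_x_def vector_in_S2_iff by simp
qed

lemma rotate_x_0: "rotate_x 0 p = p"
  by (simp add: rotate_x_def vector_3_collapse)

lemma rotate_x_pi: "rotate_x pi (rotate_x pi p) = p" "rotate_x pi p $ 3 = - p $ 3"
  by (simp_all add: rotate_x_def vector_3_collapse)

lemma has_vector_derivative_rotate_x:
  "((\<lambda>s. rotate_x s p) has_vector_derivative cross3 (axis 1 1) (rotate_x s p)) (at s)"
proof -
  have "cross3 (axis 1 1) q = vector [0, - q $ 3, q $ 2]" for q :: "real^3"
    by (simp add: cross3_def axis_def)
  moreover have "((\<lambda>s. rotate_x s p) has_vector_derivative
      vector [0, - rotate_x s p $ 3, rotate_x s p $ 2]) (at s)"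
    unfolding rotate_x_def vector_3
    by (intro has_vector_derivative_vector_3) (auto intro!: derivative_eq_intros)
  ultimately show ?thesis by simp
qed

text \<open>The first coordinate of a factor generates rotation around the first axis; the constants
  normalise the angular speed to 1. At time pi this negates the height, which is the reflection of
  the moment rectangle.\<close>

lemma ham_flow_rotate:
  assumes "\<alpha> > 0"
  shows "ham_flow \<alpha> (\<lambda>x. (\<alpha> + 1) / (2 * pi) * fst x $ 1) (\<lambda>s x. (rotate_x s (fst x), snd x))"
    and "ham_flow \<alpha> (\<lambda>x. \<alpha> / (2 * pi) * snd x $ 1) (\<lambda>s x. (fst x, rotate_x s (snd x)))"
proof -
  have a: "axis 1 1 \<bullet> w = w $ 1" for w :: "real^3" by (simp add: inner_axis')
  have "((\<lambda>x :: (real^3) \<times> (real^3). k * fst x $ 1) has_derivative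
      (\<lambda>w. (k *\<^sub>R axis 1 1) \<bullet> fst w + 0 \<bullet> snd w)) (at x)"
    "((\<lambda>x :: (real^3) \<times> (real^3). k * snd x $ 1) has_derivative
      (\<lambda>w. 0 \<bullet> fst w + (k *\<^sub>R axis 1 1) \<bullet> snd w)) (at x)" for k x
    unfolding a inner_scaleR_left inner_zero_left add_0_right add_0_left
    by (intro has_derivative_mult_right bounded_linear_imp_has_derivative
        bounded_linear_fst_nth bounded_linear_snd_nth)+
  note v = ham_vecI[OF assms _ this(1)] ham_vecI[OF assms _ this(2)]
  have k: "2 * pi / (\<alpha> + 1) * ((\<alpha> + 1) / (2 * pi)) = 1" "2 * pi / \<alpha> * (\<alpha> / (2 * pi)) = 1"
    using assms by simp_all
  have V: "ham_vec \<alpha> (\<lambda>x. (\<alpha> + 1) / (2 * pi) * fst x $ 1) x (cross3 (axis 1 1) (fst x), 0)"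
    "ham_vec \<alpha> (\<lambda>x. \<alpha> / (2 * pi) * snd x $ 1) x (0, cross3 (axis 1 1) (snd x))" if "x \<in> S2xS2" for x
    using v(1)[OF that, of "(\<alpha> + 1) / (2 * pi)"] v(2)[OF that, of "\<alpha> / (2 * pi)"]
    unfolding cross_mult_left scaleR_scaleR k cross_zero_left by simp_all
  have s: "smooth_on S2xS2 (\<lambda>x :: (real^3) \<times> (real^3). k * fst x $ 1)"
    "smooth_on S2xS2 (\<lambda>x :: (real^3) \<times> (real^3). k * snd x $ 1)" for k
    by (rule smooth_on_Cinf[OF Cinf_on_mult[OF Cinf_on_const[OF open_UNIV]
            Cinf_on_linear[OF open_UNIV bounded_linear_fst_nth]] subset_UNIV]
        smooth_on_Cinf[OF Cinf_on_mult[OF Cinf_on_const[OF open_UNIV]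
            Cinf_on_linear[OF open_UNIV bounded_linear_snd_nth]] subset_UNIV])+
  have 1: "(rotate_x s (fst x), snd x) \<in> S2xS2" "(fst x, rotate_x s (snd x)) \<in> S2xS2" if "x \<in> S2xS2" for s x
    using that rotate_x_S2[of "fst x" s] rotate_x_S2[of "snd x" s] by (simp_all add: S2xS2_def mem_Times_iff)
  have 2: "((\<lambda>s. (rotate_x s (fst x), snd x)) has_vector_derivative
      (cross3 (axis 1 1) (fst (rotate_x s (fst x), snd x)), 0)) (at s)"
    "((\<lambda>s. (fst x, rotate_x s (snd x))) has_vector_derivative
      (0, cross3 (axis 1 1) (snd (fst x, rotate_x s (snd x))))) (at s)" for s x
    unfolding fst_conv snd_conv
    by (intro has_vector_derivative_Pair has_vector_derivative_rotate_x has_vector_derivative_const)+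
  show "ham_flow \<alpha> (\<lambda>x. (\<alpha> + 1) / (2 * pi) * fst x $ 1) (\<lambda>s x. (rotate_x s (fst x), snd x))"
    unfolding ham_flow_def using s(1) 1(1) 2(1) V(1)[OF 1(1)]
    by (intro conjI ballI allI exI) (simp_all only: rotate_x_0 prod.collapse)
  show "ham_flow \<alpha> (\<lambda>x. \<alpha> / (2 * pi) * snd x $ 1) (\<lambda>s x. (fst x, rotate_x s (snd x)))"
    unfolding ham_flow_def using s(2) 1(2) 2(2) V(2)[OF 1(2)]
    by (intro conjI ballI allI exI) (simp_all only: rotate_x_0 prod.collapse)
qed

lemma image_eq_if_involution:
  assumes "\<And>x. x \<in> A \<Longrightarrow> f x \<in> B" "\<And>x. x \<in> B \<Longrightarrow> f x \<in> A" "\<And>x. f (f x) = x"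
  shows "f ` A = B"
  using assms by (metis image_subsetI imageI subsetI subset_antisym)

lemma reflect_moves:
  assumes \<alpha>: "\<alpha> > 0" and x: "x \<in> {-1 - \<alpha><..<1 + \<alpha>}" and y: "y \<in> {-\<alpha><..<\<alpha>}"
  shows "flat_equiv \<alpha> (split_torus \<alpha> x y) (split_torus \<alpha> (- x) y)"
    and "flat_equiv \<alpha> (split_torus \<alpha> x y) (split_torus \<alpha> x (- y))"
proof -
  have x': "- x \<in> {-1 - \<alpha><..<1 + \<alpha>}" and y': "- y \<in> {-\<alpha><..<\<alpha>}" using x y by auto
  note T = split_torus_eq[OF \<alpha> x y] split_torus_eq[OF \<alpha> x' y] split_torus_eq[OF \<alpha> x y']
  have sub: "split_torus \<alpha> x y \<subseteq> S2xS2" unfolding T by blast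
  have n: "norm (rotate_x s p) = 1" if "norm p = 1" for s p using rotate_x_S2[of p s] that by simp
  have "(\<lambda>z. (rotate_x pi (fst z), snd z)) ` split_torus \<alpha> x y = split_torus \<alpha> (- x) y"
    unfolding T by (rule image_eq_if_involution)
      (auto simp: S2xS2_def rotate_x_pi n)
  with ham_flow_imp_flat_equiv[OF ham_flow_rotate(1)[OF \<alpha>] sub, of pi]
  show "flat_equiv \<alpha> (split_torus \<alpha> x y) (split_torus \<alpha> (- x) y)" by simp
  have "(\<lambda>z. (fst z, rotate_x pi (snd z))) ` split_torus \<alpha> x y = split_torus \<alpha> x (- y)"
    unfolding T by (rule image_eq_if_involution)
      (auto simp: S2xS2_def rotate_x_pi n)
  with ham_flow_imp_flat_equiv[OF ham_flow_rotate(2)[OF \<alpha>] sub, of pi]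
  show "flat_equiv \<alpha> (split_torus \<alpha> x y) (split_torus \<alpha> x (- y))" by simp
qed

section \<open>The orbit of a split torus\<close>

lemma split_torus_subset: "\<alpha> > 0 \<Longrightarrow> x \<in> {-1 - \<alpha><..<1 + \<alpha>} \<Longrightarrow> y \<in> {-\<alpha><..<\<alpha>} \<Longrightarrow> split_torus \<alpha> x y \<subseteq> S2xS2"
  by (auto simp: split_torus_eq)

lemma orbit_step:
  assumes \<alpha>: "\<alpha> > 0" and y: "0 < y" "y < \<alpha>" and x: "\<bar>x\<bar> < 1 + y" "x \<noteq> y - 1"
  defines "x' \<equiv> if x < y - 1 then x + 2 else x - 2 * y"
  shows "\<bar>x'\<bar> < 1 + y" "flat_equiv \<alpha> (split_torus \<alpha> x y) (split_torus \<alpha> x' y)"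
proof -
  show "\<bar>x'\<bar> < 1 + y" using x y by (auto simp: x'_def abs_less_iff)
  have y': "y \<in> {-\<alpha><..<\<alpha>}" "- y \<in> {-\<alpha><..<\<alpha>}" "1 + y \<in> {-1 - \<alpha><..<1 + \<alpha>}" using y by auto
  have tr: "flat_equiv \<alpha> (split_torus \<alpha> x y) C"
    if "flat_equiv \<alpha> (split_torus \<alpha> x y) B" "flat_equiv \<alpha> B C" for B C
    using that x y by (intro flat_equiv_trans[OF that] split_torus_subset \<alpha>) (auto simp: abs_less_iff)
  have x0: "x \<in> {-1 - \<alpha><..<1 + \<alpha>}" using x y by (auto simp: abs_less_iff)
  show "flat_equiv \<alpha> (split_torus \<alpha> x y) (split_torus \<alpha> x' y)"
  proof (cases "x < y - 1")
    case True
    \<comment> \<open>The chain is (x, y), (-x, y), (1 + y, -x - 1), (1 + y, x + 1), (x + 2, y). The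
      first swap asks for x < y - 1, the second for x > -1 - y.\<close>
    have d: "- x \<in> {-1 - \<alpha><..<1 + \<alpha>}" "- x - 1 \<in> {-\<alpha><..<\<alpha>}" "x + 1 \<in> {-\<alpha><..<\<alpha>}"
      using True x y by (auto simp: abs_less_iff)
    have "flat_equiv \<alpha> (split_torus \<alpha> (- x) y) (split_torus \<alpha> (1 + y) (- x - 1))"
      using True by (intro swap_move \<alpha> d y') simp
    then have "flat_equiv \<alpha> (split_torus \<alpha> x y) (split_torus \<alpha> (1 + y) (- x - 1))"
      by (rule tr[OF reflect_moves(1)[OF \<alpha> x0 y'(1)]])
    moreover have "flat_equiv \<alpha> (split_torus \<alpha> (1 + y) (- x - 1)) (split_torus \<alpha> (1 + y) (x + 1))"
      using reflect_moves(2)[OF \<alpha> y'(3) d(2)] by (simp add: add.commute)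
    ultimately have "flat_equiv \<alpha> (split_torus \<alpha> x y) (split_torus \<alpha> (1 + y) (x + 1))" by (rule tr)
    moreover have "flat_equiv \<alpha> (split_torus \<alpha> (1 + y) (x + 1)) (split_torus \<alpha> (1 + (x + 1)) (1 + y - 1))"
      using x by (intro swap_move \<alpha> d y') (auto simp: abs_less_iff)
    ultimately have "flat_equiv \<alpha> (split_torus \<alpha> x y) (split_torus \<alpha> (1 + (x + 1)) (1 + y - 1))" by (rule tr)
    moreover have "1 + (x + 1) = x'" "1 + y - 1 = y" using True by (simp_all add: x'_def)
    ultimately show ?thesis by simp
  next
    case False
    then have "flat_equiv \<alpha> (split_torus \<alpha> x y) (split_torus \<alpha> (x - 2 * y) (- y))"
      using x y by (intro shear_move \<alpha> x0 y') (auto simp: abs_less_iff)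
    moreover have "flat_equiv \<alpha> (split_torus \<alpha> (x - 2 * y) (- y)) (split_torus \<alpha> (x - 2 * y) (- (- y)))"
      using False x y by (intro reflect_moves(2) \<alpha> y') (auto simp: abs_less_iff)
    ultimately have "flat_equiv \<alpha> (split_torus \<alpha> x y) (split_torus \<alpha> (x - 2 * y) (- (- y)))" by (rule tr)
    then show ?thesis using False by (simp add: x'_def)
  qed
qed

text \<open>Both branches of a step add 2 modulo 2 + 2y; \<open>k\<close> counts how often the
  second branch was taken.\<close>

lemma orbit:
  assumes \<alpha>: "\<alpha> > 0" and y: "0 < y" "y < \<alpha>" "y \<notin> \<rat>"
  shows "\<exists>x (k::int). x = 2 * real n - (2 + 2 * y) * of_int k \<and> \<bar>x\<bar> < 1 + y \<and>
    flat_equiv \<alpha> (split_torus \<alpha> 0 y) (split_torus \<alpha> x y)"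
proof (induction n)
  case 0
  have "0 \<in> {-1 - \<alpha><..<1 + \<alpha>}" "y \<in> {-\<alpha><..<\<alpha>}" using \<alpha> y by auto
  from reflect_moves(1)[OF \<alpha> this] show ?case using y by (intro exI[of _ 0]) simp
next
  case (Suc n)
  then obtain x and k :: int where x: "x = 2 * real n - (2 + 2 * y) * of_int k" "\<bar>x\<bar> < 1 + y"
    and eq: "flat_equiv \<alpha> (split_torus \<alpha> 0 y) (split_torus \<alpha> x y)" by blast
  \<comment> \<open>Hitting the break point would give y (1 + 2k) = 2n - 2k + 1, and the odd
    coefficient of y is not zero.\<close>
  have "x \<noteq> y - 1"
  proof
    assume "x = y - 1"
    then have "y * of_int (1 + 2 * k) = of_int (2 * int n - 2 * k + 1)" using x(1) by (simp add: algebra_simps)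
    moreover have "1 + 2 * k \<noteq> 0" by presburger
    ultimately have "y = of_int (2 * int n - 2 * k + 1) / of_int (1 + 2 * k)"
      by (subst nonzero_eq_divide_eq) (simp_all only: of_int_eq_0_iff not_False_eq_True)
    then have "y \<in> \<rat>" by (metis Rats_divide Rats_of_int)
    with y(3) show False by blast
  qed
  note st = orbit_step[OF \<alpha> y(1,2) x(2) this]
  have s: "split_torus \<alpha> 0 y \<subseteq> S2xS2" using \<alpha> y by (intro split_torus_subset) auto
  define x' where "x' = (if x < y - 1 then x + 2 else x - 2 * y)"
  have "x' = 2 * real (Suc n) - (2 + 2 * y) * of_int (if x < y - 1 then k else k + 1)"
    using x(1) by (simp add: x'_def algebra_simps)
  then show ?case
    using st[folded x'_def] flat_equiv_trans[OF eq st(2) s, folded x'_def] by blast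
qed

lemma orbit_recurrent:
  assumes \<alpha>: "\<alpha> > 0" and y: "0 < y" "y < \<alpha>" "y \<notin> \<rat>" and "\<delta> > 0"
  shows "\<exists>x. 0 < \<bar>x\<bar> \<and> \<bar>x\<bar> < \<delta> \<and> \<bar>x\<bar> < 1 + y \<and> flat_equiv \<alpha> (split_torus \<alpha> 0 y) (split_torus \<alpha> x y)"
proof -
  define c where "c = 2 + 2 * y"
  have c: "c > 0" using y by (simp add: c_def)
  obtain N0 :: nat where N0: "c / \<delta> < N0" using reals_Archimedean2 by blast
  \<comment> \<open>At least 2, so that the Dirichlet residue is below half the circumference and is
    itself the representative kept by \<open>orbit\<close>.\<close>
  define N where "N = max 2 N0"
  have N: "N \<ge> 2" "c / \<delta> < N" using N0 by (auto simp: N_def)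
  obtain h k where k: "0 < k" and hk: "\<bar>of_int k * (2 / c) - of_int h\<bar> < 1 / N"
    using Dirichlet_approx[of N "2 / c"] N(1) by (metis less_le_trans zero_less_numeral)
  have "\<bar>of_int k * (2 / c) - of_int h\<bar> * c < 1 / N * c" using hk c by (intro mult_strict_right_mono)
  also have "\<bar>of_int k * (2 / c) - of_int h\<bar> * c = \<bar>(of_int k * (2 / c) - of_int h) * c\<bar>"
    using c by (simp add: abs_mult)
  also have "(of_int k * (2 / c) - of_int h) * c = 2 * of_int k - c * of_int h"
    using c by (simp add: left_diff_distrib)
  finally have small: "\<bar>2 * of_int k - c * of_int h\<bar> < c / N" by simp
  obtain x and h' :: int where x: "x = 2 * real (nat k) - c * of_int h'" "\<bar>x\<bar> < 1 + y"
    and eq: "flat_equiv \<alpha> (split_torus \<alpha> 0 y) (split_torus \<alpha> x y)"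
    using orbit[OF \<alpha> y, of "nat k"] unfolding c_def by blast
  have xk: "x = 2 * of_int k - c * of_int h'" using x(1) k by simp
  have "c / N \<le> c / 2" using N(1) c by (intro divide_left_mono) auto
  then have "\<bar>2 * of_int k - c * of_int h\<bar> < c / 2" by (rule less_le_trans[OF small])
  moreover have "\<bar>x\<bar> < c / 2" using x(2) by (simp add: c_def)
  \<comment> \<open>Both numbers represent the same point of the circle, so their difference is a
    multiple of c; being smaller than c, it is 0.\<close>
  ultimately have "\<bar>(2 * of_int k - c * of_int h) - x\<bar> < c"
    using abs_triangle_ineq4[of "2 * of_int k - c * of_int h" x] by linarith
  also have "(2 * of_int k - c * of_int h) - x = c * of_int (h' - h)" unfolding xk by (simp add: algebra_simps)
  finally have "c * \<bar>of_int (h' - h)\<bar> < c * 1" using c by (simp add: abs_mult)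
  then have "\<bar>of_int (h' - h) :: real\<bar> < 1" using c by (simp only: mult_less_cancel_left_pos)
  then have "h' = h" by linarith
  then have "\<bar>x\<bar> < c / N" using small xk by simp
  also have "c / N < \<delta>" using N assms(5) by (simp add: field_simps)
  finally have "\<bar>x\<bar> < \<delta>" .
  moreover have "x \<noteq> 0"
  proof
    assume "x = 0"
    then have e: "2 * of_int k = c * of_int h'" using xk by simp
    then have "h' \<noteq> 0" using k by auto
    moreover have "y * of_int h' = of_int (k - h')" using e by (simp add: c_def algebra_simps)
    ultimately have "y = of_int (k - h') / of_int h'"
      by (subst nonzero_eq_divide_eq) (simp_all only: of_int_eq_0_iff not_False_eq_True)
    then have "y \<in> \<rat>" by (metis Rats_divide Rats_of_int)
    with y(3) show False by blast
  qed
  ultimately show ?thesis using x(2) eq by (intro exI[of _ x]) simp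
qed

section \<open>From recurrence on the circle to tori inside a given neighbourhood\<close>

theorem corollary1p10:
  fixes \<alpha> :: real
  assumes "\<alpha> > 0"
  shows "\<exists>L\<in>split_tori \<alpha>. \<forall>W. weinstein_nbhd S2xS2 (omega \<alpha>) L W \<longrightarrow>
     (\<exists>L'\<in>split_tori \<alpha>. L' \<subseteq> W \<and> ham_equiv S2xS2 (omega \<alpha>) L L' \<and> L \<inter> L' = {}) \<and>
     infinite {L'\<in>split_tori \<alpha>. L' \<subseteq> W \<and> ham_equiv S2xS2 (omega \<alpha>) L L' \<and> L \<inter> L' = {}}"
proof -
  note \<alpha> = assms
  have "uncountable ({0<..<\<alpha>} - \<rat>)"
    using \<alpha> by (intro uncountable_minus_countable countable_rat) (simp add: uncountable_open_interval)
  then have "{0<..<\<alpha>} - \<rat> \<noteq> {}" by (metis countable_empty)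
  then obtain y where "y \<in> {0<..<\<alpha>}" "y \<notin> \<rat>" by blast
  then have y: "0 < y" "y < \<alpha>" "y \<notin> \<rat>" by simp_all
  then have y': "y \<in> {-\<alpha><..<\<alpha>}" by simp
  have T: "split_torus \<alpha> x y = {z \<in> S2xS2. fst z $ 3 = x / (\<alpha> + 1) \<and> snd z $ 3 = y / \<alpha>}"
    if "\<bar>x\<bar> < 1 + y" for x
    using that y by (intro split_torus_eq \<alpha> y') (auto simp: abs_less_iff)
  have tori: "split_torus \<alpha> x y \<in> split_tori \<alpha>" if "\<bar>x\<bar> < 1 + y" for x
    using that y y' unfolding split_tori_def by (intro CollectI exI[of _ x] exI[of _ y]) (auto simp: abs_less_iff)
  \<comment> \<open>Disjointness separates tori with different parameters only because they are
    nonempty; this is what makes the parametrisation injective below.\<close>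
  have ne: "split_torus \<alpha> x y \<noteq> {}" if "\<bar>x\<bar> < 1 + y" for x
  proof -
    define a where "a = x / (\<alpha> + 1)"
    define b where "b = y / \<alpha>"
    have "\<bar>a\<bar> \<le> 1" "\<bar>b\<bar> \<le> 1" using that y \<alpha> by (auto simp: a_def b_def abs_mult field_simps)
    then have "a\<^sup>2 \<le> 1" "b\<^sup>2 \<le> 1" by (simp_all add: abs_square_le_1)
    then have "vector [sqrt (1 - a\<^sup>2), 0, a] \<in> S2" "vector [sqrt (1 - b\<^sup>2), 0, b] \<in> S2"
      unfolding vector_in_S2_iff by simp_all
    then have "(vector [sqrt (1 - a\<^sup>2), 0, a], vector [sqrt (1 - b\<^sup>2), 0, b]) \<in> split_torus \<alpha> x y"
      unfolding T[OF that] S2xS2_def a_def[symmetric] b_def[symmetric]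
      by (simp only: mem_Collect_eq mem_Times_iff fst_conv snd_conv vector_3 simp_thms)
    then show ?thesis by blast
  qed
  have disj: "split_torus \<alpha> x y \<inter> split_torus \<alpha> x' y = {}" if "\<bar>x\<bar> < 1 + y" "\<bar>x'\<bar> < 1 + y" "x \<noteq> x'" for x x'
    unfolding T[OF that(1)] T[OF that(2)] using that(3) \<alpha> by auto
  let ?L = "split_torus \<alpha> 0 y"
  have y0: "\<bar>0\<bar> < 1 + y" using y by simp
  show ?thesis
  proof (rule bexI[OF _ tori[OF y0]], intro allI impI)
    fix W assume "weinstein_nbhd S2xS2 (omega \<alpha>) ?L W"
    then have W: "openin (top_of_set S2xS2) W" "?L \<subseteq> W" by (auto simp: weinstein_nbhd_def)
    \<comment> \<open>Measures how far the heights are from those of the torus. Its minimum over the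
      compact complement of W is positive, so W contains a tube described by heights alone.\<close>
    define d where "d z = \<bar>fst z $ 3\<bar> + \<bar>snd z $ 3 - y / \<alpha>\<bar>" for z :: "(real^3) \<times> (real^3)"
    have "compact S2xS2" unfolding S2xS2_def by (intro compact_Times compact_sphere)
    moreover have "closedin (top_of_set S2xS2) (S2xS2 - W)" using W(1) by (simp add: closedin_diff)
    ultimately have K: "compact (S2xS2 - W)" by (rule closedin_compact)
    have "\<exists>\<delta>>0. \<forall>z\<in>S2xS2 - W. \<delta> \<le> d z"
    proof (cases "S2xS2 - W = {}")
      case False
      have "continuous_on (S2xS2 - W) d" unfolding d_def by (intro continuous_intros)
      from continuous_attains_inf[OF K False this] obtain z where
        z: "z \<in> S2xS2 - W" "\<forall>w\<in>S2xS2 - W. d z \<le> d w" by blast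
      have "d z \<noteq> 0"
      proof
        assume "d z = 0"
        then have "fst z $ 3 = 0" "snd z $ 3 = y / \<alpha>" unfolding d_def by linarith+
        then have "z \<in> ?L" using z(1) unfolding T[OF y0] by simp
        with W(2) z(1) show False by blast
      qed
      then have "d z > 0" by (simp add: d_def less_le)
      with z(2) show ?thesis by blast
    qed (auto intro: exI[of _ 1])
    then obtain \<delta> where \<delta>: "\<delta> > 0" "\<And>z. z \<in> S2xS2 \<Longrightarrow> d z < \<delta> \<Longrightarrow> z \<in> W" by force
    define S where "S = {x. 0 < \<bar>x\<bar> \<and> \<bar>x\<bar> < \<delta> \<and> \<bar>x\<bar> < 1 + y \<and> flat_equiv \<alpha> ?L (split_torus \<alpha> x y)}"
    have "infinite S"
    proof
      assume fin: "finite S"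
      \<comment> \<open>A radius no larger than \<delta> or any parameter found so far; recurrence
        within it yields a parameter outside the supposedly finite set.\<close>
      define m where "m = Min (insert \<delta> (abs ` S))"
      have "m > 0" using fin \<delta>(1) unfolding m_def by (subst Min_gr_iff) (auto simp: S_def)
      from orbit_recurrent[OF \<alpha> y this] obtain x where
        x: "0 < \<bar>x\<bar>" "\<bar>x\<bar> < m" "\<bar>x\<bar> < 1 + y" "flat_equiv \<alpha> ?L (split_torus \<alpha> x y)" by blast
      have "m \<le> \<delta>" using fin unfolding m_def by simp
      then have "x \<in> S" using x by (simp add: S_def)
      then have "m \<le> \<bar>x\<bar>" using fin unfolding m_def by (intro Min_le) auto
      with x(2) show False by simp
    qed
    moreover have "inj_on (\<lambda>x. split_torus \<alpha> x y) S"
    proof (rule inj_onI, rule ccontr)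
      fix x x' assume "x \<in> S" "x' \<in> S" and eq: "split_torus \<alpha> x y = split_torus \<alpha> x' y" and "x \<noteq> x'"
      then have x: "\<bar>x\<bar> < 1 + y" "\<bar>x'\<bar> < 1 + y" by (simp_all add: S_def)
      from disj[OF this \<open>x \<noteq> x'\<close>] ne[OF x(1)] eq show False by simp
    qed
    ultimately have "infinite ((\<lambda>x. split_torus \<alpha> x y) ` S)" by (simp add: finite_image_iff)
    moreover have "(\<lambda>x. split_torus \<alpha> x y) ` S \<subseteq>
        {L'\<in>split_tori \<alpha>. L' \<subseteq> W \<and> ham_equiv S2xS2 (omega \<alpha>) ?L L' \<and> ?L \<inter> L' = {}}"
    proof (intro image_subsetI CollectI conjI)
      fix x assume "x \<in> S"
      then have x: "x \<noteq> 0" "\<bar>x\<bar> < \<delta>" "\<bar>x\<bar> < 1 + y" "flat_equiv \<alpha> ?L (split_torus \<alpha> x y)" by (auto simp: S_def)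
      show "split_torus \<alpha> x y \<in> split_tori \<alpha>" by (rule tori[OF x(3)])
      show "ham_equiv S2xS2 (omega \<alpha>) ?L (split_torus \<alpha> x y)" by (rule flat_equiv_imp_ham_equiv[OF x(4)])
      show "?L \<inter> split_torus \<alpha> x y = {}" using x y0 by (intro disj) auto
      \<comment> \<open>The height of the first factor is the moment coordinate divided by \<alpha>
        + 1 > 1, so the bound \<delta> on x also bounds \<open>d\<close>.\<close>
      have "\<bar>x / (\<alpha> + 1)\<bar> \<le> \<bar>x\<bar>" using \<alpha> by (simp add: abs_mult divide_le_eq mult_le_cancel_left1)
      then show "split_torus \<alpha> x y \<subseteq> W"
        using x(2) unfolding T[OF x(3)] by (intro subsetI \<delta>(2)) (auto simp: d_def)
    qed
    ultimately have inf: "infinite {L'\<in>split_tori \<alpha>. L' \<subseteq> W \<and> ham_equiv S2xS2 (omega \<alpha>) ?L L' \<and> ?L \<inter> L' = {}}"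
      using finite_subset by blast
    then have "{L'\<in>split_tori \<alpha>. L' \<subseteq> W \<and> ham_equiv S2xS2 (omega \<alpha>) ?L L' \<and> ?L \<inter> L' = {}} \<noteq> {}"
      by (metis finite.emptyI)
    with inf show "(\<exists>L'\<in>split_tori \<alpha>. L' \<subseteq> W \<and> ham_equiv S2xS2 (omega \<alpha>) ?L L' \<and> ?L \<inter> L' = {}) \<and>
      infinite {L'\<in>split_tori \<alpha>. L' \<subseteq> W \<and> ham_equiv S2xS2 (omega \<alpha>) ?L L' \<and> ?L \<inter> L' = {}}" by auto
  qed
qed

end
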